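(* Let $U=[a_1,b_1]\cup\dots\cup[a_k,b_k]\subseteq\mathbb{R}$ with $a_1\le b_1<a_2\le b_2<\dots<a_k\le b_k$, let $S=\{x-a_1,\ (x-a_2)(x-b_1),\ \dots,\ (x-a_k)(x-b_{k-1}),\ b_k-x\}$, and let $M$ be the quadratic module in $\mathbb{R}[x,y]$ generated by $S$. Then $M$ is saturated: every $f\in\mathbb{R}[x,y]$ with $f(x,y)\ge 0$ for all $(x,y)\in U\times\mathbb{R}$ belongs to $M$.
   Context: The quadratic module generated by $S=\{s_1,\dots,s_m\}\subseteq\mathbb{R}[x,y]$ is the set of all $\sigma_0+\sigma_1s_1+\dots+\sigma_ms_m$ with each $\sigma_i$ a sum of squares of polynomials in $\mathbb{R}[x,y]$. It is called saturated if it contains every polynomial that is non-negative on the set $\{p\in\mathbb{R}^2: s_i(p)\ge0 \text{ for all } i\}$ (here $U\times\mathbb{R}$). *)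

theory Defs
  imports "HOL-Computational_Algebra.Polynomial"
begin

text \<open>Polynomials in R[x,y] are represented as polynomials in y whose
  coefficients are polynomials in x: R[x,y] = (R[x])[y].\<close>

type_synonym bpoly = "real poly poly"

definition eval2 :: "bpoly \<Rightarrow> real \<Rightarrow> real \<Rightarrow> real" where
  "eval2 f x y = poly (map_poly (\<lambda>c. poly c x) f) y"

definition const2 :: "real \<Rightarrow> bpoly" where
  "const2 c = [:[:c:]:]"

definition varX :: bpoly where
  "varX = [:[:0, 1:]:]"

definition varY :: bpoly where
  "varY = [:0, 1:]"

definition is_sos :: "bpoly \<Rightarrow> bool" where
  "is_sos s \<longleftrightarrow> (\<exists>ps. s = sum_list (map (\<lambda>p. p ^ 2) ps))"

definition qmodule :: "bpoly list \<Rightarrow> bpoly set" where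
  "qmodule gs = {f. \<exists>s0 ss. is_sos s0 \<and> length ss = length gs \<and> (\<forall>s\<in>set ss. is_sos s)
      \<and> f = s0 + sum_list (map2 (*) ss gs)}"

text \<open>Generators for U = [a 0, b 0] \<union> ... \<union> [a (k-1), b (k-1)] (0-indexed):
  x - a_0, (x - a_(i+1))(x - b_i) for i < k-1, b_(k-1) - x.\<close>
definition gens :: "nat \<Rightarrow> (nat \<Rightarrow> real) \<Rightarrow> (nat \<Rightarrow> real) \<Rightarrow> bpoly list" where
  "gens k a b = [varX - const2 (a 0)]
     @ map (\<lambda>i. (varX - const2 (a (Suc i))) * (varX - const2 (b i))) [0..<k - 1]
     @ [const2 (b (k - 1)) - varX]"

end

(* Idea. A polynomial f >= 0 on U x R may be assumed to have no square factor; then f stays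
   non-negative on U x R after subtracting a reserve h(x) S(y), where h >= 0 has finitely many zeros
   and S is a sum of even powers of y.  Near each point c of the convex hull of U, the remainder f2
   agrees with an element of M to arbitrarily high order in x - c: at points of U this is Puiseux
   theory, since a polynomial over R((t)) that is non-negative for both orderings of R((t)) is a sum
   of two squares (the substitution t = s^2 handles end points), and these squares automatically
   have integral coefficients; outside U some generator is negative.  Gluing the local
   representations along [min U, max U] with polynomial weights that approximate step functions up
   to a multiple of h leaves an error that the reserve absorbs. *)
theory Submission
  imports Defs
    "HOL-Computational_Algebra.Computational_Algebra"
    "HOL-Computational_Algebra.Field_as_Ring"
    "HOL-Analysis.Analysis"
begin

subsection \<open>Ring homomorphisms and polynomials\<close>

text \<open>The strip U x R is not compact, so closeness is measured coefficientwise in y. Gluing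
  must therefore keep the y-degree of every local representation within one bound 2d, and S holds
  the even powers that dominate y^k for k <= 2d. Leading terms of squares over the real Laurent
  series cannot cancel, so the local squares inherit this bound from f2. Square factors have to go
  because f may vanish along a whole curve in U x R, where nothing can be subtracted; without them
  some nonzero D in R[x] lies in the ideal of f and its y-derivative, and h is built from D and the
  leading coefficient of f. At a zero of h the representation must match to higher order than h
  vanishes. These orders are finite, so congruences modulo a power of x - c suffice and series may
  be truncated. Two squares arise by factoring over complex Puiseux series: a factor that is not
  self-conjugate pairs with its conjugate to A^2 + B^2, and a self-conjugate one has a real Puiseux
  root for one of the two orderings, so it occurs squared.\<close>

locale rhom =
  fixes h :: "'a::idom \<Rightarrow> 'b::idom"
  assumes add: "h (a + b) = h a + h b" and mult: "h (a * b) = h a * h b" and one: "h 1 = 1"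
begin

lemma zero: "h 0 = 0"
proof -
  have "h 0 + h 0 = h 0 + 0" using add[of 0 0] by simp
  then show ?thesis by (rule add_left_imp_eq)
qed

lemma uminus: "h (- a) = - h a"
  using add[of a "- a"] by (simp add: zero eq_neg_iff_add_eq_0 add.commute)

lemma diff: "h (a - b) = h a - h b"
  using add[of a "- b"] by (simp add: uminus)

lemma sum: "h (\<Sum>i\<in>A. f i) = (\<Sum>i\<in>A. h (f i))"
  by (induction A rule: infinite_finite_induct) (auto simp: zero add)

lemma power: "h (a ^ n) = h a ^ n"
  by (induction n) (auto simp: one mult)

lemma coeff_map: "coeff (map_poly h p) i = h (coeff p i)"
  by (simp add: coeff_map_poly zero)

lemma poly_map: "poly (map_poly h p) (h x) = h (poly p x)"
  by (induction p) (simp_all add: map_poly_pCons zero add mult)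

lemma map_poly_add: "map_poly h (p + q) = map_poly h p + map_poly h q"
  by (rule poly_eqI) (simp add: coeff_map add)

lemma map_poly_diff: "map_poly h (p - q) = map_poly h p - map_poly h q"
  by (rule poly_eqI) (simp add: coeff_map diff)

lemma map_poly_mult: "map_poly h (p * q) = map_poly h p * map_poly h q"
  by (rule poly_eqI) (simp add: coeff_map coeff_mult sum mult)

lemma map_poly_one: "map_poly h 1 = 1"
  by (simp add: one)

lemma map_poly_power: "map_poly h (p ^ n) = map_poly h p ^ n"
  by (induction n) (simp_all add: one map_poly_mult)

lemma map_poly_dvd: "p dvd q \<Longrightarrow> map_poly h p dvd map_poly h q"
  by (auto simp: map_poly_mult elim!: dvdE)

lemma map_poly_pderiv: "map_poly h (pderiv p) = pderiv (map_poly h p)"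
proof (rule poly_eqI)
  fix n
  have nat: "h (of_nat k) = of_nat k" for k
    by (induction k) (simp_all add: zero one add)
  then show "coeff (map_poly h (pderiv p)) n = coeff (pderiv (map_poly h p)) n"
    by (simp only: coeff_map coeff_pderiv mult nat)
qed


end

locale fhom = rhom h for h :: "'a::field \<Rightarrow> 'b::field"
begin

lemma eq_0_iff: "h a = 0 \<longleftrightarrow> a = 0"
proof
  assume "h a = 0"
  then have "h (a * inverse a) = 0" by (simp add: mult)
  then show "a = 0" using one zero by (cases "a = 0") auto
qed (simp add: zero)

lemma inverse: "h (inverse a) = inverse (h a)"
proof (cases "a = 0")
  case False
  then have "h a * h (inverse a) = 1" by (simp flip: mult add: one)
  then show ?thesis using False by (metis inverse_unique)
qed (simp add: zero)

lemma degree_map: "degree (map_poly h p) = degree p"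
  by (rule degree_map_poly) (simp add: eq_0_iff)

lemma map_poly_eq_0: "map_poly h p = 0 \<longleftrightarrow> p = 0"
  by (metis eq_0_iff coeff_map leading_coeff_0_iff degree_map map_poly_0)

end

subsection \<open>Hensel's lemma\<close>

text \<open>Reducing the cofactor of \<open>h\<close> modulo \<open>g\<close> makes \<open>a\<close>
  small; \<open>b\<close> is then small too, since a large \<open>g * b\<close> could not cancel
  against \<open>h * a\<close> and \<open>r\<close>. In Hensel's lemma these bounds keep the factors
  at their original degrees.\<close>

lemma coprime_bezout_degree:
  fixes g h r :: "'a::{field_gcd} poly"
  assumes "coprime g h" "degree r < degree g + degree h" "degree g > 0"
  shows "\<exists>a b. r = g * b + h * a \<and> degree a < degree g \<and> (b = 0 \<or> degree b < degree h)"
proof -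
  obtain u v where "u * g + v * h = 1"
    using assms(1) bezout_coefficients_fst_snd[of g h] by (metis coprime_imp_gcd_eq_1)
  then have "r * (u * g + v * h) = r" by simp
  then have r: "r = r * u * g + r * v * h"
    by (simp add: algebra_simps)
  define a where "a = (r * v) mod g"
  define b where "b = r * u + h * ((r * v) div g)"
  have "r * v = g * ((r * v) div g) + a" by (simp add: a_def)
  then have "h * (r * v) = h * (g * ((r * v) div g) + a)" by (rule arg_cong)
  then have e: "r = g * b + h * a"
    using r by (simp add: b_def ring_distribs ac_simps)
  have da: "degree a < degree g"
    unfolding a_def using assms(3) degree_mod_less[of g "r * v"] by (cases "g = 0") auto
  have "b = 0 \<or> degree b < degree h"
  proof (rule ccontr)
    assume "\<not> ?thesis"
    then have b: "b \<noteq> 0" "degree b \<ge> degree h" by auto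
    have "degree (h * a) < degree g + degree h" 
      using degree_mult_le[of h a] da by linarith
    moreover have "degree (g * b) \<ge> degree g + degree h"
      using b assms(3) by (subst degree_mult_eq) auto
    ultimately have "degree (g * b + h * a) = degree (g * b)"
      by (intro degree_add_eq_left) auto
    then show False using e assms(2) \<open>degree (g * b) \<ge> degree g + degree h\<close> by simp
  qed
  with e da show ?thesis by blast
qed

text \<open>The pair at k holds the coefficients of \<open>t^k\<close> in the two factors;
  \<open>st\<close> solves the linear equation for it, given the part of the product that involves
  earlier pairs only. The indices 0 and k are left out of the sum because there the unknowns meet
  the constant terms, which are prescribed as \<open>g\<close> and \<open>h\<close> in the proof
  below.\<close>

function hensel_seq :: "('a::comm_ring_1 poly \<Rightarrow> 'a poly \<times> 'a poly) \<Rightarrow> (nat \<Rightarrow> 'a poly) \<Rightarrow> nat \<Rightarrow> 'a poly \<times> 'a poly" where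
  "hensel_seq st q k = st (q k - (\<Sum>i\<in>{1..<k}. fst (hensel_seq st q i) * snd (hensel_seq st q (k - i))))"
  by auto
termination by (relation "Wellfounded.measure (\<lambda>(st, q, k). k)") auto

declare hensel_seq.simps [simp del]

text \<open>Comparing coefficients of \<open>t^k\<close> in \<open>Q = G * H\<close> leaves
  \<open>g * H_k + h * G_k = R_k\<close> with \<open>R_k\<close> known. As \<open>Q\<close> is
  monic, \<open>R_k\<close> has degree below that of \<open>Q\<close>, and the solution with
  \<open>degree G_k < degree g\<close> leaves \<open>G\<close> monic.\<close>

theorem hensel:
  fixes Q :: "'a::field_gcd fps poly"
  assumes Q: "lead_coeff Q = 1" and gh: "map_poly (\<lambda>c. fps_nth c 0) Q = g * h"
    and cop: "coprime g h" and g: "lead_coeff g = 1" "degree g > 0"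
  shows "\<exists>G. G dvd Q \<and> degree G = degree g \<and> lead_coeff G = 1"
proof -
  define q where "q k = map_poly (\<lambda>c. fps_nth c k) Q" for k
  have qc: "coeff (q k) i = fps_nth (coeff Q i) k" for k i
    by (simp add: q_def coeff_map_poly)
  define d where "d = degree Q"
  have q0: "degree (q 0) = d" "lead_coeff (q 0) = 1"
  proof -
    have "coeff (q 0) d = 1" by (simp add: qc d_def Q)
    moreover have "degree (q 0) \<le> d"
      by (rule degree_le) (auto simp: qc d_def coeff_eq_0)
    ultimately show "degree (q 0) = d" "lead_coeff (q 0) = 1"
      using le_degree[of "q 0" d] by (auto simp: le_antisym)
  qed
  have gh': "q 0 = g * h" using gh by (simp add: q_def)
  have h1: "lead_coeff h = 1" using q0(2) g by (simp add: gh' lead_coeff_mult)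
  have dsum: "d = degree g + degree h"
  proof -
    have "degree (g * h) = degree g + degree h"
      using g h1 by (intro degree_mult_eq) auto
    then show ?thesis using q0 gh' by simp
  qed
  define m where "m = degree g"
  define e where "e = degree h"
  define st where "st r = (SOME (ab::'a poly \<times> 'a poly). r = g * snd ab + h * fst ab \<and> degree (fst ab) < m \<and> (snd ab = 0 \<or> degree (snd ab) < e))" for r
  have st: "r = g * snd (st r) + h * fst (st r) \<and> degree (fst (st r)) < m \<and> (snd (st r) = 0 \<or> degree (snd (st r)) < e)"
    if r: "degree r < d" for r
  proof -
    from coprime_bezout_degree[OF cop, of r] r dsum g
    obtain a b where "r = g * b + h * a \<and> degree a < m \<and> (b = 0 \<or> degree b < e)"
      unfolding m_def e_def by auto
    then have "\<exists>ab::'a poly \<times> 'a poly. r = g * snd ab + h * fst ab \<and> degree (fst ab) < m \<and> (snd ab = 0 \<or> degree (snd ab) < e)"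
      by (intro exI[of _ "(a, b)"]) auto
    then show ?thesis unfolding st_def by (rule someI_ex)
  qed
  define s where "s = hensel_seq st q"
  define G where "G k = (if k = 0 then g else fst (s k))" for k
  define H where "H k = (if k = 0 then h else snd (s k))" for k
  have dq: "degree (q k) < d" if "k > 0" for k
  proof -
    have "coeff (q k) i = 0" if "i \<ge> d" for i
    proof (cases "i = d")
      case True then show ?thesis using Q \<open>k > 0\<close> by (simp add: qc d_def)
    next
      case False then show ?thesis using that by (simp add: qc d_def coeff_eq_0)
    qed
    moreover have "d > 0" using dsum g by simp
    ultimately show ?thesis
    proof (cases "q k = 0")
      case False
      then have "coeff (q k) (degree (q k)) \<noteq> 0" by simp
      then show ?thesis using \<open>\<And>i. d \<le> i \<Longrightarrow> coeff (q k) i = 0\<close> by (meson not_le)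
    qed simp
  qed
  define R where "R k = q k - (\<Sum>i\<in>{1..<k}. G i * H (k - i))" for k
  have sk: "s k = st (R k)" if "k > 0" for k
  proof -
    have "s k = st (q k - (\<Sum>i\<in>{1..<k}. fst (s i) * snd (s (k - i))))"
      unfolding s_def by (subst hensel_seq.simps) simp
    also have "(\<Sum>i\<in>{1..<k}. fst (s i) * snd (s (k - i))) = (\<Sum>i\<in>{1..<k}. G i * H (k - i))"
      by (intro sum.cong) (auto simp: G_def H_def)
    finally show ?thesis by (simp add: R_def)
  qed
  have main: "q k = (\<Sum>i\<le>k. G i * H (k - i)) \<and> (k > 0 \<longrightarrow> degree (G k) < m \<and> (H k = 0 \<or> degree (H k) < e))" for k
  proof (induction k rule: less_induct)
    case (less k)
    show ?case
    proof (cases "k = 0")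
      case True then show ?thesis by (simp add: gh' G_def H_def)
    next
      case False
      have "degree (R k) < d"
      proof -
        have "degree (G i * H (k - i)) < d" if "i \<in> {1..<k}" for i
        proof (cases "H (k - i) = 0")
          case True then show ?thesis using dsum g by simp
        next
          case nz: False
          have "degree (G i) < m" "degree (H (k - i)) < e" using less[of i] less[of "k - i"] that nz by auto
          then show ?thesis using degree_mult_le[of "G i" "H (k - i)"] dsum by (simp add: m_def e_def)
        qed
        then have "degree (\<Sum>i\<in>{1..<k}. G i * H (k - i)) < d"
          using dsum g by (intro degree_sum_less) auto
        then show ?thesis unfolding R_def using dq[of k] False by (intro degree_diff_less) auto
      qed
      from st[OF this] sk[of k] False
      have *: "R k = g * H k + h * G k" "degree (G k) < m" "H k = 0 \<or> degree (H k) < e"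
        by (auto simp: G_def H_def)
      have "(\<Sum>i\<le>k. G i * H (k - i)) = G 0 * H k + (\<Sum>i\<in>{1..<k}. G i * H (k - i)) + G k * H 0"
      proof -
        have "{..k} = insert 0 (insert k {1..<k})" using False by auto
        then show ?thesis using False by (simp add: algebra_simps)
      qed
      also have "\<dots> = q k" using *(1) by (simp add: R_def G_def H_def algebra_simps)
      finally show ?thesis using * by simp
    qed
  qed
  \<comment> \<open>\<open>mk\<close> transposes: a sequence of polynomials, indexed by the power of
    the series variable, becomes one polynomial with series coefficients.\<close>
  define mk where "mk n (F :: nat \<Rightarrow> 'a poly) = (\<Sum>i\<le>n. monom (Abs_fps (\<lambda>k. coeff (F k) i)) i)" for n and F :: "nat \<Rightarrow> 'a poly"
  have mkc: "fps_nth (coeff (mk n F) i) k = coeff (F k) i" if "\<And>k. degree (F k) \<le> n" for n F i k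
  proof -
    have "coeff (mk n F) i = (if i \<le> n then Abs_fps (\<lambda>k. coeff (F k) i) else 0)"
      by (simp add: mk_def coeff_sum sum.delta' if_distrib cong: if_cong)
    then show ?thesis using that[of k] by (auto simp: coeff_eq_0)
  qed
  have dG: "degree (G k) \<le> m" for k using main[of k] by (cases "k = 0") (auto simp: G_def m_def)
  have dH: "degree (H k) \<le> e" for k using main[of k] by (cases "k = 0") (auto simp: H_def e_def)
  have "Q = mk m G * mk e H"
  proof (rule poly_eqI, rule fps_ext)
    fix n k
    have "fps_nth (coeff (mk m G * mk e H) n) k
        = (\<Sum>i\<le>n. \<Sum>j\<le>k. coeff (G j) i * coeff (H (k - j)) (n - i))"
      by (simp add: coeff_mult fps_sum_nth fps_mult_nth atLeast0AtMost mkc[of G m, OF dG] mkc[of H e, OF dH])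
    also have "\<dots> = (\<Sum>j\<le>k. \<Sum>i\<le>n. coeff (G j) i * coeff (H (k - j)) (n - i))"
      by (rule sum.swap)
    also have "\<dots> = coeff (q k) n"
      using main[of k] by (simp add: coeff_sum coeff_mult)
    finally show "fps_nth (coeff Q n) k = fps_nth (coeff (mk m G * mk e H) n) k"
      by (simp add: qc)
  qed
  moreover have "coeff (mk m G) m = 1"
  proof (rule fps_ext)
    fix k
    show "fps_nth (coeff (mk m G) m) k = fps_nth 1 k"
      unfolding mkc[of G m, OF dG] using main[of k] g by (cases "k = 0") (auto simp: G_def m_def coeff_eq_0)
  qed
  moreover have "degree (mk m G) \<le> m"
    unfolding mk_def by (intro degree_sum_le) (auto intro: order.trans[OF degree_monom_le])
  ultimately show ?thesis
    using le_degree[of "mk m G" m] by (intro exI[of _ "mk m G"]) (auto simp: m_def le_antisym)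
qed

subsection \<open>Puiseux series roots\<close>

abbreviation ramify :: "nat \<Rightarrow> 'a::zero fls poly \<Rightarrow> 'a fls poly" where
  "ramify n \<equiv> map_poly (\<lambda>c. fls_compose_power c n)"

lemma fhom_compose_power: "n > 0 \<Longrightarrow> fhom (\<lambda>f :: 'a::field fls. fls_compose_power f n)"
  by unfold_locales auto

lemma rhom_fps_to_fls: "rhom (fps_to_fls :: 'a::field fps \<Rightarrow> 'a fls)"
  by unfold_locales (auto simp: fls_times_fps_to_fls)

lemma fls_compose_power_compose_power:
  assumes "m > 0" "n > 0"
  shows "fls_compose_power (fls_compose_power f m) n = fls_compose_power f (m * n)"
proof (rule fls_eqI)
  fix k
  have *: "int m * int n dvd k \<longleftrightarrow> int n dvd k \<and> int m dvd k div int n"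
    using assms by (metis dvd_div_iff_mult dvd_mult_right mult.commute of_nat_0_eq_iff not_gr_zero)
  have "k div (int m * int n) = k div int n div int m"
    by (metis mult.commute of_nat_0_le_iff zdiv_zmult2_eq)
  with * show "fls_nth (fls_compose_power (fls_compose_power f m) n) k = fls_nth (fls_compose_power f (m * n)) k"
    using assms by (simp add: fls_nth_compose_power)
qed

lemma subdegree_fls_compose_power:
  fixes f :: "'a::field fls"
  assumes "n > 0"
  shows "fls_subdegree (fls_compose_power f n) = int n * fls_subdegree f"
proof (cases "f = 0")
  case False
  show ?thesis
  proof (rule fls_subdegree_eqI)
    show "fls_nth (fls_compose_power f n) (int n * fls_subdegree f) \<noteq> 0"
      using assms False by (simp add: fls_nth_compose_power)
    fix k assume k: "k < int n * fls_subdegree f"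
    show "fls_nth (fls_compose_power f n) k = 0"
    proof (cases "int n dvd k")
      case True
      then have "k div int n < fls_subdegree f" using k assms by (auto elim!: dvdE)
      then show ?thesis using assms by (simp add: fls_nth_compose_power)
    qed (use assms in \<open>simp add: fls_nth_compose_power\<close>)
  qed
qed simp

lemma coeff_linear_power_sub: "coeff ([:c, 1:] ^ Suc n) n = of_nat (Suc n) * (c :: 'a::comm_ring_1)"
  by (subst coeff_linear_poly_power) simp_all

lemma coeff_linear_power_top: "coeff ([:c, 1:] ^ n) n = (1 :: 'a::comm_ring_1)"
  by (subst coeff_linear_poly_power) simp_all

text \<open>Newton's algorithm: after killing the subleading coefficient, rescale along the steepest edge
  of the Newton polygon; the reduction is then not a pure power and Hensel's lemma splits off a
  factor of smaller degree.\<close>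

lemma puiseux_step:
  fixes P :: "complex fls poly"
  assumes "degree P = d" "lead_coeff P = 1" "d > 0" "coeff P (d - 1) = 0"
    and IH: "\<And>G :: complex fls poly. 0 < degree G \<Longrightarrow> degree G < d \<Longrightarrow>
      \<exists>n>0. \<exists>\<eta>. poly (ramify n G) \<eta> = 0"
  shows "\<exists>n>0. \<exists>\<eta>. poly (ramify n P) \<eta> = 0"
proof (cases "\<exists>i<d. coeff P i \<noteq> 0")
  case False
  interpret c: fhom "\<lambda>f :: complex fls. fls_compose_power f 1" by (rule fhom_compose_power) simp
  have "coeff P 0 = 0" using False assms by auto
  then have "poly (ramify 1 P) 0 = 0" unfolding poly_0_coeff_0 c.coeff_map by simp
  then show ?thesis by (intro exI[of _ 1]) auto
next
  case True
  \<comment> \<open>With ramification d! every slope \<open>N * v(coeff P i) / (d - i)\<close>,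
    where v is the order, becomes an integer.\<close>
  define N where "N = (fact d :: nat)"
  have N: "N > 0" by (simp add: N_def)
  interpret cN: fhom "\<lambda>f :: complex fls. fls_compose_power f N" by (rule fhom_compose_power) fact
  define A where "A = {i. i < d \<and> coeff P i \<noteq> 0}"
  have A: "finite A" "A \<noteq> {}" using True by (auto simp: A_def)
  define sl where "sl i = int (N div (d - i)) * fls_subdegree (coeff P i)" for i
  define r where "r = Min (sl ` A)"
  have slN: "sl i * int (d - i) = int N * fls_subdegree (coeff P i)" if "i < d" for i
  proof -
    have "d - i dvd N" unfolding N_def using that by (intro dvd_fact) auto
    then have "int (N div (d - i)) * int (d - i) = int N" by (simp flip: of_nat_mult)
    then show ?thesis unfolding sl_def by (metis mult.commute mult.assoc)
  qed
  have "r \<in> sl ` A" unfolding r_def using A by (intro Min_in) auto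
  then obtain i0 where i0: "i0 < d" "coeff P i0 \<noteq> 0" "sl i0 = r" by (auto simp: A_def)
  have rle: "r \<le> sl i" if "i < d" "coeff P i \<noteq> 0" for i
    unfolding r_def using A that by (intro Min_le) (auto simp: A_def)
  define w :: "complex fls" where "w = fls_X_intpow r"
  have w: "w \<noteq> 0" "fls_subdegree w = r" by (auto simp: w_def)
  have iw: "inverse w = fls_X_intpow (- r)" by (simp add: w_def fls_inverse_X_intpow)
  have swk: "fls_subdegree (inverse w ^ k) = - r * int k" for k
    by (simp add: fls_subdegree_pow iw)
  \<comment> \<open>These are the coefficients of \<open>w^(-d) * P(w * y)\<close> after
    ramification. Minimality of the slope \<open>r\<close> makes all of them integral and the one at
    \<open>i0\<close> a unit.\<close>
  define C where "C i = fls_compose_power (coeff P i) N * inverse w ^ (d - i)" for i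
  have C0: "C i = 0 \<longleftrightarrow> coeff P i = 0" for i using w by (simp add: C_def cN.eq_0_iff)
  have sC: "fls_subdegree (C i) = (sl i - r) * int (d - i)" if "i < d" "coeff P i \<noteq> 0" for i
    using that w slN[OF that(1)]
    by (simp add: C_def cN.eq_0_iff swk subdegree_fls_compose_power[OF N] algebra_simps)
  have sC0: "fls_subdegree (C i) \<ge> 0" if "i \<le> d" for i
  proof (cases "i = d \<or> coeff P i = 0")
    case True
    then show ?thesis using assms(1,2) C0[of i] cN.one by (auto simp: C_def)
  next
    case False then show ?thesis using that sC[of i] rle[of i] by simp
  qed
  define Q where "Q = (\<Sum>i\<le>d. monom (fls_regpart (C i)) i)"
  have Qc: "coeff Q i = (if i \<le> d then fls_regpart (C i) else 0)" for i
    by (simp add: Q_def coeff_sum if_distrib sum.delta' cong: if_cong)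
  have Qd: "coeff Q d = 1" using assms cN.one by (simp add: Qc C_def)
  have degQ: "degree Q = d"
    using le_degree[of Q d] Qd by (intro antisym degree_le) (auto simp: Qc)
  have Qfls: "fps_to_fls (coeff Q i) = (if i \<le> d then C i else 0)" for i
    using sC0[of i] by (simp add: Qc)
  define q0 where "q0 = map_poly (\<lambda>c. fps_nth c 0) Q"
  have q0c: "coeff q0 i = fps_nth (coeff Q i) 0" for i by (simp add: q0_def coeff_map_poly)
  have q0d: "degree q0 = d" "lead_coeff q0 = 1"
  proof -
    have "coeff q0 d = 1" by (simp add: q0c Qd)
    then show "degree q0 = d" using degQ le_degree[of q0 d] by (intro antisym degree_le) (auto simp: q0c coeff_eq_0)
    with \<open>coeff q0 d = 1\<close> show "lead_coeff q0 = 1" by simp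
  qed
  have q0i0: "coeff q0 i0 \<noteq> 0"
  proof -
    have "fls_subdegree (C i0) = 0" using sC[of i0] i0 by simp
    then have "fls_nth (C i0) 0 \<noteq> 0" using C0[of i0] i0 nth_fls_subdegree_nonzero[of "C i0"] by simp
    then show ?thesis using i0 by (simp add: q0c Qc)
  qed
  have "\<not> constant (poly q0)" using q0d assms(3) by (simp add: constant_degree)
  then obtain \<alpha> where \<alpha>: "poly q0 \<alpha> = 0" using fundamental_theorem_of_algebra by blast
  have q0nz: "q0 \<noteq> 0" using q0i0 by auto
  define m where "m = order \<alpha> q0"
  obtain h where h: "q0 = [:- \<alpha>, 1:] ^ m * h" "\<not> [:- \<alpha>, 1:] dvd h"
    using order_decomp[OF q0nz, of \<alpha>] unfolding m_def by blast
  have hnz: "h \<noteq> 0" using h by auto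
  have m0: "m > 0" using \<alpha> q0nz by (simp add: m_def order_root)
  have dm: "degree ([:- \<alpha>, 1:] ^ m) = m" by (simp add: degree_power_eq)
  have md: "m + degree h = d"
  proof -
    have "degree ([:- \<alpha>, 1:] ^ m * h) = degree ([:- \<alpha>, 1:] ^ m) + degree h"
      using hnz by (intro degree_mult_eq) auto
    then show ?thesis using q0d dm h(1) by simp
  qed
  \<comment> \<open>A root \<open>\<alpha>\<close> of multiplicity d would give the subleading
    coefficient \<open>- d * \<alpha>\<close>. That coefficient vanishes, so the reduction would be
    \<open>y^d\<close>, against the nonzero coefficient at \<open>i0 < d\<close>.\<close>
  have "m < d"
  proof (rule ccontr)
    assume "\<not> m < d"
    then have "m = d" "degree h = 0" using md by auto
    then obtain c where "h = [:c:]" by (auto elim: degree_eq_zeroE)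
    have l1: "lead_coeff ([:- \<alpha>, 1:] ^ m) = 1" by (simp add: lead_coeff_power)
    then have "lead_coeff q0 = c" unfolding h(1) lead_coeff_mult by (simp add: \<open>h = [:c:]\<close>)
    then have "c = 1" using q0d(2) by simp
    then have q0e: "q0 = [:- \<alpha>, 1:] ^ d" unfolding h(1) by (simp add: \<open>h = [:c:]\<close> \<open>m = d\<close>)
    have "coeff q0 (d - 1) = of_nat d * - \<alpha>"
      using assms(3) coeff_linear_power_sub[of "- \<alpha>" "d - 1"] by (simp add: q0e)
    moreover have "coeff q0 (d - 1) = 0" using assms(4) C0[of "d - 1"] by (simp add: q0c Qc)
    ultimately have "\<alpha> = 0" using assms(3) by auto
    then have "q0 = monom 1 d" by (simp add: q0e monom_altdef)
    then show False using q0i0 i0 by simp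
  qed
  have "coprime ([:- \<alpha>, 1:] ^ m) h"
  proof -
    have "prime_elem [:- \<alpha>, 1:]" by (intro irreducible_imp_prime_elem irreducible_linear_field_poly) auto
    then have "coprime [:- \<alpha>, 1:] h" using h(2) prime_elem_imp_coprime by blast
    then show ?thesis by simp
  qed
  then obtain G where G: "G dvd Q" "degree G = m" "lead_coeff G = 1"
    using hensel[of Q "[:- \<alpha>, 1:] ^ m" h] h(1) degQ Qd dm m0 coeff_linear_power_top[of "- \<alpha>" m] by (auto simp: q0_def)
  interpret f: rhom "fps_to_fls :: complex fps \<Rightarrow> _" by (rule rhom_fps_to_fls)
  have "degree (map_poly fps_to_fls G) = m"
    using G by (subst degree_map_poly) auto
  with IH[of "map_poly fps_to_fls G"] m0 \<open>m < d\<close> obtain n \<eta> where n: "n > 0"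
    and \<eta>: "poly (ramify n (map_poly fps_to_fls G)) \<eta> = 0" by auto
  interpret cn: fhom "\<lambda>f :: complex fls. fls_compose_power f n" by (rule fhom_compose_power) fact
  have "ramify n (map_poly fps_to_fls G) dvd
     ramify n (map_poly fps_to_fls Q)"
    by (intro cn.map_poly_dvd f.map_poly_dvd G)
  with \<eta> have root: "poly (ramify n (map_poly fps_to_fls Q)) \<eta> = 0"
    by (auto elim!: dvdE)
  \<comment> \<open>The rescaling factor after the second ramification: \<open>v\<close> times a
    root of \<open>Q\<close> is a root of \<open>P\<close>, both suitably ramified.\<close>
  define v where "v = fls_compose_power w n"
  have v: "v \<noteq> 0" using w by (simp add: v_def cn.eq_0_iff)
  have "0 = v ^ d * poly (ramify n (map_poly fps_to_fls Q)) \<eta>"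
    by (simp add: root)
  also have "degree (ramify n (map_poly fps_to_fls Q)) = d"
    using degQ by (simp add: cn.degree_map degree_map_poly)
  then have "v ^ d * poly (ramify n (map_poly fps_to_fls Q)) \<eta>
     = (\<Sum>i\<le>d. v ^ d * (fls_compose_power (C i) n * \<eta> ^ i))"
    by (simp add: poly_altdef cn.coeff_map f.coeff_map Qfls sum_distrib_left)
  also have "\<dots> = (\<Sum>i\<le>d. fls_compose_power (coeff P i) (N * n) * (v * \<eta>) ^ i)"
  proof (rule sum.cong)
    fix i assume "i \<in> {..d}"
    then have "v ^ d = v ^ i * v ^ (d - i)" by (simp flip: power_add)
    moreover have "v ^ (d - i) * inverse v ^ (d - i) = 1" using v by (simp flip: power_mult_distrib)
    moreover have "fls_compose_power (C i) n = fls_compose_power (coeff P i) (N * n) * inverse v ^ (d - i)"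
      by (simp add: C_def cn.mult cn.power cn.inverse v_def fls_compose_power_compose_power[OF N n] del: power_inverse)
    ultimately show "v ^ d * (fls_compose_power (C i) n * \<eta> ^ i) = fls_compose_power (coeff P i) (N * n) * (v * \<eta>) ^ i"
      by (simp add: power_mult_distrib mult_ac del: power_inverse)
  qed simp
  also have "\<dots> = poly (ramify (N * n) P) (v * \<eta>)"
  proof -
    interpret cc: fhom "\<lambda>f :: complex fls. fls_compose_power f (N * n)" by (rule fhom_compose_power) (use N n in simp)
    show ?thesis by (simp add: poly_altdef cc.degree_map cc.coeff_map assms(1))
  qed
  finally show ?thesis using N n by (intro exI[of _ "N * n"] conjI exI[of _ "v * \<eta>"]) auto
qed

text \<open>Characteristic zero permits division by the degree, so the shift
  \<open>y -> y + c\<close> kills the subleading coefficient of the monic polynomial; the root found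
  is shifted back.\<close>

theorem puiseux:
  fixes P :: "complex fls poly"
  assumes "degree P > 0"
  shows "\<exists>n>0. \<exists>\<eta>. poly (ramify n P) \<eta> = 0"
  using assms
proof (induction "degree P" arbitrary: P rule: less_induct)
  case less
  define d where "d = degree P"
  define P1 where "P1 = smult (inverse (lead_coeff P)) P"
  have P0: "P \<noteq> 0" using less by auto
  have P1: "degree P1 = d" "lead_coeff P1 = 1" using P0 by (auto simp: P1_def d_def)
  define c where "c = - coeff P1 (d - 1) / of_nat d"
  define P2 where "P2 = pcompose P1 [:c, 1:]"
  have d: "d > 0" using less by (simp add: d_def)
  have P2: "degree P2 = d" "lead_coeff P2 = 1"
    using P1 lead_coeff_comp[of "[:c, 1:]" P1] by (auto simp: P2_def degree_pcompose)
  have "coeff P2 (d - 1) = 0"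
  proof -
    \<comment> \<open>The terms of degree below d - 1, which stay below d - 1 under the
      shift.\<close>
    define R where "R = P1 - monom 1 d - monom (coeff P1 (d - 1)) (d - 1)"
    have R: "degree R < d - 1 \<or> R = 0"
    proof -
      have "coeff R i = 0" if "i \<ge> d - 1" for i
      proof -
        have "i = d - 1 \<or> i = d \<or> i > d" using that by linarith
        then consider "i = d - 1" | "i = d" | "i > d" by blast
        then show ?thesis
          by cases (use P1 d in \<open>auto simp: R_def coeff_eq_0\<close>)
      qed
      then show ?thesis by (metis leading_coeff_0_iff not_le)
    qed
    have "P1 = monom 1 d + monom (coeff P1 (d - 1)) (d - 1) + R" by (simp add: R_def)
    then have "P2 = pcompose (monom 1 d) [:c,1:] + pcompose (monom (coeff P1 (d - 1)) (d - 1)) [:c,1:] + pcompose R [:c,1:]"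
      unfolding P2_def by (metis pcompose_add)
    moreover have "pcompose (monom a k) [:c,1:] = smult a ([:c,1:] ^ k)" for a k
    proof -
      have "pcompose ([:0,1:] ^ k) [:c,1:] = [:c,1:] ^ k"
        by (induction k) (simp_all add: pcompose_1 pcompose_mult pcompose_pCons)
      then show ?thesis by (simp add: monom_altdef pcompose_smult)
    qed
    moreover have "coeff (pcompose R [:c,1:]) (d - 1) = 0"
      using R by (cases "R = 0") (auto simp: degree_pcompose intro!: coeff_eq_0)
    ultimately have "coeff P2 (d - 1) = coeff ([:c,1:] ^ d) (d - 1) + coeff P1 (d - 1) * coeff ([:c,1:] ^ (d - 1)) (d - 1)"
      by simp
    also have "\<dots> = of_nat d * c + coeff P1 (d - 1)"
      using d coeff_linear_power_sub[of c "d - 1"] coeff_linear_power_top[of c "d - 1"] by simp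
    also have "\<dots> = 0" using d by (simp add: c_def)
    finally show ?thesis .
  qed
  from puiseux_step[OF P2 d this] less(1) obtain n \<eta> where n: "n > 0"
    and \<eta>: "poly (ramify n P2) \<eta> = 0" by (auto simp: d_def)
  interpret cn: fhom "\<lambda>f :: complex fls. fls_compose_power f n" by (rule fhom_compose_power) fact
  have "ramify n (pcompose p [:c, 1:]) = pcompose (ramify n p) [:fls_compose_power c n, 1:]" for p
    by (induction p) (simp_all add: pcompose_pCons cn.map_poly_add cn.map_poly_mult map_poly_pCons map_poly_smult cn.zero cn.one cn.mult)
  then have "poly (ramify n P1) (fls_compose_power c n + \<eta>) = 0"
    using \<eta> by (simp add: P2_def poly_pcompose)
  then have "poly (ramify n P) (fls_compose_power c n + \<eta>) = 0"
    using P0 by (simp add: P1_def map_poly_smult cn.zero cn.mult cn.eq_0_iff)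
  then show ?case using n by blast
qed

subsection \<open>Real and complex Laurent series\<close>

definition fls_map :: "('a::zero \<Rightarrow> 'b::zero) \<Rightarrow> 'a fls \<Rightarrow> 'b fls" where
  "fls_map f F = Abs_fls (\<lambda>n. f (fls_nth F n))"

lemma fls_map_nth [simp]:
  assumes "f 0 = 0"
  shows "fls_nth (fls_map f F) n = f (fls_nth F n)"
proof -
  have "\<forall>\<^sub>\<infinity>n. fls_nth F (- int n) = 0" by simp
  then have "\<forall>\<^sub>\<infinity>n. f (fls_nth F (- int n)) = 0"
    by (rule MOST_mono) (simp add: assms)
  then show ?thesis unfolding fls_map_def by (rule nth_Abs_fls)
qed

lemma fhom_fls_map:
  fixes f :: "'a::field \<Rightarrow> 'b::field"
  assumes "fhom f"
  shows "fhom (fls_map f)"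
proof -
  interpret f: fhom f by fact
  have sd: "fls_subdegree (fls_map f F) = fls_subdegree F" for F
  proof (cases "F = 0")
    case True then have "fls_map f F = 0" by (intro fls_eqI) (simp add: f.zero)
    then show ?thesis using True by simp
  next
    case False
    then show ?thesis by (intro fls_subdegree_eqI) (auto simp: f.zero f.eq_0_iff)
  qed
  show ?thesis
  proof
    fix a b :: "'a fls"
    show "fls_map f (a + b) = fls_map f a + fls_map f b"
      by (rule fls_eqI) (simp add: f.zero f.add)
    show "fls_map f (a * b) = fls_map f a * fls_map f b"
      by (rule fls_eqI) (simp add: f.zero f.sum f.mult fls_times_nth(1) sd)
    show "fls_map f 1 = 1"
      by (rule fls_eqI) (simp add: f.zero f.one)
  qed
qed

lemma fhom_of_real: "fhom (of_real :: real \<Rightarrow> complex)"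
  by unfold_locales auto

lemma fhom_cnj: "fhom cnj"
  by unfold_locales auto

abbreviation flsC :: "real fls \<Rightarrow> complex fls" where "flsC \<equiv> fls_map of_real"
abbreviation flscnj :: "complex fls \<Rightarrow> complex fls" where "flscnj \<equiv> fls_map cnj"

interpretation flsC: fhom flsC by (rule fhom_fls_map[OF fhom_of_real])
interpretation flscnj: fhom flscnj by (rule fhom_fls_map[OF fhom_cnj])

text \<open>The substitution \<open>X -> w * X\<close>. The n-th roots of unity \<open>w\<close>
  give the Galois group of \<open>C((s))\<close> over \<open>C((s^n))\<close>, and
  \<open>w = -1\<close> exchanges the two orderings of the real Laurent series.\<close>

definition fls_scale :: "'a::field \<Rightarrow> 'a fls \<Rightarrow> 'a fls" where
  "fls_scale w F = fls_compose_fps F (fps_const w * fps_X)"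

lemma fls_scale_nth: "w \<noteq> 0 \<Longrightarrow> fls_nth (fls_scale w F) n = fls_nth F n * w powi n"
  by (simp add: fls_scale_def fls_nth_fls_compose_fps_linear)

lemma fhom_fls_scale: "w \<noteq> 0 \<Longrightarrow> fhom (fls_scale w)"
  by unfold_locales (auto simp: fls_scale_def fls_compose_fps_add fls_compose_fps_mult)

lemma fhom_comp: "fhom f \<Longrightarrow> fhom g \<Longrightarrow> fhom (\<lambda>x. f (g x))"
  unfolding fhom_def rhom_def by simp

text \<open>Positivity for the ordering of the real Laurent series in which the variable is a positive
  infinitesimal.\<close>

definition fls_nonneg :: "real fls \<Rightarrow> bool" where
  "fls_nonneg F \<longleftrightarrow> fls_nth F (fls_subdegree F) \<ge> 0"

lemma fls_nonneg_mult: "fls_nonneg a \<Longrightarrow> fls_nonneg b \<Longrightarrow> fls_nonneg (a * b)"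
  by (cases "a = 0 \<or> b = 0") (auto simp: fls_nonneg_def)

lemma fls_nonneg_multD:
  assumes "fls_nonneg (a * b)" "fls_nonneg a" "a \<noteq> 0" shows "fls_nonneg b"
proof (cases "b = 0")
  case False
  have "fls_nth a (fls_subdegree a) > 0"
    using assms(2,3) nth_fls_subdegree_nonzero[of a] unfolding fls_nonneg_def by linarith
  then show ?thesis using assms(1,3) False by (simp add: fls_nonneg_def zero_le_mult_iff)
qed (simp add: fls_nonneg_def)

lemma fls_nonneg_uminus: "fls_nonneg a \<Longrightarrow> fls_nonneg (- a) \<Longrightarrow> a = 0"
  using nth_fls_subdegree_nonzero[of a] unfolding fls_nonneg_def by fastforce

lemma fls_mult_vanish:
  fixes f g :: "'a::field fls"
  assumes "\<And>k. k < m \<Longrightarrow> fls_nth f k = 0" "\<And>k. k < n \<Longrightarrow> fls_nth g k = 0" "k < m + n"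
  shows "fls_nth (f * g) k = 0"
proof (cases "f = 0 \<or> g = 0")
  case False
  then have "fls_subdegree f \<ge> m" "fls_subdegree g \<ge> n"
    using assms(1,2) by (auto intro!: fls_subdegree_geI)
  then show ?thesis using False assms(3) by (intro fls_eq0_below_subdegree) simp
qed auto

lemma fls_mult_nth_lowest:
  fixes f g :: "'a::field fls"
  assumes "\<And>k. k < m \<Longrightarrow> fls_nth f k = 0" "\<And>k. k < n \<Longrightarrow> fls_nth g k = 0"
  shows "fls_nth (f * g) (m + n) = fls_nth f m * fls_nth g n"
proof (cases "f = 0 \<or> g = 0")
  case False
  then have s: "fls_subdegree f \<ge> m" "fls_subdegree g \<ge> n"
    using assms(1,2) by (auto intro!: fls_subdegree_geI)
  show ?thesis
  proof (cases "fls_subdegree f = m \<and> fls_subdegree g = n")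
    case True then show ?thesis using fls_times_base[of f g] by simp
  next
    case F: False
    then have "fls_nth f m = 0 \<or> fls_nth g n = 0" using s by auto
    moreover have "fls_nth (f * g) (m + n) = 0"
      using F s False by (intro fls_eq0_below_subdegree) auto
    ultimately show ?thesis by auto
  qed
qed auto

section \<open>Continuity of polynomial evaluation at Laurent series, and persistence of
  signs\<close>

lemma poly_fls_vanish:
  fixes p :: "'a::field fls poly"
  shows "\<exists>m. \<forall>h. (\<forall>k<0. fls_nth h k = 0) \<longrightarrow> (\<forall>k<m. fls_nth (poly p h) k = 0)"
proof (induction p)
  case (pCons a p)
  then obtain m where m: "\<And>h k. (\<forall>k<0. fls_nth h k = 0) \<Longrightarrow> k < m \<Longrightarrow> fls_nth (poly p h) k = 0" by auto
  show ?case
  proof (intro exI[of _ "min m (fls_subdegree a)"] allI impI)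
    fix h :: "'a fls" and k assume h: "\<forall>k<0. fls_nth h k = 0" and k: "k < min m (fls_subdegree a)"
    have "fls_nth (h * poly p h) k = 0"
      using h m[OF h] k by (intro fls_mult_vanish[of 0 _ m]) auto
    then show "fls_nth (poly (pCons a p) h) k = 0" using k by simp
  qed
qed auto

text \<open>Taylor expansion gives \<open>g(\<theta> + h) = g(\<theta>) + h * g1(h)\<close>, and the
  order of \<open>g1(h)\<close> is bounded below uniformly over integral \<open>h\<close>; so a high
  order of \<open>h\<close> makes the difference small.\<close>

lemma poly_fls_continuous:
  fixes g :: "'a::field fls poly"
  shows "\<exists>N. \<forall>h. (\<forall>k<N. fls_nth h k = 0) \<longrightarrow> (\<forall>j\<le>M. fls_nth (poly g (\<theta> + h)) j = fls_nth (poly g \<theta>) j)"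
proof -
  obtain c g1 where g1: "pcompose g [:\<theta>, 1:] = pCons c g1" by (cases "pcompose g [:\<theta>, 1:]")
  have e: "poly g (\<theta> + h) = c + h * poly g1 h" for h
    using arg_cong[OF g1, of "\<lambda>p. poly p h"] by (simp add: poly_pcompose)
  have c: "c = poly g \<theta>" using e[of 0] by simp
  obtain m where m: "\<And>h k. (\<forall>k<0. fls_nth h k = 0) \<Longrightarrow> k < m \<Longrightarrow> fls_nth (poly g1 h) k = 0"
    using poly_fls_vanish[of g1] by auto
  show ?thesis
  proof (intro exI[of _ "max 0 (M + 1 - m)"] allI impI)
    fix h :: "'a fls" and j assume h: "\<forall>k<max 0 (M + 1 - m). fls_nth h k = 0" and j: "j \<le> M"
    have "fls_nth (h * poly g1 h) j = 0"
      using h m[of h] j by (intro fls_mult_vanish[of "max 0 (M + 1 - m)" _ m]) auto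
    then show "fls_nth (poly g (\<theta> + h)) j = fls_nth (poly g \<theta>) j" by (simp add: e c)
  qed
qed

text \<open>The sign is that of the lowest coefficient, which a perturbation of high enough order
  does not touch.\<close>

lemma fls_nonneg_poly_near:
  fixes g :: "real fls poly"
  assumes "poly g \<theta> \<noteq> 0"
  shows "\<exists>N. \<forall>h. (\<forall>k<N. fls_nth h k = 0) \<longrightarrow> poly g (\<theta> + h) \<noteq> 0 \<and> (fls_nonneg (poly g (\<theta> + h)) \<longleftrightarrow> fls_nonneg (poly g \<theta>))"
proof -
  define v where "v = poly g \<theta>"
  obtain N where N: "\<And>h j. (\<forall>k<N. fls_nth h k = 0) \<Longrightarrow> j \<le> fls_subdegree v \<Longrightarrow> fls_nth (poly g (\<theta> + h)) j = fls_nth v j"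
    using poly_fls_continuous[of "fls_subdegree v" g \<theta>] unfolding v_def by auto
  show ?thesis
  proof (intro exI[of _ N] allI impI)
    fix h :: "real fls" assume h: "\<forall>k<N. fls_nth h k = 0"
    have "fls_nth v (fls_subdegree v) \<noteq> 0" using assms by (simp add: v_def)
    then have "fls_nth (poly g (\<theta> + h)) (fls_subdegree v) \<noteq> 0" using N[OF h, of "fls_subdegree v"] by simp
    moreover from this have "fls_subdegree (poly g (\<theta> + h)) = fls_subdegree v"
      using N[OF h] by (intro fls_subdegree_eqI) auto
    ultimately show "poly g (\<theta> + h) \<noteq> 0 \<and> (fls_nonneg (poly g (\<theta> + h)) \<longleftrightarrow> fls_nonneg (poly g \<theta>))"
      using N[OF h, of "fls_subdegree v"] by (auto simp: fls_nonneg_def v_def)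
  qed
qed

text \<open>The substitution \<open>t = e * s^q\<close>. With e = -1 a positive s runs along
  negative t, so both orderings are reached; q allows real Puiseux series as points.\<close>

definition fls_test :: "real \<Rightarrow> nat \<Rightarrow> real fls \<Rightarrow> real fls" where
  "fls_test e q F = fls_compose_power (fls_scale e F) q"

lemma fhom_fls_test: "e \<noteq> 0 \<Longrightarrow> q > 0 \<Longrightarrow> fhom (fls_test e q)"
  unfolding fls_test_def by (intro fhom_comp[OF fhom_compose_power fhom_fls_scale])

text \<open>Non-negativity at all real Puiseux points, for both orderings of the field of real Laurent
  series.\<close>

definition fls_psd :: "real fls poly \<Rightarrow> bool" where
  "fls_psd F \<longleftrightarrow> (\<forall>e\<in>{1, -1}. \<forall>q>0. \<forall>\<theta>. fls_nonneg (poly (map_poly (fls_test e q) F) \<theta>))"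

lemma fls_psdD: "fls_psd F \<Longrightarrow> e \<in> {1, -1} \<Longrightarrow> q > 0 \<Longrightarrow> fls_nonneg (poly (map_poly (fls_test e q) F) \<theta>)"
  unfolding fls_psd_def by auto

text \<open>Where \<open>D\<close> vanishes the product says nothing about \<open>F\<close>. Moving
  the point by \<open>X^k\<close> with k large keeps the sign of \<open>F\<close>, and some such k
  avoids the finitely many roots of \<open>D\<close>.\<close>

lemma fls_psd_cancel:
  assumes "fls_psd (D * F)" "fls_psd D" "D \<noteq> 0"
  shows "fls_psd F"
  unfolding fls_psd_def
proof (intro ballI allI impI)
  fix e :: real and q :: nat and \<theta> assume e: "e \<in> {1, -1}" and q: "q > 0"
  interpret t: fhom "fls_test e q" by (rule fhom_fls_test) (use e q in auto)
  define f where "f = map_poly (fls_test e q) F"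
  define d where "d = map_poly (fls_test e q) D"
  have d0: "d \<noteq> 0" using assms(3) by (simp add: d_def t.map_poly_eq_0)
  show "fls_nonneg (poly f \<theta>)"
  proof (cases "poly f \<theta> = 0")
    case False
    then obtain N where N: "\<And>h. (\<forall>k<N. fls_nth h k = 0) \<Longrightarrow> fls_nonneg (poly f (\<theta> + h)) \<longleftrightarrow> fls_nonneg (poly f \<theta>)"
      using fls_nonneg_poly_near[OF False] by blast
    have "infinite {N..}" by (rule infinite_Ici)
    moreover have "inj_on (\<lambda>k. \<theta> + fls_X_intpow k :: real fls) {N..}"
      by (auto simp: inj_on_def fls_eq_iff dest: spec)
    ultimately have "infinite ((\<lambda>k. \<theta> + fls_X_intpow k) ` {N..})" using finite_imageD by blast
    moreover have "finite {x. poly d x = 0}" using d0 by (rule poly_roots_finite)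
    ultimately have "\<not> (\<lambda>k. \<theta> + fls_X_intpow k) ` {N..} \<subseteq> {x. poly d x = 0}" using finite_subset by blast
    then obtain k where k: "k \<ge> N" "poly d (\<theta> + fls_X_intpow k) \<noteq> 0" by auto
    have "fls_nonneg (poly d (\<theta> + fls_X_intpow k) * poly f (\<theta> + fls_X_intpow k))"
      using assms(1) e q unfolding fls_psd_def d_def f_def
      by (simp only: t.map_poly_mult[symmetric] poly_mult[symmetric])
    moreover have "fls_nonneg (poly d (\<theta> + fls_X_intpow k))"
      using assms(2) e q unfolding fls_psd_def d_def by auto
    ultimately have "fls_nonneg (poly f (\<theta> + fls_X_intpow k))"
      using k by (blast intro: fls_nonneg_multD)
    then show ?thesis using N[of "fls_X_intpow k"] k by simp
  qed (simp add: fls_nonneg_def)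
qed

text \<open>The linear factor takes opposite signs at \<open>\<theta>0 + s\<close> and
  \<open>\<theta>0 - s\<close>, while a nonzero value of \<open>g\<close> would keep its sign for
  \<open>s\<close> infinitesimal of high order.\<close>

lemma fls_nonneg_double_root:
  assumes "\<And>\<theta>. fls_nonneg (poly ([:- \<theta>0, 1:] * g) \<theta>)"
  shows "poly g \<theta>0 = 0"
proof (rule ccontr)
  assume nz: "poly g \<theta>0 \<noteq> 0"
  then obtain N where N: "\<And>h. (\<forall>k<N. fls_nth h k = 0) \<Longrightarrow> fls_nonneg (poly g (\<theta>0 + h)) \<longleftrightarrow> fls_nonneg (poly g \<theta>0)"
    and N': "\<And>h. (\<forall>k<N. fls_nth h k = 0) \<Longrightarrow> poly g (\<theta>0 + h) \<noteq> 0"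
    using fls_nonneg_poly_near by blast
  define s :: "real fls" where "s = fls_X_intpow N"
  have s: "s \<noteq> 0" "fls_nonneg s" by (auto simp: s_def fls_nonneg_def)
  have "poly ([:- \<theta>0, 1:] * g) (\<theta>0 + s) = s * poly g (\<theta>0 + s)"
    by (simp add: algebra_simps)
  then have "fls_nonneg (s * poly g (\<theta>0 + s))" using assms[of "\<theta>0 + s"] by simp
  then have "fls_nonneg (poly g (\<theta>0 + s))" using s fls_nonneg_multD by blast
  then have 1: "fls_nonneg (poly g \<theta>0)" using N[of s] by (simp add: s_def)
  have "poly ([:- \<theta>0, 1:] * g) (\<theta>0 + (- s)) = s * (- poly g (\<theta>0 + (- s)))"
    by (simp add: algebra_simps)
  then have "fls_nonneg (s * (- poly g (\<theta>0 + (- s))))" using assms[of "\<theta>0 + (- s)"] by simp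
  then have "fls_nonneg (- poly g (\<theta>0 + (- s)))" using s fls_nonneg_multD by blast
  moreover have "fls_nonneg (poly g (\<theta>0 + (- s)))" using 1 N[of "- s"] by (simp add: s_def)
  ultimately have "poly g (\<theta>0 + (- s)) = 0" by (rule fls_nonneg_uminus[rotated])
  moreover have "poly g (\<theta>0 + (- s)) \<noteq> 0" by (rule N') (simp add: s_def)
  ultimately show False by simp
qed

text \<open>Division with remainder stays one after the embedding, because degrees are preserved.
  This brings factors found over the complex series back to the real ones.\<close>

lemma (in fhom) map_poly_dvdD:
  assumes "map_poly h p dvd map_poly h q"
  shows "p dvd q"
proof (cases "p = 0")
  case False
  have "map_poly h q = map_poly h p * map_poly h (q div p) + map_poly h (q mod p)"
    by (simp flip: map_poly_mult map_poly_add)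
  then have d: "map_poly h p dvd map_poly h (q mod p)"
    using assms by (metis dvd_add_right_iff dvd_triv_left)
  show ?thesis
  proof (rule ccontr)
    assume "\<not> p dvd q"
    then have nz: "q mod p \<noteq> 0" by auto
    then have "degree (q mod p) < degree p" using degree_mod_less[OF False] by auto
    moreover have "degree p \<le> degree (q mod p)"
      using dvd_imp_degree_le[OF d] nz by (simp add: map_poly_eq_0 degree_map)
    ultimately show False by simp
  qed
qed (use assms map_poly_eq_0 in auto)

text \<open>Replacing X by -X multiplies the lowest coefficient by \<open>(-1)^k\<close>, so
  non-negativity in both orderings makes the order k even. The remaining unit has a positive
  constant term and hence a power series square root.\<close>

lemma fls_sqrt:
  assumes "fls_nonneg c" "fls_nonneg (fls_scale (- 1) c)"
  shows "\<exists>a. c = a ^ 2"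
proof (cases "c = 0")
  case False
  define k where "k = fls_subdegree c"
  define u where "u = fls_regpart (fls_shift k c)"
  have cu: "c = fls_shift (- k) (fps_to_fls u)" using False by (simp add: u_def k_def)
  have u0: "fps_nth u 0 = fls_nth c k" by (simp add: u_def)
  have pos: "fls_nth c k > 0"
    using assms(1) nth_fls_subdegree_nonzero[OF False] unfolding fls_nonneg_def k_def by linarith
  have "fls_subdegree (fls_scale (- 1) c) = k"
    using False by (intro fls_subdegree_eqI) (auto simp: fls_scale_nth k_def)
  then have "fls_nth c k * (- 1) powi k \<ge> 0"
    using assms(2) by (simp add: fls_nonneg_def fls_scale_nth)
  then have "even k" using pos by (auto simp: power_int_minus_left zero_le_mult_iff split: if_splits)
  then obtain j where j: "k = 2 * j" by (elim evenE)
  define v where "v = fps_radical (\<lambda>n. root n) 2 u"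
  have "v ^ 2 = u"
  proof -
    have "root (Suc 1) (fps_nth u 0) ^ Suc 1 = fps_nth u 0"
      using u0 pos by (intro real_root_pow_pos) auto
    then have "fps_radical (\<lambda>n. root n) (Suc 1) u ^ Suc 1 = u"
      using power_radical[of u "\<lambda>n. root n" 1] u0 pos by auto
    then show ?thesis by (simp add: v_def numeral_2_eq_2)
  qed
  then have "fps_to_fls u = fps_to_fls v ^ 2" by (simp flip: fps_to_fls_power)
  then have "c = (fls_shift (- j) (fps_to_fls v)) ^ 2"
    unfolding cu j by (simp add: fls_shifted_times_simps power2_eq_square)
  then show ?thesis by blast
qed (auto intro: exI[of _ 0])

lemma two_squares_mult:
  fixes a b c d :: "'a::comm_ring_1"
  shows "(a ^ 2 + b ^ 2) * (c ^ 2 + d ^ 2) = (a * c - b * d) ^ 2 + (a * d + b * c) ^ 2"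
  by (simp add: power2_eq_square algebra_simps)

lemma fls_nth_sum: "fls_nth (sum f I) n = (\<Sum>i\<in>I. fls_nth (f i) n)"
  by (induction I rule: infinite_finite_induct) auto

text \<open>At the smaller of the two orders the squares contribute a sum of real squares, which
  cannot cancel.\<close>

lemma fls_two_squares_pos:
  fixes a b :: "real fls"
  assumes "a \<noteq> 0 \<or> b \<noteq> 0"
  shows "fls_nth (a ^ 2 + b ^ 2) (fls_subdegree (a ^ 2 + b ^ 2)) > 0"
proof -
  define l where "l = (if a = 0 then fls_subdegree b else if b = 0 then fls_subdegree a else min (fls_subdegree a) (fls_subdegree b))"
  have v: "fls_nth a k = 0" "fls_nth b k = 0" if "k < l" for k
    using that by (auto simp: l_def split: if_splits)
  have nz: "fls_nth a l \<noteq> 0 \<or> fls_nth b l \<noteq> 0"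
    using assms nth_fls_subdegree_nonzero[of a] nth_fls_subdegree_nonzero[of b] by (auto simp: l_def min_def)
  have "fls_nth (a * a) (l + l) = fls_nth a l * fls_nth a l"
    by (rule fls_mult_nth_lowest) (use v in auto)
  moreover have "fls_nth (b * b) (l + l) = fls_nth b l * fls_nth b l"
    by (rule fls_mult_nth_lowest) (use v in auto)
  ultimately have p: "fls_nth (a ^ 2 + b ^ 2) (l + l) > 0"
    using nz sum_power2_gt_zero_iff[of "fls_nth a l" "fls_nth b l"] by (simp add: power2_eq_square)
  have "fls_subdegree (a ^ 2 + b ^ 2) = l + l"
  proof (rule fls_subdegree_eqI)
    fix k assume k: "k < l + l"
    have "fls_nth (a * a) k = 0" "fls_nth (b * b) k = 0"
      by (rule fls_mult_vanish[of l _ l], use v k in auto)+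
    then show "fls_nth (a ^ 2 + b ^ 2) k = 0" by (simp add: power2_eq_square)
  qed (use p in simp)
  then show ?thesis using p by simp
qed

lemma fls_two_squares_eq_0: "a ^ 2 + b ^ 2 = 0 \<Longrightarrow> a = 0 \<and> b = 0" for a b :: "real fls"
  using fls_two_squares_pos[of a b] by auto

lemma fls_psd_sum_two_squares: "fls_psd (A ^ 2 + B ^ 2)"
  unfolding fls_psd_def
proof (intro ballI allI impI)
  fix e :: real and q :: nat and \<theta> assume e: "e \<in> {1, -1}" and q: "q > 0"
  interpret t: fhom "fls_test e q" by (rule fhom_fls_test) (use e q in auto)
  have "fls_nonneg (a ^ 2 + b ^ 2)" for a b
    using fls_two_squares_pos[of a b] by (cases "a = 0 \<and> b = 0") (auto simp: fls_nonneg_def)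
  then show "fls_nonneg (poly (map_poly (fls_test e q) (A ^ 2 + B ^ 2)) \<theta>)"
    by (simp only: t.map_poly_add t.map_poly_power poly_power poly_add)
qed

text \<open>If one of the degrees were too big, the squares of two top coefficients would have to
  cancel. This is the source of the y-degree bound on the local squares.\<close>

lemma poly_two_squares_degree:
  fixes A B :: "'a::idom poly"
  assumes "\<And>a b :: 'a. a ^ 2 + b ^ 2 = 0 \<Longrightarrow> a = 0 \<and> b = 0"
  shows "2 * degree A \<le> degree (A ^ 2 + B ^ 2) \<and> 2 * degree B \<le> degree (A ^ 2 + B ^ 2)"
proof -
  define m where "m = max (degree A) (degree B)"
  have c: "coeff (p ^ 2) (2 * m) = coeff p m ^ 2" if "degree p \<le> m" for p :: "'a poly"
  proof (cases "degree p = m")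
    case True then show ?thesis using lead_coeff_power[of p 2] degree_power_eq[of p 2] by (cases "p = 0") auto
  next
    case False
    then show ?thesis using that degree_power_le[of p 2] by (simp add: coeff_eq_0)
  qed
  show ?thesis
  proof (rule ccontr)
    assume "\<not> ?thesis"
    then have "degree (A ^ 2 + B ^ 2) < 2 * m" by (auto simp: m_def)
    then have "coeff A m ^ 2 + coeff B m ^ 2 = 0"
    proof -
      have "coeff (A ^ 2) (2 * m) = coeff A m ^ 2" "coeff (B ^ 2) (2 * m) = coeff B m ^ 2"
        by (rule c, simp add: m_def)+
      moreover have "coeff (A ^ 2 + B ^ 2) (2 * m) = 0" by (rule coeff_eq_0) fact
      ultimately show ?thesis by simp
    qed
    then have "coeff A m = 0 \<and> coeff B m = 0" by (rule assms)
    moreover have "m > 0" using \<open>degree (A ^ 2 + B ^ 2) < 2 * m\<close> by simp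
    moreover have "m = degree A \<or> m = degree B" by (auto simp: m_def)
    ultimately show False by auto
  qed
qed

lemma flsC_Re:
  assumes "flscnj F = F" shows "flsC (fls_map Re F) = F"
proof (rule fls_eqI)
  fix n
  have "cnj (fls_nth F n) = fls_nth F n" using arg_cong[OF assms, of "\<lambda>F. fls_nth F n"] by simp
  then show "fls_nth (flsC (fls_map Re F)) n = fls_nth F n" by (simp add: complex_eq_iff)
qed

lemma flscnj_flsC: "flscnj (flsC F) = flsC F"
  by (rule fls_eqI) simp

text \<open>A polynomial vanishing at \<open>\<eta>\<close> and all its conjugates under the Galois group of
  \<open>C((s))\<close> over \<open>C((s^n))\<close>.\<close>

lemma fls_galois_poly:
  fixes \<eta> :: "complex fls"
  assumes n: "n > 0"
  shows "\<exists>Q. Q \<noteq> 0 \<and> (\<forall>y. poly (ramify n Q) y = 0 \<longleftrightarrow> (\<exists>k<n. y = fls_scale (cis (2 * pi * real k / real n)) \<eta>))"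
proof -
  interpret cn: fhom "\<lambda>f :: complex fls. fls_compose_power f n" by (rule fhom_compose_power) fact
  define z where "z = cis (2 * pi / n)"
  have z0: "z \<noteq> 0" by (simp add: z_def)
  interpret sc: fhom "fls_scale z" by (rule fhom_fls_scale) fact
  have zn: "z ^ n = 1" 
  proof -
    have "z ^ n = cis (real n * (2 * pi / n))" unfolding z_def by (rule Complex.DeMoivre)
    then show ?thesis using n by simp
  qed
  have zk: "cis (2 * pi * real k / real n) = z ^ k" for k by (simp add: z_def Complex.DeMoivre mult_ac)
  define r where "r k = fls_scale (z ^ k) \<eta>" for k
  have rS: "fls_scale z (r k) = r (Suc k)" for k
    using z0 by (intro fls_eqI) (simp add: r_def fls_scale_nth power_int_mult_distrib)
  have rn: "r n = r 0" by (simp add: r_def zn)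
  \<comment> \<open>The product over the orbit of \<open>\<eta>\<close> is invariant under
    \<open>s -> z * s\<close>; its coefficients therefore involve only exponents divisible by n and
    come from series in \<open>s^n\<close>.\<close>
  define Q where "Q = (\<Prod>k<n. [:- r k, 1:])"
  have "map_poly (fls_scale z) Q = (\<Prod>k<n. [:- r (Suc k), 1:])"
  proof -
    have "map_poly (fls_scale z) [:- r k, 1:] = [:- r (Suc k), 1:]" for k
      by (simp add: map_poly_pCons sc.zero sc.one sc.uminus rS)
    then have "map_poly (fls_scale z) (\<Prod>k<j. [:- r k, 1:]) = (\<Prod>k<j. [:- r (Suc k), 1:])" for j
      by (induction j) (simp_all only: prod.lessThan_Suc sc.map_poly_mult lessThan_0 prod.empty sc.map_poly_one)
    then show ?thesis by (simp add: Q_def)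
  qed
  also have "\<dots> = Q"
  proof -
    obtain j where j: "n = Suc j" using n by (cases n) auto
    have "(\<Prod>k<n. [:- r (Suc k), 1:]) = (\<Prod>k<j. [:- r (Suc k), 1:]) * [:- r 0, 1:]"
      using rn by (simp add: j)
    also have "\<dots> = Q" unfolding Q_def j by (subst prod.lessThan_Suc_shift) (simp only: mult.commute o_def)
    finally show ?thesis .
  qed
  finally have "map_poly (fls_scale z) Q = Q" .
  then have inv: "fls_scale z (coeff Q i) = coeff Q i" for i by (simp flip: sc.coeff_map)
  have div: "int n dvd k" if "fls_nth (coeff Q i) k \<noteq> 0" for i k
  proof -
    have "fls_nth (coeff Q i) k * z powi k = fls_nth (coeff Q i) k"
      using inv[of i] fls_scale_nth[OF z0, of "coeff Q i" k] by simp
    then have "z powi k = 1" using that by simp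
    define j where "j = nat (k mod int n)"
    have "int n * (k div int n) + int j = k" using n by (simp add: j_def)
    moreover have "z powi (int n * (k div int n) + int j) = z powi (int n * (k div int n)) * z powi int j"
      by (rule power_int_add) (simp add: z0)
    ultimately have "z powi k = z powi (int n * (k div int n)) * z powi int j" by simp
    also have "z powi (int n * (k div int n)) = 1" using zn by (simp add: power_int_mult)
    finally have "z ^ j = 1" using \<open>z powi k = 1\<close> by simp
    moreover have "j < n" using n by (simp add: j_def nat_less_iff)
    ultimately have "j = 0"
    proof -
      have "inj_on (\<lambda>k. cis (2 * pi * real k / real n)) {..<n}" using Complex.bij_betw_roots_unity[OF n] by (simp add: bij_betw_def)
      from inj_onD[OF this, of j 0] show ?thesis
        using \<open>z ^ j = 1\<close> zk[of j] \<open>j < n\<close> n by simp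
    qed
    moreover have "0 \<le> k mod int n" using n by simp
    ultimately have "k mod int n = 0" unfolding j_def by simp
    then show ?thesis by (simp add: dvd_eq_mod_eq_0)
  qed
  \<comment> \<open>Keeping every n-th coefficient inverts ramification on series supported on
    multiples of n.\<close>
  define dn where "dn c = Abs_fls (\<lambda>k. fls_nth c (int n * k))" for c :: "complex fls"
  have dn: "fls_nth (dn c) k = fls_nth c (int n * k)" for c k
    unfolding dn_def
  proof (rule nth_Abs_fls_lower_bound[of "min 0 (fls_subdegree c)"], intro allI impI)
    fix j assume "j < min 0 (fls_subdegree c)"
    moreover from this have "int n * j \<le> 1 * j" using n by (intro mult_right_mono_neg) auto
    ultimately have "int n * j < fls_subdegree c" by linarith
    then show "fls_nth c (int n * j) = 0" by simp
  qed
  define Q' where "Q' = map_poly dn Q"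
  have "dn 0 = 0" by (rule fls_eqI) (simp add: dn)
  then have Q'c: "coeff Q' i = dn (coeff Q i)" for i by (simp add: Q'_def coeff_map_poly)
  have "ramify n Q' = Q"
  proof (rule poly_eqI, rule fls_eqI)
    fix i k
    show "fls_nth (coeff (ramify n Q') i) k = fls_nth (coeff Q i) k"
      using n div[of i k] by (auto simp: cn.coeff_map Q'c fls_nth_compose_power dn)
  qed
  moreover have "poly Q y = 0 \<longleftrightarrow> (\<exists>k<n. y = r k)" for y
    by (auto simp: Q_def poly_prod prod_zero_iff)
  moreover have "Q \<noteq> 0" by (simp add: Q_def prod_zero_iff)
  ultimately show ?thesis
    unfolding r_def zk by (intro exI[of _ Q']) (auto simp: cn.map_poly_eq_0)
qed

subsection \<open>Sums of two squares over the real Laurent series\<close>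

text \<open>The conjugate of \<open>\<eta>\<close> is \<open>\<eta>(\<zeta> s)\<close> for an \<open>n\<close>-th root of unity \<open>\<zeta>\<close>. If \<open>w\<^sup>2 = \<zeta>\<close>, then
  \<open>\<theta> = \<eta>(w s)\<close> has real coefficients, and \<open>e = w^n\<close> is \<open>1\<close> or \<open>-1\<close>.\<close>

lemma fls_real_root:
  fixes \<eta> :: "complex fls" and P :: "complex fls poly"
  assumes n: "n > 0"
    and root: "poly (ramify n P) \<eta> = 0"
    and min: "\<And>G. poly (ramify n G) \<eta> = 0 \<Longrightarrow> P dvd G"
    and self: "map_poly flscnj P = P"
  shows "\<exists>e\<in>{1, -1}. \<exists>\<theta>. \<forall>G. poly (map_poly (fls_test e n) G) \<theta> = 0 \<longleftrightarrow> P dvd map_poly flsC G"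
proof -
  interpret cn: fhom "\<lambda>f :: complex fls. fls_compose_power f n" by (rule fhom_compose_power) fact
  have cnjc: "flscnj (fls_compose_power c n) = fls_compose_power (flscnj c) n" for c
    using n by (intro fls_eqI) (simp add: fls_nth_compose_power)
  \<comment> \<open>\<open>P\<close> has real coefficients, so the conjugate of
    \<open>\<eta>\<close> is a root too; and since \<open>P\<close> divides the orbit polynomial
    \<open>Q\<close>, that conjugate lies in the orbit of \<open>\<eta>\<close>.\<close>
  have "poly (ramify n P) (flscnj \<eta>) = 0"
  proof -
    have "ramify n P = map_poly flscnj (ramify n P)"
      by (subst self[symmetric], rule poly_eqI) (simp add: cn.coeff_map flscnj.coeff_map cnjc)
    then have "poly (ramify n P) (flscnj \<eta>) = flscnj (poly (ramify n P) \<eta>)"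
      by (simp only: flscnj.poly_map[symmetric])
    then show ?thesis by (simp add: root flscnj.zero)
  qed
  moreover obtain Q where Q: "\<And>y. poly (ramify n Q) y = 0 \<longleftrightarrow> (\<exists>k<n. y = fls_scale (cis (2 * pi * real k / real n)) \<eta>)"
    using fls_galois_poly[OF n, of \<eta>] by blast
  have "fls_scale 1 \<eta> = \<eta>" by (intro fls_eqI) (simp add: fls_scale_nth)
  then have "poly (ramify n Q) \<eta> = 0" using n by (subst Q) (auto intro!: exI[of _ 0])
  then have "P dvd Q" by (rule min)
  then obtain H where "Q = P * H" by blast
  ultimately have "poly (ramify n Q) (flscnj \<eta>) = 0"
    by (simp add: cn.map_poly_mult)
  then obtain k where k: "flscnj \<eta> = fls_scale (cis (2 * pi * real k / real n)) \<eta>" using Q by blast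
  define w where "w = cis (pi * real k / real n)"
  have w0: "w \<noteq> 0" by (simp add: w_def)
  interpret sc: fhom "fls_scale w" by (rule fhom_fls_scale) fact
  \<comment> \<open>As \<open>w\<close> has modulus 1 and squares to the root of unity, the factor
    \<open>cnj w\<close> produced by conjugation combines with that root of unity to
    \<open>w\<close> again; so \<open>\<eta>(w * s)\<close> is real.\<close>
  have w2: "cnj w * cis (2 * pi * real k / real n) = w" 
    by (simp add: w_def cis_cnj cis_mult)
  define e :: real where "e = (- 1) ^ k"
  have wn: "w ^ n = of_real e"
  proof -
    have "w ^ n = cis (real n * (pi * real k / real n))" unfolding w_def by (rule Complex.DeMoivre)
    also have "real n * (pi * real k / real n) = real k * pi" using n by simp
    also have "cis (real k * pi) = cis pi ^ k" by (simp only: Complex.DeMoivre)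
    finally show ?thesis by (simp add: e_def cis_pi)
  qed
  have e: "e \<in> {1, -1}" by (cases "even k") (auto simp: e_def)
  define \<theta>' where "\<theta>' = fls_scale w \<eta>"
  have "flscnj \<theta>' = \<theta>'"
  proof (rule fls_eqI)
    fix j
    have "fls_nth (flscnj \<theta>') j = fls_nth (flscnj \<eta>) j * cnj w powi j"
      using w0 by (simp add: \<theta>'_def fls_scale_nth)
    also have "\<dots> = fls_nth \<eta> j * (cis (2 * pi * real k / real n) powi j * cnj w powi j)"
      unfolding k by (simp add: fls_scale_nth)
    also have "cis (2 * pi * real k / real n) powi j * cnj w powi j = w powi j"
      by (simp only: power_int_mult_distrib[symmetric] mult.commute[of _ "cnj w"] w2)
    finally show "fls_nth (flscnj \<theta>') j = fls_nth \<theta>' j" using w0 by (simp add: \<theta>'_def fls_scale_nth)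
  qed
  then have \<theta>: "flsC (fls_map Re \<theta>') = \<theta>'" by (rule flsC_Re)
  define \<theta> where "\<theta> = fls_map Re \<theta>'"
  interpret t: fhom "fls_test e n" by (rule fhom_fls_test) (use e n in auto)
  have e0: "e \<noteq> 0" using e by auto
  \<comment> \<open>Scaling by \<open>w\<close> turns \<open>c(s^n)\<close> into
    \<open>c(w^n * s^n) = c(e * s^n)\<close>, which is a real test substitution.\<close>
  have tc: "flsC (fls_test e n c) = fls_scale w (fls_compose_power (flsC c) n)" for c
  proof (rule fls_eqI)
    fix j
    show "fls_nth (flsC (fls_test e n c)) j = fls_nth (fls_scale w (fls_compose_power (flsC c) n)) j"
    proof (cases "int n dvd j")
      case True
      then obtain i where i: "j = int n * i" by blast
      have "of_real (e powi i) = w powi j" by (simp add: i power_int_mult wn)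
      then show ?thesis using True n w0 e0
        by (simp add: fls_test_def fls_nth_compose_power fls_scale_nth i)
    next
      case False
      then show ?thesis using n w0 by (simp add: fls_test_def fls_nth_compose_power fls_scale_nth)
    qed
  qed
  have ev: "flsC (poly (map_poly (fls_test e n) G) \<theta>) = fls_scale w (poly (ramify n (map_poly flsC G)) \<eta>)" for G
  proof -
    have "map_poly flsC (map_poly (fls_test e n) G) = map_poly (fls_scale w) (ramify n (map_poly flsC G))"
      by (rule poly_eqI) (simp add: cn.coeff_map flsC.coeff_map t.coeff_map sc.coeff_map tc)
    then show ?thesis
      by (simp only: flsC.poly_map[symmetric] sc.poly_map[symmetric] \<theta>_def \<theta> \<theta>'_def[symmetric])
  qed
  have "poly (map_poly (fls_test e n) G) \<theta> = 0 \<longleftrightarrow> P dvd map_poly flsC G" for G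
  proof -
    have "poly (map_poly (fls_test e n) G) \<theta> = 0 \<longleftrightarrow> poly (ramify n (map_poly flsC G)) \<eta> = 0"
      using ev[of G] flsC.eq_0_iff sc.eq_0_iff by metis
    also have "\<dots> \<longleftrightarrow> P dvd map_poly flsC G"
      using min[of "map_poly flsC G"] root by (auto elim!: dvdE simp: cn.map_poly_mult)
    finally show ?thesis .
  qed
  with e show ?thesis by blast
qed

text \<open>The kernel of \<open>ev\<close> is a principal ideal; when \<open>ev\<close> evaluates
  at a Puiseux root, its monic generator is the minimal polynomial of that root.\<close>

lemma minimal_annihilator:
  fixes ev :: "'a::field poly \<Rightarrow> 'b::field"
  assumes "rhom ev" "ev F = 0" "F \<noteq> 0"
  shows "\<exists>P. ev P = 0 \<and> lead_coeff P = 1 \<and> (\<forall>G. ev G = 0 \<longrightarrow> P dvd G)"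
proof -
  interpret ev: rhom ev by fact
  obtain P0 where P0: "ev P0 = 0" "P0 \<noteq> 0" "\<And>G. ev G = 0 \<and> G \<noteq> 0 \<Longrightarrow> degree P0 \<le> degree G"
    using ex_has_least_nat[of "\<lambda>p. ev p = 0 \<and> p \<noteq> 0" F degree] assms by blast
  define P where "P = smult (inverse (lead_coeff P0)) P0"
  have P: "ev P = 0" "lead_coeff P = 1" "degree P = degree P0"
    using P0 ev.mult[of "[:inverse (lead_coeff P0):]" P0] by (simp_all add: P_def)
  have "P dvd G" if "ev G = 0" for G
  proof (rule ccontr)
    assume "\<not> P dvd G"
    then have nz: "G mod P \<noteq> 0" by auto
    have "ev (G div P * P + G mod P) = 0" using that by simp
    then have "ev (G mod P) = 0" by (simp only: ev.add ev.mult P(1)) simp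
    then have "degree P0 \<le> degree (G mod P)" using P0(3) nz by simp
    moreover have "P \<noteq> 0" using P(2) by (metis coeff_0 zero_neq_one)
    then have "degree (G mod P) < degree P" using nz degree_mod_less[of P G] by blast
    ultimately show False using P by simp
  qed
  then show ?thesis using P by blast
qed

text \<open>Induction on the degree, splitting off the minimal polynomial \<open>P\<close> of a
  complex Puiseux root. If \<open>P\<close> has real coefficients, it has a real Puiseux point as
  root, where non-negativity forces even multiplicity, so \<open>P^2\<close> divides off. Otherwise
  \<open>P\<close> times its conjugate is \<open>A^2 + B^2\<close>, and such forms are closed under
  products.\<close>

theorem fls_psd_two_squares:
  "fls_psd F \<Longrightarrow> \<exists>A B. F = A ^ 2 + B ^ 2"
proof (induction "degree F" arbitrary: F rule: less_induct)
  case less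
  show ?case
  proof (cases "degree F = 0")
    case True
    then obtain c where c: "F = [:c:]" by (rule degree_eq_zeroE)
    have sq: "\<exists>a. c = a ^ 2"
    proof (rule fls_sqrt)
      have t1: "fls_test e 1 c = fls_scale e c" for e
        unfolding fls_test_def by (rule fls_eqI) (simp add: fls_nth_compose_power)
      have "fls_nonneg (fls_scale e c)" if "e \<in> {1, -1}" for e
      proof -
        interpret t: fhom "fls_test e 1" by (rule fhom_fls_test) (use that in auto)
        have "fls_nonneg (poly (map_poly (fls_test e 1) F) 0)"
          using less.prems that by (rule fls_psdD) simp
        then show ?thesis unfolding c by (simp add: map_poly_pCons t.zero t1 flip: One_nat_def)
      qed
      moreover have "fls_scale 1 c = c" by (rule fls_eqI) (simp add: fls_scale_nth)
      ultimately show "fls_nonneg c" "fls_nonneg (fls_scale (- 1) c)" by (metis insertI1, simp)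
    qed
    then obtain a where "c = a ^ 2" by blast
    then have "F = [:a:] ^ 2 + 0 ^ 2" by (simp add: c power2_eq_square)
    then show ?thesis by blast
  next
    case False
    then have F0: "F \<noteq> 0" by auto
    have "degree (map_poly flsC F) > 0" using False by (simp add: flsC.degree_map)
    from puiseux[OF this] obtain n \<eta> where n: "n > 0"
      and \<eta>: "poly (ramify n (map_poly flsC F)) \<eta> = 0" by blast
    interpret cn: fhom "\<lambda>f :: complex fls. fls_compose_power f n" by (rule fhom_compose_power) fact
    define ev where "ev G = poly (ramify n G) \<eta>" for G
    have "rhom ev" by unfold_locales (simp_all add: ev_def cn.map_poly_add cn.map_poly_mult cn.one)
    from minimal_annihilator[OF this, of "map_poly flsC F"] \<eta> F0
    obtain P where P: "ev P = 0" "lead_coeff P = 1" "\<And>G. ev G = 0 \<Longrightarrow> P dvd G"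
      by (auto simp: ev_def flsC.map_poly_eq_0)
    have dP: "degree P > 0"
    proof (rule ccontr)
      assume "\<not> degree P > 0"
      then have "P = 1" using P(2) by (auto elim: degree_eq_zeroE)
      then show False using P(1) by (simp add: ev_def cn.one)
    qed
    have PF: "P dvd map_poly flsC F" using P(3) \<eta> by (simp add: ev_def)
    show ?thesis
    proof (cases "map_poly flscnj P = P")
      case self: True
      define p where "p = map_poly (fls_map Re) P"
      have pP: "map_poly flsC p = P"
      proof (rule poly_eqI)
        fix i
        have "flscnj (coeff P i) = coeff P i" using self by (simp flip: flscnj.coeff_map)
        then show "coeff (map_poly flsC p) i = coeff P i"
          by (simp add: flsC.coeff_map p_def coeff_map_poly flsC_Re fls_eq_iff)
      qed
      have p0: "p \<noteq> 0" and dp: "degree p > 0" using pP dP flsC.degree_map[of p] by auto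
      obtain e \<theta> where e: "e \<in> {1, -1}" and
        \<theta>: "\<And>G. poly (map_poly (fls_test e n) G) \<theta> = 0 \<longleftrightarrow> P dvd map_poly flsC G"
        using fls_real_root[OF n, of P \<eta>] P self unfolding ev_def by blast
      have dvd_iff: "poly (map_poly (fls_test e n) G) \<theta> = 0 \<longleftrightarrow> p dvd G" for G
        unfolding \<theta> using flsC.map_poly_dvdD[of p G] flsC.map_poly_dvd[of p G] by (auto simp: pP)
      interpret t: fhom "fls_test e n" by (rule fhom_fls_test) (use e n in auto)
      obtain F1 where F1: "F = p * F1" using PF flsC.map_poly_dvdD[of p F] by (auto simp: pP)
      have "poly (map_poly (fls_test e n) p) \<theta> = 0" using dvd_iff by simp
      then obtain p1 where p1: "map_poly (fls_test e n) p = [:- \<theta>, 1:] * p1"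
        by (auto simp: poly_eq_0_iff_dvd)
      \<comment> \<open>The root is simple: otherwise \<open>p\<close> would divide its own
        derivative.\<close>
      have "poly p1 \<theta> \<noteq> 0"
      proof
        assume "poly p1 \<theta> = 0"
        then have "poly (pderiv (map_poly (fls_test e n) p)) \<theta> = 0"
          unfolding p1 pderiv_mult by (simp add: pderiv_pCons)
        then have "p dvd pderiv p" using dvd_iff[of "pderiv p"] unfolding t.map_poly_pderiv by blast
        then show False using dp by simp
      qed
      moreover have "poly (p1 * map_poly (fls_test e n) F1) \<theta> = 0"
      proof (rule fls_nonneg_double_root)
        fix x
        have "fls_nonneg (poly (map_poly (fls_test e n) F) x)"
          using less.prems e n by (rule fls_psdD)
        then show "fls_nonneg (poly ([:- \<theta>, 1:] * (p1 * map_poly (fls_test e n) F1)) x)"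
          unfolding F1 t.map_poly_mult p1 by (simp only: mult.assoc)
      qed
      ultimately have "p dvd F1" by (simp add: dvd_iff)
      then obtain F2 where F2: "F = p ^ 2 * F2" unfolding F1 by (auto simp: power2_eq_square mult.assoc)
      have "fls_psd F2" using less.prems fls_psd_sum_two_squares[of p 0] p0 unfolding F2 by (intro fls_psd_cancel[of "p ^ 2" F2]) auto
      moreover have "degree F2 < degree F"
        using F0 dp unfolding F2 by (subst degree_mult_eq) (auto simp: degree_power_eq)
      ultimately obtain A B where "F2 = A ^ 2 + B ^ 2" using less.hyps by blast
      then have "F = (p * A) ^ 2 + (p * B) ^ 2" by (simp add: F2 power_mult_distrib distrib_left)
      then show ?thesis by blast
    next
      case nself: False
      define P' where "P' = map_poly flscnj P"
      have cnjc: "flscnj (fls_compose_power c n) = fls_compose_power (flscnj c) n" for c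
        using n by (intro fls_eqI) (simp add: fls_nth_compose_power)
      have evc: "poly (ramify n (map_poly flscnj G)) (flscnj \<eta>) = flscnj (ev G)" for G
      proof -
        have "ramify n (map_poly flscnj G) = map_poly flscnj (ramify n G)"
          by (rule poly_eqI) (simp add: cn.coeff_map flscnj.coeff_map cnjc)
        then show ?thesis by (simp add: flscnj.poly_map ev_def)
      qed
      have cc: "map_poly flscnj (map_poly flscnj G) = G" for G
        by (rule poly_eqI, rule fls_eqI) (simp add: flscnj.coeff_map)
      have cF: "map_poly flscnj (map_poly flsC F) = map_poly flsC F"
        by (rule poly_eqI) (simp add: flscnj.coeff_map flsC.coeff_map flscnj_flsC)
      obtain G where G: "map_poly flsC F = P * G" using PF by blast
      have min': "P' dvd H" if "poly (ramify n H) (flscnj \<eta>) = 0" for H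
      proof -
        have "ev (map_poly flscnj H) = 0"
          using evc[of "map_poly flscnj H"] that by (simp add: cc flscnj.eq_0_iff)
        then have "map_poly flscnj P dvd map_poly flscnj (map_poly flscnj H)"
          by (intro flscnj.map_poly_dvd P(3))
        then show ?thesis by (simp add: cc P'_def)
      qed
      have P'1: "lead_coeff P' = 1" "degree P' = degree P"
        using P(2) by (simp_all add: P'_def flscnj.degree_map flscnj.coeff_map flscnj.one)
      \<comment> \<open>Otherwise the conjugate polynomial would divide \<open>P\<close>, and with
        equal degree and leading coefficient it would equal \<open>P\<close>. Hence the conjugate
        root is a root of the cofactor \<open>G\<close>.\<close>
      have "poly (ramify n P) (flscnj \<eta>) \<noteq> 0"
      proof
        assume "poly (ramify n P) (flscnj \<eta>) = 0"
        then have "P' dvd P" by (rule min')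
        then obtain H where H: "P = P' * H" by blast
        have "P \<noteq> 0" using dP by auto
        then have "P' \<noteq> 0" "H \<noteq> 0" using H by (metis mult_zero_left, metis mult_zero_right)
        then have "degree (P' * H) = degree P' + degree H" by (rule degree_mult_eq)
        then have "degree P = degree P' + degree H" by (simp only: H[symmetric])
        then have "degree H = 0" using P'1 by simp
        moreover have "lead_coeff H = 1" using P(2) P'1 unfolding H lead_coeff_mult by simp
        ultimately have "H = 1" by (auto elim: degree_eq_zeroE)
        then show False using H nself by (simp add: P'_def)
      qed
      moreover have "poly (ramify n (map_poly flsC F)) (flscnj \<eta>) = 0"
        using evc[of "map_poly flsC F"] \<eta> by (simp add: cF ev_def flscnj.zero)
      ultimately have "P' dvd G" unfolding G by (intro min') (simp add: cn.map_poly_mult)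
      then have PP': "P * P' dvd map_poly flsC F" unfolding G by simp
      \<comment> \<open>With \<open>P = A + i * B\<close>, the product of \<open>P\<close> and its
        conjugate is the norm form \<open>A^2 + B^2\<close>.\<close>
      define A where "A = map_poly (fls_map Re) P"
      define B where "B = map_poly (fls_map Im) P"
      have f0: "fls_map Re 0 = 0" "fls_map Im 0 = 0" by (rule fls_eqI, simp)+
      have ii: "fls_const \<i> * fls_const \<i> = - 1" by (rule fls_eqI) (simp add: fls_const_mult_const)
      define AC where "AC = map_poly flsC A"
      define BC where "BC = smult (fls_const \<i>) (map_poly flsC B)"
      have "P = AC + BC" "P' = AC - BC"
        by (rule poly_eqI, rule fls_eqI, simp add: AC_def BC_def A_def B_def P'_def flsC.coeff_map flscnj.coeff_map coeff_map_poly f0 complex_eq_iff)+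
      then have "P * P' = (AC + BC) * (AC - BC)" by (simp only:)
      also have "\<dots> = AC ^ 2 - BC ^ 2" by (simp add: power2_eq_square algebra_simps)
      also have "BC ^ 2 = - (map_poly flsC B ^ 2)" by (simp add: BC_def power2_eq_square ii)
      finally have PPD: "P * P' = map_poly flsC (A ^ 2 + B ^ 2)"
        by (simp add: AC_def flsC.map_poly_add flsC.map_poly_power)
      define D where "D = A ^ 2 + B ^ 2"
      have "degree D = degree (P * P')" unfolding PPD by (simp add: D_def flsC.degree_map)
      also have "\<dots> = degree P + degree P'" using P P'1 by (intro degree_mult_eq) auto
      finally have dD: "degree D > 0" using dP by simp
      have "D dvd F" using PP' unfolding PPD D_def by (rule flsC.map_poly_dvdD)
      then obtain F1 where F1: "F = D * F1" by blast
      have "fls_psd D" unfolding D_def by (rule fls_psd_sum_two_squares)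
      then have "fls_psd F1" using less.prems dD unfolding F1 by (intro fls_psd_cancel[of D F1]) auto
      moreover have "degree F1 < degree F"
        using F0 dD unfolding F1 by (subst degree_mult_eq) auto
      ultimately obtain A' B' where "F1 = A' ^ 2 + B' ^ 2" using less.hyps by blast
      then have "F = (A * A' - B * B') ^ 2 + (A * B' + B * A') ^ 2"
        unfolding F1 D_def by (simp only: two_squares_mult)
      then show ?thesis by blast
    qed
  qed
qed

subsection \<open>Local sums of squares\<close>

lemma eval2_poly: "eval2 F x y = poly (poly F [:y:]) x"
  by (induction F) (simp_all add: eval2_def map_poly_pCons)

lemma rhom_eval2: "rhom (\<lambda>F. eval2 F x y)"
  by unfold_locales (simp_all add: eval2_poly)

definition fls_of_poly :: "real poly \<Rightarrow> real fls" where
  "fls_of_poly c = fps_to_fls (fps_of_poly c)"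

interpretation fls_of_poly: rhom fls_of_poly
  by unfold_locales (simp_all add: fls_of_poly_def fps_of_poly_add fps_of_poly_mult fls_times_fps_to_fls)

lemma fls_of_poly_nth: "fls_nth (fls_of_poly c) k = (if k < 0 then 0 else coeff c (nat k))"
  by (simp add: fls_of_poly_def)

lemma fls_of_poly_X: "fls_of_poly [:0, 1:] = fls_X"
  by (rule fls_eqI) (auto simp: fls_of_poly_nth coeff_pCons split: nat.split)

lemma fls_of_poly_const: "fls_of_poly [:c:] = fls_const c"
  by (rule fls_eqI) (auto simp: fls_of_poly_nth coeff_pCons split: nat.split)

text \<open>After removal of \<open>s^k\<close> the sign in the ordering is that of the constant
  term, a limit of non-negative values from the right.\<close>

lemma fls_of_poly_nonneg:
  assumes "r > 0" "\<And>s. 0 < s \<Longrightarrow> s < r \<Longrightarrow> poly W s \<ge> 0"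
  shows "fls_nonneg (fls_of_poly W)"
proof (cases "W = 0")
  case False
  define k where "k = order 0 W"
  obtain V where V: "W = [:- 0, 1:] ^ k * V" "\<not> [:- 0, 1:] dvd V"
    using order_decomp[OF False, of 0] unfolding k_def by blast
  have V0: "poly V 0 \<noteq> 0" using V(2) by (simp add: poly_eq_0_iff_dvd)
  have "((\<lambda>s. poly V s) \<longlongrightarrow> poly V 0) (at_right 0)"
    by (intro tendsto_intros isCont_tendsto_compose[OF poly_isCont]) 
  moreover have "eventually (\<lambda>s. 0 \<le> poly V s) (at_right 0)"
  proof -
    have "eventually (\<lambda>s::real. s \<in> {0<..<r}) (at_right 0)" using assms(1) by (rule eventually_at_right_real)
    then show ?thesis
    proof eventually_elim
      case (elim s)
      have "s ^ k * poly V s \<ge> 0"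
        using assms(2)[of s] elim by (simp add: V(1) poly_power)
      moreover have "s ^ k > 0" using elim by simp
      ultimately show ?case by (simp add: zero_le_mult_iff)
    qed
  qed
  ultimately have "poly V 0 \<ge> 0" by (intro tendsto_lowerbound) auto
  then have "fls_nonneg (fls_of_poly V)"
  proof -
    have "fls_subdegree (fls_of_poly V) = 0"
      using V0 by (intro fls_subdegree_eqI) (auto simp: fls_of_poly_nth poly_0_coeff_0)
    then show ?thesis using \<open>poly V 0 \<ge> 0\<close> by (simp add: fls_nonneg_def fls_of_poly_nth poly_0_coeff_0)
  qed
  moreover have "fls_nonneg (fls_X ^ k)"
    by (simp add: fls_nonneg_def fls_subdegree_pow)
  moreover have "fls_of_poly W = fls_X ^ k * fls_of_poly V"
    by (simp add: V(1) fls_of_poly.mult fls_of_poly.power fls_of_poly_X)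
  ultimately show ?thesis by (simp add: fls_nonneg_mult)
qed (simp add: fls_of_poly.zero fls_nonneg_def)

lemma fls_test_of_poly:
  assumes "e \<noteq> 0" "q > 0"
  shows "fls_test e q (fls_of_poly c) = fls_of_poly (pcompose c (monom e q))"
proof -
  interpret t: fhom "fls_test e q" by (rule fhom_fls_test) fact+
  have X: "fls_test e q fls_X = fls_of_poly (monom e q)"
    using assms by (intro fls_eqI) (auto simp: fls_test_def fls_nth_compose_power fls_scale_nth fls_of_poly_nth div_eq_dividend_iff elim!: dvdE)
  have C: "fls_test e q (fls_const a) = fls_const a" for a
    using assms by (intro fls_eqI) (auto simp: fls_test_def fls_nth_compose_power fls_scale_nth elim!: dvdE)
  show ?thesis
  proof (induction c)
    case (pCons a c)
    have "pCons a c = [:a:] + [:0, 1:] * c" by simp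
    then have "fls_of_poly (pCons a c) = fls_const a + fls_X * fls_of_poly c"
      by (metis fls_of_poly.add fls_of_poly.mult fls_of_poly_const fls_of_poly_X)
    then have "fls_test e q (fls_of_poly (pCons a c)) = fls_const a + fls_of_poly (monom e q) * fls_test e q (fls_of_poly c)"
      by (simp only: t.add t.mult X C)
    also have "\<dots> = fls_of_poly (pcompose (pCons a c) (monom e q))"
      by (simp add: pcompose_pCons pCons.IH fls_of_poly.add fls_of_poly.mult fls_of_poly_const)
    finally show ?case .
  qed (simp add: fls_of_poly.zero t.zero)
qed

lemma poly_altdef_le:
  fixes p :: "'a::comm_ring_1 poly"
  assumes "degree p \<le> d"
  shows "poly p x = (\<Sum>i\<le>d. coeff p i * x ^ i)"
  unfolding poly_altdef by (rule sum.mono_neutral_left) (use assms in \<open>auto simp: coeff_eq_0\<close>)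

text \<open>The sign at \<open>\<theta>\<close> depends on finitely many coefficients, so
  \<open>\<theta>\<close> may be replaced by a Laurent polynomial \<open>T(s) / s^a\<close>.
  Clearing denominators gives a polynomial \<open>W\<close> whose values at small s > 0 are values
  of \<open>F\<close> times a positive power of s.\<close>

lemma fls_psd_of_poly:
  assumes "\<delta> > 0" "\<And>t y. \<bar>t\<bar> < \<delta> \<Longrightarrow> eval2 F t y \<ge> 0"
  shows "fls_psd (map_poly fls_of_poly F)"
  unfolding fls_psd_def
proof (intro ballI allI impI)
  fix e :: real and q :: nat and \<theta> assume e: "e \<in> {1, -1}" and q: "q > 0"
  have e0: "e \<noteq> 0" "\<bar>e\<bar> = 1" using e by auto
  interpret t: fhom "fls_test e q" by (rule fhom_fls_test) (use e q in auto)
  define g where "g = map_poly (fls_test e q) (map_poly fls_of_poly F)"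
  show "fls_nonneg (poly g \<theta>)"
  proof (cases "poly g \<theta> = 0")
    case False
    then obtain N where N: "\<And>h. (\<forall>k<N. fls_nth h k = 0) \<Longrightarrow> fls_nonneg (poly g (\<theta> + h)) \<longleftrightarrow> fls_nonneg (poly g \<theta>)"
      using fls_nonneg_poly_near by blast
    define a where "a = nat (max 0 (- fls_subdegree \<theta>))"
    obtain u where u: "\<theta> = fls_shift (int a) (fps_to_fls u)"
      using fls_as_fps[of \<theta> "int a"] by (auto simp: a_def)
    define T where "T = (\<Sum>i<nat (N + int a). monom (fps_nth u i) i)"
    have T: "coeff T i = (if i < nat (N + int a) then fps_nth u i else 0)" for i
      by (simp add: T_def coeff_sum if_distrib cong: if_cong)
    define \<theta>' where "\<theta>' = fls_shift (int a) (fls_of_poly T)"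
    have "fls_nonneg (poly g (\<theta> + (\<theta>' - \<theta>))) \<longleftrightarrow> fls_nonneg (poly g \<theta>)"
      by (rule N) (auto simp: u \<theta>'_def fls_of_poly_nth T nat_less_iff)
    then have eq: "fls_nonneg (poly g \<theta>') \<longleftrightarrow> fls_nonneg (poly g \<theta>)" by simp
    define d where "d = degree F"
    define x :: "real fls" where "x = fls_X ^ a"
    have x0: "x \<noteq> 0" by (simp add: x_def)
    have xn: "fls_nonneg (x ^ d)"
      by (simp add: x_def fls_nonneg_def fls_subdegree_pow flip: power_mult)
    have x\<theta>: "x * \<theta>' = fls_of_poly T"
      by (simp add: x_def \<theta>'_def fls_X_power_times_conv_shift)
    define W where "W = (\<Sum>i\<le>d. pcompose (coeff F i) (monom e q) * T ^ i * [:0, 1:] ^ (a * (d - i)))"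
    have degg: "degree g \<le> d"
      unfolding g_def d_def by (intro degree_le) (auto simp: t.coeff_map fls_of_poly.coeff_map coeff_eq_0 fls_of_poly.zero t.zero)
    have "x ^ d * poly g \<theta>' = (\<Sum>i\<le>d. x ^ d * (coeff g i * \<theta>' ^ i))"
      by (simp add: poly_altdef_le[OF degg] sum_distrib_left)
    also have "\<dots> = (\<Sum>i\<le>d. coeff g i * (x * \<theta>') ^ i * x ^ (d - i))"
    proof (rule sum.cong)
      fix i assume "i \<in> {..d}"
      then have "x ^ d = x ^ i * x ^ (d - i)" by (simp flip: power_add)
      then show "x ^ d * (coeff g i * \<theta>' ^ i) = coeff g i * (x * \<theta>') ^ i * x ^ (d - i)"
        by (simp add: power_mult_distrib)
    qed simp
    also have "\<dots> = fls_of_poly W"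
      unfolding W_def x\<theta> 
      by (simp add: g_def t.coeff_map fls_of_poly.coeff_map fls_test_of_poly[OF e0(1) q] fls_of_poly.sum
          fls_of_poly.mult fls_of_poly.power x_def power_mult fls_of_poly_X)
    finally have W: "x ^ d * poly g \<theta>' = fls_of_poly W" .
    have "fls_nonneg (fls_of_poly W)"
    proof (rule fls_of_poly_nonneg)
      show "min 1 \<delta> > 0" using assms by simp
      fix s assume s: "0 < s" "s < min 1 \<delta>"
      have "s ^ q \<le> s" using s q power_decreasing[of 1 q s] by simp
      then have "\<bar>e * s ^ q\<bar> < \<delta>" using s e0 by (simp add: abs_mult)
      then have "eval2 F (e * s ^ q) (poly T s / s ^ a) \<ge> 0" by (rule assms(2))
      then have "0 \<le> s ^ (a * d) * eval2 F (e * s ^ q) (poly T s / s ^ a)" using s by simp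
      also have "eval2 F (e * s ^ q) (poly T s / s ^ a) = (\<Sum>i\<le>d. poly (coeff F i) (e * s ^ q) * (poly T s / s ^ a) ^ i)"
        by (simp add: eval2_poly poly_altdef[of F] d_def poly_sum poly_power)
      also have "s ^ (a * d) * \<dots> = poly W s"
        unfolding W_def poly_sum sum_distrib_left
      proof (rule sum.cong)
        fix i assume "i \<in> {..d}"
        then have "a * d = a * i + a * (d - i)" by (simp add: algebra_simps)
        then have "s ^ (a * d) = (s ^ a) ^ i * s ^ (a * (d - i))" by (simp add: power_add power_mult)
        then show "s ^ (a * d) * (poly (coeff F i) (e * s ^ q) * (poly T s / s ^ a) ^ i) =
            poly (coeff F i \<circ>\<^sub>p monom e q * T ^ i * [:0, 1:] ^ (a * (d - i))) s"
          using s by (simp add: poly_pcompose poly_monom poly_power power_divide)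
      qed simp
      finally show "0 \<le> poly W s" .
    qed
    then have "fls_nonneg (x ^ d * poly g \<theta>')" by (simp only: W)
    then have "fls_nonneg (poly g \<theta>')" by (rule fls_nonneg_multD) (use xn x0 in auto)
    then show ?thesis using eq by simp
  qed (simp add: fls_nonneg_def)
qed

text \<open>If k is the lowest exponent and negative, the coefficient at 2k of
  \<open>A^2 + B^2\<close> is a sum of two squares of real polynomials in y. It vanishes, so both
  polynomials do, and no negative exponent survives.\<close>

lemma fls_poly_two_squares_integral:
  fixes A B :: "real fls poly"
  assumes "\<And>i k. k < 0 \<Longrightarrow> fls_nth (coeff (A ^ 2 + B ^ 2) i) k = 0"
  shows "\<forall>i. \<forall>k<0. fls_nth (coeff A i) k = 0 \<and> fls_nth (coeff B i) k = 0"
proof -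
  have ex: "\<exists>K. \<forall>i. \<forall>k<K. fls_nth (coeff C i) k = 0" for C :: "real fls poly"
  proof -
    define K where "K = Min ((\<lambda>i. fls_subdegree (coeff C i)) ` {..degree C})"
    have "K \<le> fls_subdegree (coeff C i)" if "i \<le> degree C" for i
      unfolding K_def using that by (intro Min_le) auto
    then have "fls_nth (coeff C i) k = 0" if "k < K" for i k
    proof (cases "i \<le> degree C")
      case True
      then show ?thesis using that \<open>\<And>i. i \<le> degree C \<Longrightarrow> K \<le> fls_subdegree (coeff C i)\<close>[of i]
        by (intro fls_eq0_below_subdegree) simp
    qed (simp add: coeff_eq_0)
    then show ?thesis by blast
  qed
  from ex[of A] ex[of B] obtain K1 K2 where
    "\<forall>i. \<forall>k<K1. fls_nth (coeff A i) k = 0" "\<forall>i. \<forall>k<K2. fls_nth (coeff B i) k = 0" by blast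
  then have K: "fls_nth (coeff A i) k = 0" "fls_nth (coeff B i) k = 0" if "k < min K1 K2" for i k
    using that by auto
  define V where "V k \<longleftrightarrow> (\<forall>i. fls_nth (coeff A i) k = 0 \<and> fls_nth (coeff B i) k = 0)" for k
  have step: "V k" if k: "k < 0" and below: "\<And>j. j < k \<Longrightarrow> V j" for k
  proof -
    define S where "S C = map_poly (\<lambda>c. fls_nth c k) C" for C :: "real fls poly"
    have Sc: "coeff (S C) i = fls_nth (coeff C i) k" for C i by (simp add: S_def coeff_map_poly)
    have sq: "fls_nth (coeff (C ^ 2) i) (k + k) = coeff (S C ^ 2) i"
      if "\<And>j i. j < k \<Longrightarrow> fls_nth (coeff C i) j = 0" for C i
    proof -
      have "fls_nth (coeff C a * coeff C b) (k + k) = fls_nth (coeff C a) k * fls_nth (coeff C b) k" for a b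
        by (rule fls_mult_nth_lowest) (use that in auto)
      then show ?thesis by (simp add: power2_eq_square coeff_mult Sc fls_nth_sum)
    qed
    have "S A ^ 2 + S B ^ 2 = 0"
    proof (rule poly_eqI)
      fix i
      have "coeff (S A ^ 2 + S B ^ 2) i = fls_nth (coeff (A ^ 2 + B ^ 2) i) (k + k)"
        using sq[of A i] sq[of B i] below by (simp add: V_def)
      then show "coeff (S A ^ 2 + S B ^ 2) i = coeff 0 i" using assms[of "k + k" i] k by simp
    qed
    then have "S A = 0" "S B = 0" by (simp_all add: sum_power2_eq_zero_iff)
    then show "V k" unfolding V_def by (metis Sc coeff_0)
  qed
  have "\<forall>k<min K1 K2 + int n. k < 0 \<longrightarrow> V k" for n
  proof (induction n)
    case (Suc n)
    have "k < min K1 K2 + int (Suc n) \<longleftrightarrow> k < min K1 K2 + int n \<or> k = min K1 K2 + int n" for k by auto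
    then show ?case using Suc step[of "min K1 K2 + int n"] by auto
  qed (auto simp: V_def K)
  note below = this
  have "V k" if "k < 0" for k
    using that below[of "nat (k + 1 - min K1 K2)"] by (cases "k < min K1 K2") (auto simp: V_def K)
  then show ?thesis by (auto simp: V_def)
qed

text \<open>The series coefficients of \<open>A\<close> and \<open>B\<close> are integral, so
  truncation at order n changes the squares only by multiples of \<open>t^n\<close> and leaves
  polynomials.\<close>

theorem local_two_squares:
  fixes F :: bpoly
  assumes "\<delta> > 0" "\<And>t y. \<bar>t\<bar> < \<delta> \<Longrightarrow> eval2 F t y \<ge> 0"
  shows "\<exists>A B :: bpoly. 2 * degree A \<le> degree F \<and> 2 * degree B \<le> degree F \<and>
     [:[:0, 1:] ^ n:] dvd F - (A ^ 2 + B ^ 2)"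
proof -
  obtain A B where AB: "map_poly fls_of_poly F = A ^ 2 + B ^ 2"
    using fls_psd_two_squares[OF fls_psd_of_poly[OF assms]] by blast
  have dF: "degree (map_poly fls_of_poly F) \<le> degree F"
    by (intro degree_le) (auto simp: fls_of_poly.coeff_map coeff_eq_0 fls_of_poly.zero)
  have deg: "2 * degree A \<le> degree F" "2 * degree B \<le> degree F"
    using poly_two_squares_degree[of A B, OF fls_two_squares_eq_0] dF unfolding AB by auto
  have "fls_nth (coeff (A ^ 2 + B ^ 2) i) k = 0" if "k < 0" for i k
    using that unfolding AB[symmetric] by (simp add: fls_of_poly.coeff_map fls_of_poly_nth)
  from fls_poly_two_squares_integral[OF this]
  have int: "fls_nth (coeff A i) k = 0" "fls_nth (coeff B i) k = 0" if "k < 0" for i k using that by auto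
  define tr where "tr c = (\<Sum>k<n. monom (fls_nth c (int k)) k)" for c :: "real fls"
  have trc: "coeff (tr c) k = (if k < n then fls_nth c (int k) else 0)" for c k
    by (simp add: tr_def coeff_sum if_distrib cong: if_cong)
  have tr0: "tr 0 = 0" by (rule poly_eqI) (simp add: trc)
  define T where "T C = map_poly tr C" for C
  have Tc: "coeff (T C) i = tr (coeff C i)" for C i by (simp add: T_def coeff_map_poly tr0)
  have dT: "degree (T C) \<le> degree C" for C by (intro degree_le) (auto simp: Tc coeff_eq_0 tr0)
  have diff: "fls_nth (coeff (C ^ 2 - map_poly fls_of_poly (T C ^ 2)) i) k = 0"
    if C: "\<And>i k. k < 0 \<Longrightarrow> fls_nth (coeff C i) k = 0" and k: "k < int n" for C i k
  proof -
    define C' where "C' = map_poly fls_of_poly (T C)"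
    have C': "fls_nth (coeff C' i) k = (if k < 0 then 0 else if k < int n then fls_nth (coeff C i) k else 0)" for i k
      by (auto simp: C'_def fls_of_poly.coeff_map fls_of_poly_nth Tc trc nat_less_iff)
    have "C ^ 2 - map_poly fls_of_poly (T C ^ 2) = (C - C') * (C + C')"
      by (simp add: C'_def fls_of_poly.map_poly_mult power2_eq_square algebra_simps)
    moreover have "fls_nth (coeff (C - C') a * coeff (C + C') b) k = 0" for a b
      by (rule fls_mult_vanish[of "int n" _ 0]) (use C C' k in auto)
    ultimately show ?thesis by (simp only: coeff_mult fls_nth_sum) simp
  qed
  have "[:[:0, 1:] ^ n:] dvd F - (T A ^ 2 + T B ^ 2)"
    unfolding const_poly_dvd_iff
  proof
    fix i
    have e: "map_poly fls_of_poly (F - (T A ^ 2 + T B ^ 2)) =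
       (A ^ 2 - map_poly fls_of_poly (T A ^ 2)) + (B ^ 2 - map_poly fls_of_poly (T B ^ 2))"
      by (simp add: fls_of_poly.map_poly_diff fls_of_poly.map_poly_add AB)
    have "coeff (coeff (F - (T A ^ 2 + T B ^ 2)) i) k = 0" if "k < n" for k
    proof -
      have "coeff (coeff (F - (T A ^ 2 + T B ^ 2)) i) k = fls_nth (coeff (map_poly fls_of_poly (F - (T A ^ 2 + T B ^ 2))) i) (int k)"
        unfolding fls_of_poly.coeff_map by (simp add: fls_of_poly_nth)
      also have "\<dots> = 0" unfolding e coeff_add fls_plus_nth using diff[OF int(1)] diff[OF int(2)] that by simp
      finally show ?thesis .
    qed
    then have "monom 1 n dvd coeff (F - (T A ^ 2 + T B ^ 2)) i" by (simp add: monom_1_dvd_iff')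
    then show "[:0, 1:] ^ n dvd coeff (F - (T A ^ 2 + T B ^ 2)) i" by (simp add: monom_altdef)
  qed
  then show ?thesis using deg dT[of A] dT[of B] by (intro exI[of _ "T A"] exI[of _ "T B"]) auto
qed

text \<open>After \<open>t = s^2\<close> non-negativity holds on both sides of 0. With
  \<open>A = A0(s^2) + s * A1(s^2)\<close> and likewise for \<open>B\<close>, the even part of
  \<open>A^2 + B^2\<close> is \<open>A0^2 + B0^2 + t * (A1^2 + B1^2)\<close>. Matching to order 2n
  in s gives order n in t.\<close>

theorem local_two_squares_onesided:
  fixes F :: bpoly
  assumes "\<delta> > 0" "\<And>t y. 0 \<le> t \<Longrightarrow> t < \<delta> \<Longrightarrow> eval2 F t y \<ge> 0"
  shows "\<exists>A B C D :: bpoly. 2 * degree A \<le> degree F \<and> 2 * degree B \<le> degree F \<and> 2 * degree C \<le> degree F \<and> 2 * degree D \<le> degree F \<and>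
     [:[:0, 1:] ^ n:] dvd F - (A ^ 2 + B ^ 2 + [:[:0, 1:]:] * (C ^ 2 + D ^ 2))"
proof -
  define sq :: "real poly \<Rightarrow> real poly" where "sq c = pcompose c (monom 1 2)" for c
  interpret sq: rhom sq by unfold_locales (simp_all add: sq_def pcompose_add pcompose_mult pcompose_1)
  define G where "G = map_poly sq F"
  have evG: "eval2 G s y = eval2 F (s ^ 2) y" for s y
    unfolding G_def by (induction F) (simp_all add: eval2_def map_poly_pCons sq.zero sq_def poly_pcompose poly_monom)
  have dG: "degree G \<le> degree F"
    unfolding G_def by (intro degree_le) (auto simp: sq.coeff_map coeff_eq_0 sq.zero)
  have "eval2 G s y \<ge> 0" if "\<bar>s\<bar> < min 1 \<delta>" for s y
  proof -
    have "s ^ 2 \<le> \<bar>s\<bar>" using that power_decreasing[of 1 2 "\<bar>s\<bar>"] by simp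
    then show ?thesis unfolding evG using that by (intro assms(2)) auto
  qed
  then obtain A B where deg: "2 * degree A \<le> degree G" "2 * degree B \<le> degree G"
    and dv: "[:[:0, 1:] ^ (2 * n):] dvd G - (A ^ 2 + B ^ 2)"
    using local_two_squares[of "min 1 \<delta>" G "2 * n"] assms(1) by auto
  define ev where "ev c = (\<Sum>k\<le>degree c. monom (coeff c (2 * k)) k)" for c :: "real poly"
  define od where "od c = (\<Sum>k\<le>degree c. monom (coeff c (2 * k + 1)) k)" for c :: "real poly"
  have evc: "coeff (ev c) k = coeff c (2 * k)" for c k
    by (auto simp: ev_def coeff_sum if_distrib not_le coeff_eq_0 cong: if_cong)
  have odc: "coeff (od c) k = coeff c (2 * k + 1)" for c k
    by (auto simp: od_def coeff_sum if_distrib not_le coeff_eq_0 cong: if_cong)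
  have z: "ev 0 = 0" "od 0 = 0" by (rule poly_eqI, simp add: evc odc)+
  have sqc: "coeff (sq c) k = (if even k then coeff c (k div 2) else 0)" for c k
  proof (induction c arbitrary: k)
    case (pCons a c)
    have "sq (pCons a c) = [:a:] + monom 1 2 * sq c" by (simp add: sq_def pcompose_pCons)
    then show ?case using pCons.IH
      by (cases k; cases "k - 1") (auto simp: coeff_monom_mult coeff_pCons split: nat.split)
  qed (simp add: sq.zero)
  define X :: bpoly where "X = [:[:0, 1:]:]"
  have dec: "C = map_poly sq (map_poly ev C) + X * map_poly sq (map_poly od C)" for C
  proof (rule poly_eqI, rule poly_eqI)
    fix i k
    show "coeff (coeff C i) k = coeff (coeff (map_poly sq (map_poly ev C) + X * map_poly sq (map_poly od C)) i) k"
      by (cases k) (auto simp: X_def sq.coeff_map coeff_map_poly z sqc evc odc elim!: evenE oddE)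
  qed
  define A0 A1 B0 B1 where "A0 = map_poly ev A" and "A1 = map_poly od A" and "B0 = map_poly ev B" and "B1 = map_poly od B"
  define R where "R = F - (A0 ^ 2 + B0 ^ 2 + X * (A1 ^ 2 + B1 ^ 2))"
  have XX: "map_poly sq X = X ^ 2"
    by (simp add: X_def map_poly_pCons sq.zero sq_def pcompose_pCons power2_eq_square monom_altdef)
  \<comment> \<open>The cross terms carry an odd power of s and are invisible to the even
    coefficients.\<close>
  have "G - (A ^ 2 + B ^ 2) = map_poly sq R - X * map_poly sq ((A0 * A1 + B0 * B1) + (A0 * A1 + B0 * B1))"
  proof -
    have A: "A = map_poly sq A0 + X * map_poly sq A1" and B: "B = map_poly sq B0 + X * map_poly sq B1"
      unfolding A0_def A1_def B0_def B1_def by (rule dec)+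
    have "map_poly sq R = G - (map_poly sq A0 ^ 2 + map_poly sq B0 ^ 2 + X ^ 2 * (map_poly sq A1 ^ 2 + map_poly sq B1 ^ 2))"
      by (simp add: R_def G_def sq.map_poly_diff sq.map_poly_add sq.map_poly_mult sq.map_poly_power XX)
    then show ?thesis
      unfolding sq.map_poly_add sq.map_poly_mult by (subst A, subst B) (simp add: power2_eq_square algebra_simps)
  qed
  then have e: "coeff (coeff (G - (A ^ 2 + B ^ 2)) i) (2 * k) = coeff (coeff R i) k" for i k
    by (cases k) (simp_all add: X_def sq.coeff_map sqc)
  have "[:[:0, 1:] ^ n:] dvd R"
    unfolding const_poly_dvd_iff
  proof
    fix i
    have "[:0, 1:] ^ (2 * n) dvd coeff (G - (A ^ 2 + B ^ 2)) i" using dv unfolding const_poly_dvd_iff by blast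
    then have "\<forall>k<2 * n. coeff (coeff (G - (A ^ 2 + B ^ 2)) i) k = 0"
      using monom_1_dvd_iff'[of "2 * n" "coeff (G - (A ^ 2 + B ^ 2)) i"] by (simp add: monom_altdef)
    then have "\<forall>k<n. coeff (coeff R i) k = 0" by (simp flip: e)
    then show "[:0, 1:] ^ n dvd coeff R i"
      using monom_1_dvd_iff'[of n "coeff R i"] by (simp add: monom_altdef)
  qed
  moreover have "degree A0 \<le> degree A" "degree A1 \<le> degree A" "degree B0 \<le> degree B" "degree B1 \<le> degree B"
    unfolding A0_def A1_def B0_def B1_def
    by (intro degree_le; auto simp: coeff_map_poly z coeff_eq_0)+
  ultimately show ?thesis using deg dG unfolding R_def X_def
    by (intro exI[of _ A0] exI[of _ B0] exI[of _ A1] exI[of _ B1]) auto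
qed

subsection \<open>Quadratic modules\<close>

text \<open>The local-to-global argument relies on these closure properties and on explicit
  membership hypotheses, never on a list of generators.\<close>

locale quadratic_module =
  fixes M :: "bpoly set"
  assumes square: "p ^ 2 \<in> M"
    and add: "f \<in> M \<Longrightarrow> g \<in> M \<Longrightarrow> f + g \<in> M"
    and square_mult: "f \<in> M \<Longrightarrow> p ^ 2 * f \<in> M"
begin

lemma zero: "0 \<in> M"
  using square[of 0] by simp

lemma sum: "(\<And>i. i \<in> I \<Longrightarrow> f i \<in> M) \<Longrightarrow> sum f I \<in> M"
  by (induction I rule: infinite_finite_induct) (auto intro: zero add)

end

lemma is_sos_add: "is_sos s \<Longrightarrow> is_sos t \<Longrightarrow> is_sos (s + t)"
  unfolding is_sos_def by (metis map_append sum_list_append)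

lemma is_sos_square: "is_sos (p ^ 2)"
  unfolding is_sos_def by (rule exI[of _ "[p]"]) simp

lemma is_sos_0: "is_sos 0"
  using is_sos_square[of 0] by simp

lemma is_sos_square_mult: "is_sos s \<Longrightarrow> is_sos (p ^ 2 * s)"
proof -
  assume "is_sos s"
  then obtain ps where "s = sum_list (map (\<lambda>q. q ^ 2) ps)" unfolding is_sos_def by blast
  then have "p ^ 2 * s = sum_list (map (\<lambda>q. q ^ 2) (map (\<lambda>q. p * q) ps))"
    by (simp add: sum_list_const_mult[symmetric] power_mult_distrib o_def)
  then show ?thesis unfolding is_sos_def by blast
qed

lemma qmodule_Nil: "qmodule [] = {s. is_sos s}"
  by (auto simp: qmodule_def)

lemma qmodule_Cons: "qmodule (g # gs) = {f + s * g | f s. f \<in> qmodule gs \<and> is_sos s}"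
proof safe
  fix f assume "f \<in> qmodule (g # gs)"
  then obtain s0 ss where s: "is_sos s0" "length ss = Suc (length gs)" "\<forall>s\<in>set ss. is_sos s"
    "f = s0 + sum_list (map2 (*) ss (g # gs))" by (auto simp: qmodule_def)
  then obtain s ss' where ss: "ss = s # ss'" by (cases ss) auto
  have "s0 + sum_list (map2 (*) ss' gs) \<in> qmodule gs"
    using s unfolding ss qmodule_def by auto
  then show "\<exists>f' s. f = f' + s * g \<and> f' \<in> qmodule gs \<and> is_sos s"
    using s unfolding ss by (intro exI[of _ "s0 + sum_list (map2 (*) ss' gs)"] exI[of _ s]) auto
next
  fix f s assume "f \<in> qmodule gs" "is_sos s"
  then obtain s0 ss where s: "is_sos s0" "length ss = length gs" "\<forall>s\<in>set ss. is_sos s"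
    "f = s0 + sum_list (map2 (*) ss gs)" by (auto simp: qmodule_def)
  with \<open>is_sos s\<close> show "f + s * g \<in> qmodule (g # gs)"
    unfolding qmodule_def by (intro CollectI exI[of _ s0] exI[of _ "s # ss"]) auto
qed

lemma quadratic_module_qmodule: "quadratic_module (qmodule gs)"
proof (induction gs)
  case Nil
  show ?case by unfold_locales (auto simp: qmodule_Nil is_sos_square is_sos_add is_sos_square_mult)
next
  case (Cons g gs)
  interpret quadratic_module "qmodule gs" by fact
  show ?case
  proof
    show "p ^ 2 \<in> qmodule (g # gs)" for p
      unfolding qmodule_Cons using square[of p] is_sos_0 by force
    fix f assume "f \<in> qmodule (g # gs)"
    then obtain f1 s1 where f: "f = f1 + s1 * g" "f1 \<in> qmodule gs" "is_sos s1" unfolding qmodule_Cons by blast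
    have "p ^ 2 * f = p ^ 2 * f1 + (p ^ 2 * s1) * g" for p by (simp add: f algebra_simps)
    then show "p ^ 2 * f \<in> qmodule (g # gs)" for p
      unfolding qmodule_Cons using square_mult f is_sos_square_mult by blast
    fix h assume "h \<in> qmodule (g # gs)"
    then obtain f2 s2 where h: "h = f2 + s2 * g" "f2 \<in> qmodule gs" "is_sos s2" unfolding qmodule_Cons by blast
    have "f + h = (f1 + f2) + (s1 + s2) * g" by (simp add: f h algebra_simps)
    then show "f + h \<in> qmodule (g # gs)"
      unfolding qmodule_Cons using add f h is_sos_add by blast
  qed
qed

lemma qmodule_generator: "g \<in> set gs \<Longrightarrow> g \<in> qmodule gs"
proof (induction gs)
  case (Cons h gs)
  interpret quadratic_module "qmodule gs" by (rule quadratic_module_qmodule)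
  show ?case
  proof (cases "g = h")
    case True
    have "g = 0 + 1 ^ 2 * h" using True by simp
    then show ?thesis unfolding qmodule_Cons using zero is_sos_square by blast
  next
    case False
    then have "g \<in> qmodule gs" using Cons by simp
    moreover have "g = g + 0 * h" by simp
    ultimately show ?thesis unfolding qmodule_Cons using is_sos_0 by blast
  qed
qed simp

subsection \<open>Polynomials that are non-negative on an interval\<close>

lemma poly_nonneg_right:
  fixes p :: "real poly"
  assumes "r < b" "\<And>x. r < x \<Longrightarrow> x < b \<Longrightarrow> poly p x \<ge> 0"
  shows "poly p r \<ge> 0"
proof -
  have "((\<lambda>s. poly p s) \<longlongrightarrow> poly p r) (at_right r)"
    by (intro tendsto_intros isCont_tendsto_compose[OF poly_isCont])
  moreover have "eventually (\<lambda>s. 0 \<le> poly p s) (at_right r)"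
    using eventually_at_right_real[OF assms(1)] by eventually_elim (use assms in auto)
  ultimately show ?thesis by (intro tendsto_lowerbound) auto
qed

lemma poly_nonneg_left:
  fixes p :: "real poly"
  assumes "a < r" "\<And>x. a < x \<Longrightarrow> x < r \<Longrightarrow> poly p x \<ge> 0"
  shows "poly p r \<ge> 0"
proof -
  have "((\<lambda>s. poly p s) \<longlongrightarrow> poly p r) (at_left r)"
    by (intro tendsto_intros isCont_tendsto_compose[OF poly_isCont])
  moreover have "eventually (\<lambda>s. 0 \<le> poly p s) (at_left r)"
    using eventually_at_left_real[OF assms(1)] by eventually_elim (use assms in auto)
  ultimately show ?thesis by (intro tendsto_lowerbound) auto
qed

text \<open>The quadratic module in R[x] generated by \<open>x - A\<close> and
  \<open>B - x\<close>.\<close>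

inductive_set interval_cone :: "real \<Rightarrow> real \<Rightarrow> real poly set" for A B where
  square: "p ^ 2 \<in> interval_cone A B"
| left: "p ^ 2 * [:- A, 1:] \<in> interval_cone A B"
| right: "p ^ 2 * [:B, -1:] \<in> interval_cone A B"
| add: "p \<in> interval_cone A B \<Longrightarrow> q \<in> interval_cone A B \<Longrightarrow> p + q \<in> interval_cone A B"

text \<open>\<open>(x - A) + (B - x)\<close> is the positive constant \<open>B - A\<close>;
  multiplying the product by it yields a square times each generator. Hence the cone is closed under
  multiplication by the generators.\<close>

lemma interval_cone_cross:
  assumes "A < B"
  shows "p ^ 2 * ([:- A, 1:] * [:B, -1:]) \<in> interval_cone A B"
proof -
  define c where "c = 1 / sqrt (B - A)"
  have c: "c ^ 2 * (B - A) = 1" using assms by (simp add: c_def power_divide)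
  have "[:- A, 1:] + [:B, -1:] = [:B - A:]" by simp
  then have "p ^ 2 * ([:- A, 1:] * [:B, -1:]) = smult (c ^ 2) (p ^ 2 * ([:- A, 1:] * [:B, -1:]) * ([:- A, 1:] + [:B, -1:]))"
    using c by (simp only: mult.commute[of _ "[:B - A:]"]) simp
  also have "\<dots> = (smult c (p * [:- A, 1:])) ^ 2 * [:B, -1:] + (smult c (p * [:B, -1:])) ^ 2 * [:- A, 1:]"
    unfolding distrib_left smult_add_right
    by (simp only: power2_eq_square mult_smult_left mult_smult_right smult_smult ac_simps)
  also have "\<dots> \<in> interval_cone A B" by (intro interval_cone.intros)
  finally show ?thesis .
qed

lemma interval_cone_square_mult: "q \<in> interval_cone A B \<Longrightarrow> p ^ 2 * q \<in> interval_cone A B"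
proof (induction rule: interval_cone.induct)
  case (square r)
  then show ?case using interval_cone.square[of "p * r"] by (simp add: power_mult_distrib)
next
  case (left r)
  then show ?case using interval_cone.left[of "p * r"] by (simp only: power_mult_distrib mult.assoc)
next
  case (right r)
  then show ?case using interval_cone.right[of "p * r"] by (simp only: power_mult_distrib mult.assoc)
qed (simp add: distrib_left interval_cone.add)

lemma interval_cone_mult:
  assumes "A < B" "q \<in> interval_cone A B" "l \<in> {[:- A, 1:], [:B, -1:]}"
  shows "l * q \<in> interval_cone A B"
  using assms(2)
proof induction
  case (square r)
  then show ?case using assms(3) interval_cone.left[of r] interval_cone.right[of r] by (auto simp only: mult.commute)
next
  case (left r)
  have "[:- A, 1:] * (r ^ 2 * [:- A, 1:]) = (r * [:- A, 1:]) ^ 2" "[:B, -1:] * (r ^ 2 * [:- A, 1:]) = r ^ 2 * ([:- A, 1:] * [:B, -1:])"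
    by (simp_all only: power2_eq_square ac_simps)
  then show ?case using assms(3) interval_cone.square interval_cone_cross[OF assms(1), of r] by auto
next
  case (right r)
  have "[:B, -1:] * (r ^ 2 * [:B, -1:]) = (r * [:B, -1:]) ^ 2" "[:- A, 1:] * (r ^ 2 * [:B, -1:]) = r ^ 2 * ([:- A, 1:] * [:B, -1:])"
    by (simp_all only: power2_eq_square ac_simps)
  then show ?case using assms(3) interval_cone.square interval_cone_cross[OF assms(1), of r] by auto
qed (simp only: distrib_left interval_cone.add)

text \<open>Subtracting the minimum produces a zero in the interval, which can be divided out.\<close>

theorem nonneg_imp_interval_cone:
  assumes "A < B" "\<And>x. A \<le> x \<Longrightarrow> x \<le> B \<Longrightarrow> poly p x \<ge> 0"
  shows "p \<in> interval_cone A B"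
  using assms(2)
proof (induction "degree p" arbitrary: p rule: less_induct)
  case less
  have const: "[:c:] \<in> interval_cone A B" if "c \<ge> 0" for c
    using interval_cone.square[of "[:sqrt c:]" A B] that by (simp add: power2_eq_square)
  show ?case
  proof (cases "degree p = 0")
    case True
    then obtain c where "p = [:c:]" by (rule degree_eq_zeroE)
    then show ?thesis using const[of c] less.prems[of A] assms(1) by simp
  next
    case False
    have "\<exists>x\<in>{A..B}. \<forall>y\<in>{A..B}. poly p x \<le> poly p y"
      by (rule continuous_attains_inf) (use assms(1) in \<open>auto intro!: continuous_intros\<close>)
    then obtain r where r: "A \<le> r" "r \<le> B" "\<And>y. A \<le> y \<Longrightarrow> y \<le> B \<Longrightarrow> poly p r \<le> poly p y" by auto
    define m where "m = poly p r"
    have m: "m \<ge> 0" using less.prems r by (simp add: m_def)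
    have "poly (p - [:m:]) r = 0" by (simp add: m_def)
    then have "[:- r, 1:] dvd p - [:m:]" by (simp only: poly_eq_0_iff_dvd)
    then obtain q where q: "p - [:m:] = [:- r, 1:] * q" by (rule dvdE)
    have dpm: "degree (p - [:m:]) = degree p"
    proof -
      have "degree (p + - [:m:]) = degree p" by (rule degree_add_eq_left) (use False in simp)
      then show ?thesis by (simp only: diff_conv_add_uminus)
    qed
    have q0: "q \<noteq> 0" using q dpm False by auto
    have dq: "degree p = Suc (degree q)"
    proof -
      have "degree ([:- r, 1:] * q) = degree [:- r, 1:] + degree q" using q0 by (intro degree_mult_eq) auto
      then show ?thesis using dpm unfolding q by simp
    qed
    have pe: "p = [:m:] + [:- r, 1:] * q" unfolding q[symmetric] by simp
    have sgn: "(y - r) * poly q y \<ge> 0" if "A \<le> y" "y \<le> B" for y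
    proof -
      have "poly p y = m + (y - r) * poly q y" by (subst pe) (simp add: algebra_simps)
      then show ?thesis using r(3)[OF that] by (simp add: m_def)
    qed
    have R: "poly q y \<ge> 0" if "r < y" "y \<le> B" for y
      using sgn[of y] that r by (simp add: zero_le_mult_iff)
    have L: "poly q y \<le> 0" if "A \<le> y" "y < r" for y
      using sgn[of y] that r by (simp add: zero_le_mult_iff)
    consider "r = A" | "r = B" | "A < r" "r < B" using r by linarith
    then show ?thesis
    proof cases
      case 1
      have "poly q y \<ge> 0" if "A \<le> y" "y \<le> B" for y
        using R[of y] that 1 poly_nonneg_right[of r B q] R assms(1) by (cases "y = r") auto
      then have "q \<in> interval_cone A B" using less.hyps[of q] dq by auto
      from interval_cone_mult[OF assms(1) this, of "[:- A, 1:]"] have "[:- A, 1:] * q \<in> interval_cone A B" by simp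
      then show ?thesis
        unfolding 1[symmetric] by (subst pe) (use 1 const[OF m] in \<open>auto intro: interval_cone.add\<close>)
    next
      case 2
      have "poly (- q) y \<ge> 0" if "A \<le> y" "y \<le> B" for y
        using L[of y] that 2 poly_nonneg_left[of A r "- q"] L assms(1) by (cases "y = r") auto
      then have "- q \<in> interval_cone A B" using less.hyps[of "- q"] dq by auto
      from interval_cone_mult[OF assms(1) this, of "[:B, -1:]"] have "[:- r, 1:] * q \<in> interval_cone A B"
        by (simp add: 2)
      then show ?thesis by (subst pe) (use const[OF m] in \<open>auto intro: interval_cone.add\<close>)
    next
      case 3
      \<comment> \<open>At an interior minimum \<open>q\<close> is non-negative on the right and
        non-positive on the left, so it vanishes at \<open>r\<close> and a second linear factor
        comes out.\<close>
      have "poly q r \<ge> 0" using poly_nonneg_right[of r B q] R 3 by auto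
      moreover have "poly (- q) r \<ge> 0" using poly_nonneg_left[of A r "- q"] L 3 by auto
      ultimately have "poly q r = 0" by simp
      then have "[:- r, 1:] dvd q" by (simp only: poly_eq_0_iff_dvd)
      then obtain q' where q': "q = [:- r, 1:] * q'" by (rule dvdE)
      have R': "poly q' y \<ge> 0" if "y \<noteq> r" "A \<le> y" "y \<le> B" for y
      proof -
        have "(y - r) * (y - r) * poly q' y \<ge> 0" using sgn[of y] that by (simp add: q' algebra_simps)
        moreover have "(y - r) * (y - r) > 0" using that by (auto simp: zero_less_mult_iff)
        ultimately show ?thesis by (simp add: zero_le_mult_iff)
      qed
      have "poly q' y \<ge> 0" if "A \<le> y" "y \<le> B" for y
        using R'[of y] that poly_nonneg_right[of r B q'] R' 3 by (cases "y = r") auto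
      moreover have "degree q' < degree p"
      proof -
        have "degree ([:- r, 1:] * q') = degree [:- r, 1:] + degree q'" using q0 unfolding q' by (intro degree_mult_eq) auto
        then show ?thesis using dq q' by simp
      qed
      ultimately have "q' \<in> interval_cone A B" using less.hyps[of q'] by auto
      then have "[:- r, 1:] ^ 2 * q' \<in> interval_cone A B" by (rule interval_cone_square_mult)
      moreover have "[:- r, 1:] * q = [:- r, 1:] ^ 2 * q'" by (simp only: q' power2_eq_square mult.assoc)
      ultimately have "[:- r, 1:] * q \<in> interval_cone A B" by simp
      then show ?thesis by (subst pe) (use const[OF m] in \<open>auto intro: interval_cone.add\<close>)
    qed
  qed
qed

lemma (in quadratic_module) interval:
  assumes "A < B" "[:[:- A, 1:]:] \<in> M" "[:[:B, -1:]:] \<in> M"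
    and "\<And>x. A \<le> x \<Longrightarrow> x \<le> B \<Longrightarrow> poly p x \<ge> 0"
  shows "[:p:] * q ^ 2 \<in> M"
proof -
  have "p \<in> interval_cone A B" using assms by (intro nonneg_imp_interval_cone) auto
  then show ?thesis
  proof induction
    case (square r)
    have "[:r ^ 2:] * q ^ 2 = ([:r:] * q) ^ 2" by (simp add: power2_eq_square)
    then show ?case using quadratic_module.square[OF quadratic_module_axioms] by metis
  next
    case (left r)
    have "[:r ^ 2 * [:- A, 1:]:] * q ^ 2 = ([:r:] * q) ^ 2 * [:[:- A, 1:]:]" by (simp add: power2_eq_square ac_simps)
    then show ?case using square_mult[OF assms(2), of "[:r:] * q"] by simp
  next
    case (right r)
    have "[:r ^ 2 * [:B, -1:]:] * q ^ 2 = ([:r:] * q) ^ 2 * [:[:B, -1:]:]" by (simp add: power2_eq_square ac_simps)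
    then show ?case using square_mult[OF assms(3), of "[:r:] * q"] by simp
  next
    case (add p p')
    have "[:p + p':] * q ^ 2 = [:p:] * q ^ 2 + [:p':] * q ^ 2" by (simp add: smult_add_left)
    then show ?case using add.IH quadratic_module.add[OF quadratic_module_axioms] by metis
  qed
qed

subsection \<open>From local to global membership\<close>

lemma weierstrass_poly:
  fixes f :: "real \<Rightarrow> real"
  assumes "continuous_on {A..B} f" "e > 0"
  shows "\<exists>p :: real poly. \<forall>x\<in>{A..B}. \<bar>f x - poly p x\<bar> < e"
proof -
  obtain g where g: "real_polynomial_function g" "\<And>x. x \<in> {A..B} \<Longrightarrow> \<bar>f x - g x\<bar> < e"
    using Stone_Weierstrass_real_polynomial_function[OF compact_Icc assms(1,2)] by blast
  then obtain a n where "g = (\<lambda>x. \<Sum>i\<le>n. a i * x ^ i)"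
    unfolding real_polynomial_function_iff_sum by blast
  then have "g x = poly (\<Sum>i\<le>n. monom (a i) i) x" for x
    by (simp add: poly_sum poly_monom)
  then show ?thesis using g(2) by metis
qed

text \<open>Coprime factors for the real roots on the two sides of \<open>v\<close> allow a
  different constant to be interpolated on each side.\<close>

lemma poly_split_roots:
  fixes h :: "real poly"
  assumes "h \<noteq> 0"
  shows "\<exists>hL hR. h = hL * hR \<and> (\<forall>x>v. poly hL x \<noteq> 0) \<and> (\<forall>x\<le>v. poly hR x \<noteq> 0) \<and> coprime hL hR"
  using assms
proof (induction "degree h" arbitrary: h rule: less_induct)
  case less
  show ?case
  proof (cases "\<exists>z\<le>v. poly h z = 0")
    case False
    then show ?thesis by (intro exI[of _ 1] exI[of _ h]) auto
  next
    case True
    then obtain z where z: "z \<le> v" "poly h z = 0" by blast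
    then have "[:- z, 1:] dvd h" by (simp only: poly_eq_0_iff_dvd)
    then obtain h' where h': "h = [:- z, 1:] * h'" by (rule dvdE)
    have "h' \<noteq> 0" using less.prems h' by auto
    moreover have "degree h' < degree h"
    proof -
      have "degree ([:- z, 1:] * h') = degree [:- z, 1:] + degree h'" using \<open>h' \<noteq> 0\<close> by (intro degree_mult_eq) auto
      then show ?thesis using h' by simp
    qed
    ultimately obtain hL hR where H: "h' = hL * hR" "\<forall>x>v. poly hL x \<noteq> 0" "\<forall>x\<le>v. poly hR x \<noteq> 0" "coprime hL hR"
      using less.hyps[of h'] by blast
    have "coprime [:- z, 1:] hR"
    proof -
      have "prime_elem [:- z, 1:]" by (intro irreducible_imp_prime_elem irreducible_linear_field_poly) auto
      moreover have "\<not> [:- z, 1:] dvd hR" using H(3) z(1) by (simp only: poly_eq_0_iff_dvd[symmetric]) simp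
      ultimately show ?thesis by (rule prime_elem_imp_coprime)
    qed
    then have "coprime ([:- z, 1:] * hL) hR" using H(4) by (simp only: coprime_mult_left_iff)
    moreover have "h = [:- z, 1:] * hL * hR" unfolding h' H(1) by (simp only: mult.assoc)
    moreover have "\<forall>x>v. poly ([:- z, 1:] * hL) x \<noteq> 0" using H(2) z(1) unfolding poly_mult by auto
    ultimately show ?thesis using H(3) by blast
  qed
qed

text \<open>A function that is locally constant near the zeros of \<open>h\<close> is approximated by polynomials
  up to multiples of \<open>h\<close>: interpolate it to high order at the zeros, divide by \<open>h\<close> and apply the
  Weierstrass theorem.\<close>

lemma step_approx:
  fixes h :: "real poly" and \<phi> :: "real \<Rightarrow> real"
  assumes h: "h \<noteq> 0" "\<And>x. x \<in> {A..B} \<Longrightarrow> poly h x \<ge> 0"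
    and v: "v1 < v2" "\<And>x. v1 \<le> x \<Longrightarrow> x \<le> v2 \<Longrightarrow> poly h x \<noteq> 0"
    and \<phi>: "continuous_on UNIV \<phi>" "\<And>x. x \<le> v1 \<Longrightarrow> \<phi> x = c1" "\<And>x. x \<ge> v2 \<Longrightarrow> \<phi> x = c2"
    and "\<eta> > 0"
  shows "\<exists>\<rho>. \<forall>x\<in>{A..B}. \<bar>\<phi> x - poly \<rho> x\<bar> \<le> \<eta> * poly h x"
proof -
  obtain hL hR where H: "h = hL * hR" "\<And>x. x > v1 \<Longrightarrow> poly hL x \<noteq> 0" "\<And>x. x \<le> v1 \<Longrightarrow> poly hR x \<noteq> 0" "coprime hL hR"
    using poly_split_roots[OF h(1), of v1] by blast
  obtain u w where uw: "u * hL + w * hR = 1"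
    using H(4) bezout_coefficients_fst_snd[of hL hR] by (metis coprime_imp_gcd_eq_1)
  \<comment> \<open>Chinese remainders: \<open>T\<close> is \<open>c1\<close> modulo
    \<open>hL\<close> and \<open>c2\<close> modulo \<open>hR\<close>, so it matches
    \<open>\<phi>\<close> at the real zeros of \<open>h\<close> with multiplicity.\<close>
  define T where "T = [:c1:] + smult (c2 - c1) (u * hL)"
  have Tp: "poly T x = c1 + (c2 - c1) * (poly u x * poly hL x)" for x by (simp add: T_def)
  have uwx: "poly u x * poly hL x + poly w x * poly hR x = 1" for x
    using arg_cong[OF uw, of "\<lambda>p. poly p x"] by simp
  \<comment> \<open>This is \<open>(\<phi> - T) / h\<close>, with the factor that has zeros on the
    given side cancelled.\<close>
  define \<psi> where "\<psi> x = (if x \<le> v1 then - (c2 - c1) * poly u x / poly hR x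
      else if x \<le> v2 then (\<phi> x - poly T x) / poly h x else (c2 - c1) * poly w x / poly hL x)" for x
  have \<psi>h: "\<phi> x - poly T x = poly h x * \<psi> x" for x
  proof -
    consider "x \<le> v1" | "v1 < x" "x \<le> v2" | "v2 < x" by linarith
    then show ?thesis
    proof cases
      case 1
      then show ?thesis using H(3)[of x] \<phi>(2)[of x] by (simp add: \<psi>_def Tp H(1) algebra_simps)
    next
      case 2
      then show ?thesis using v(2)[of x] by (simp add: \<psi>_def)
    next
      case 3
      have "c2 - poly T x = (c2 - c1) * (1 - poly u x * poly hL x)" by (simp add: Tp algebra_simps)
      also have "1 - poly u x * poly hL x = poly w x * poly hR x" using uwx[of x] by simp
      finally show ?thesis using 3 v(1) H(2)[of x] \<phi>(3)[of x] by (simp add: \<psi>_def H(1))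
    qed
  qed
  have "continuous_on {A..B} \<psi>"
    unfolding \<psi>_def
  proof (intro continuous_on_cases_le)
    show "continuous_on {t \<in> {A..B}. t \<le> v1} (\<lambda>x. - (c2 - c1) * poly u x / poly hR x)"
      using H(3) by (intro continuous_intros) auto
    show "continuous_on {t \<in> {t \<in> {A..B}. v1 \<le> t}. t \<le> v2} (\<lambda>x. (\<phi> x - poly T x) / poly h x)"
      using v(2) by (intro continuous_intros continuous_on_subset[OF \<phi>(1)]) auto
    show "continuous_on {t \<in> {t \<in> {A..B}. v1 \<le> t}. v2 \<le> t} (\<lambda>x. (c2 - c1) * poly w x / poly hL x)"
      using H(2) v(1) by (intro continuous_intros) force+
    show "- (c2 - c1) * poly u t / poly hR t = (if t \<le> v2 then (\<phi> t - poly T t) / poly h t else (c2 - c1) * poly w t / poly hL t)"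
      if "t \<in> {A..B}" "t = v1" for t
    proof -
      have "\<psi> t = - (c2 - c1) * poly u t / poly hR t" using that by (simp add: \<psi>_def)
      moreover have "(\<phi> t - poly T t) / poly h t = \<psi> t" using v(2)[of t] v(1) that by (simp add: \<psi>h)
      ultimately show ?thesis using that v(1) by simp
    qed
    show "(\<phi> t - poly T t) / poly h t = (c2 - c1) * poly w t / poly hL t"
      if "t \<in> {t \<in> {A..B}. v1 \<le> t}" "t = v2" for t
    proof -
      have "c2 - poly T t = (c2 - c1) * (1 - poly u t * poly hL t)" by (simp add: Tp algebra_simps)
      also have "1 - poly u t * poly hL t = poly w t * poly hR t" using uwx[of t] by simp
      finally have e: "\<phi> t - poly T t = (c2 - c1) * (poly w t * poly hR t)" using \<phi>(3)[of t] that by simp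
      have "poly h t \<noteq> 0" using v that by auto
      then show ?thesis unfolding e H(1) by simp
    qed
  qed (auto intro!: continuous_intros)
  then obtain p where p: "\<And>x. x \<in> {A..B} \<Longrightarrow> \<bar>\<psi> x - poly p x\<bar> < \<eta>"
    using weierstrass_poly \<open>\<eta> > 0\<close> by blast
  show ?thesis
  proof (intro exI[of _ "T + h * p"] ballI)
    fix x assume x: "x \<in> {A..B}"
    have "\<phi> x - poly (T + h * p) x = poly h x * (\<psi> x - poly p x)"
      using \<psi>h[of x] by (simp add: algebra_simps)
    then have "\<bar>\<phi> x - poly (T + h * p) x\<bar> = poly h x * \<bar>\<psi> x - poly p x\<bar>"
      using h(2)[OF x] by (simp add: abs_mult)
    also have "\<dots> \<le> poly h x * \<eta>" using h(2)[OF x] p[OF x] by (intro mult_left_mono) auto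
    finally show "\<bar>\<phi> x - poly (T + h * p) x\<bar> \<le> \<eta> * poly h x" by (simp add: mult.commute)
  qed
qed

lemma poly_bounded_interval:
  fixes p :: "real poly"
  shows "\<exists>C\<ge>1. \<forall>x\<in>{A..B}. \<bar>poly p x\<bar> \<le> C"
proof -
  have "bounded (poly p ` {A..B})"
    by (intro compact_imp_bounded compact_continuous_image continuous_intros compact_Icc)
  then obtain C where "\<forall>x\<in>{A..B}. \<bar>poly p x\<bar> \<le> C" unfolding bounded_iff by auto
  then show ?thesis by (intro exI[of _ "max 1 C"]) force
qed

lemma bpoly_bounded_interval:
  fixes f :: bpoly
  shows "\<exists>C\<ge>1. \<forall>k. \<forall>x\<in>{A..B}. \<bar>poly (coeff f k) x\<bar> \<le> C"
proof (induction f)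
  case 0 then show ?case by (intro exI[of _ 1]) auto
next
  case (pCons a f)
  obtain C where C: "C \<ge> 1" "\<forall>k. \<forall>x\<in>{A..B}. \<bar>poly (coeff f k) x\<bar> \<le> C" using pCons.IH by blast
  obtain C' where C': "\<forall>x\<in>{A..B}. \<bar>poly a x\<bar> \<le> C'" using poly_bounded_interval by blast
  show ?case
  proof (intro exI[of _ "max C C'"] conjI allI ballI)
    fix k x assume "x \<in> {A..B}"
    then show "\<bar>poly (coeff (pCons a f) k) x\<bar> \<le> max C C'"
      using C(2) C' by (cases k) (auto intro: le_max_iff_disj[THEN iffD2])
  qed (use C in auto)
qed

text \<open>Weights enter the gluing as squares of polynomials, so it is the squares that have to be
  close. \<open>\<phi>^2 - \<rho>^2\<close> factors, and the sum \<open>\<phi> + \<rho>\<close> is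
  at most \<open>2 + H\<close> in absolute value, whence the choice of
  \<open>\<epsilon>\<close>.\<close>

lemma step_approx_square:
  fixes h :: "real poly" and \<phi> :: "real \<Rightarrow> real"
  assumes h: "h \<noteq> 0" "\<And>x. x \<in> {A..B} \<Longrightarrow> poly h x \<ge> 0"
    and v: "v1 < v2" "\<And>x. v1 \<le> x \<Longrightarrow> x \<le> v2 \<Longrightarrow> poly h x \<noteq> 0"
    and \<phi>: "continuous_on UNIV \<phi>" "\<And>x. x \<le> v1 \<Longrightarrow> \<phi> x = c1" "\<And>x. x \<ge> v2 \<Longrightarrow> \<phi> x = c2"
      "\<And>x. \<bar>\<phi> x\<bar> \<le> 1"
    and "\<eta> > 0"
  shows "\<exists>\<rho>. \<forall>x\<in>{A..B}. \<bar>\<phi> x ^ 2 - poly \<rho> x ^ 2\<bar> \<le> \<eta> * poly h x"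
proof -
  obtain H where H: "H \<ge> 1" "\<And>x. x \<in> {A..B} \<Longrightarrow> \<bar>poly h x\<bar> \<le> H" using poly_bounded_interval by blast
  define \<epsilon> where "\<epsilon> = min 1 (\<eta> / (2 + H))"
  have "\<epsilon> \<le> \<eta> / (2 + H)" by (simp add: \<epsilon>_def)
  then have "\<epsilon> * (2 + H) \<le> \<eta>" using H(1) by (simp add: pos_le_divide_eq)
  then have \<epsilon>: "\<epsilon> > 0" "\<epsilon> \<le> 1" "\<epsilon> * (2 + H) \<le> \<eta>"
    using H(1) \<open>\<eta> > 0\<close> by (auto simp: \<epsilon>_def)
  obtain \<rho> where \<rho>: "\<And>x. x \<in> {A..B} \<Longrightarrow> \<bar>\<phi> x - poly \<rho> x\<bar> \<le> \<epsilon> * poly h x"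
    using step_approx[OF h v \<phi>(1,2,3) \<epsilon>(1)] by blast
  show ?thesis
  proof (intro exI[of _ \<rho>] ballI)
    fix x assume x: "x \<in> {A..B}"
    have hx: "0 \<le> poly h x" "poly h x \<le> H" using h(2)[OF x] H(2)[OF x] by auto
    have "\<epsilon> * poly h x \<le> 1 * H" using hx \<epsilon> H(1) by (intro mult_mono) auto
    then have "\<bar>\<phi> x + poly \<rho> x\<bar> \<le> 2 + H" using \<rho>[OF x] \<phi>(4)[of x] by linarith
    then have "\<bar>\<phi> x - poly \<rho> x\<bar> * \<bar>\<phi> x + poly \<rho> x\<bar> \<le> (\<epsilon> * poly h x) * (2 + H)"
      using \<rho>[OF x] hx \<epsilon> by (intro mult_mono) auto
    also have "\<dots> = (\<epsilon> * (2 + H)) * poly h x" by simp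
    also have "\<dots> \<le> \<eta> * poly h x" using \<epsilon>(3) hx by (intro mult_right_mono) auto
    also have "\<bar>\<phi> x - poly \<rho> x\<bar> * \<bar>\<phi> x + poly \<rho> x\<bar> = \<bar>\<phi> x ^ 2 - poly \<rho> x ^ 2\<bar>"
      by (simp add: power2_eq_square abs_mult[symmetric] algebra_simps)
    finally show "\<bar>\<phi> x ^ 2 - poly \<rho> x ^ 2\<bar> \<le> \<eta> * poly h x" .
  qed
qed

text \<open>The summand for k is \<open>a^2 + b^2\<close> with \<open>a * b = y^k\<close> and both
  exponents even and at most 2d, so each monomial \<open>y^k\<close> is dominated by its own
  summand.\<close>

definition even_sum :: "nat \<Rightarrow> bpoly" where
  "even_sum d = (\<Sum>k\<le>2 * d. (varY ^ (k div 2)) ^ 2 + (varY ^ (k - k div 2)) ^ 2)"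

text \<open>Closeness relative to \<open>h\<close>: at a zero of \<open>h\<close> in the set all
  y-coefficients of \<open>f\<close> vanish. A \<open>\<delta>\<close> below 1 means that a reserve
  of weight \<open>h\<close> can absorb \<open>f\<close>.\<close>

definition close_on :: "real poly \<Rightarrow> bpoly \<Rightarrow> real set \<Rightarrow> real \<Rightarrow> bool" where
  "close_on h f I \<delta> \<longleftrightarrow> (\<forall>k. \<forall>x\<in>I. \<bar>poly (coeff f k) x\<bar> \<le> \<delta> * poly h x)"

context quadratic_module
begin

text \<open>\<open>f - g\<close> is nearly the convex combination of \<open>f - g1\<close> and
  \<open>f - g2\<close> with weights \<open>\<alpha>^2\<close> and \<open>\<beta>^2\<close>. The
  larger of the two old bounds survives, and the approximation of the weights uses up half of the
  gap to \<open>\<delta>\<close>, so a strict inequality is handed on.\<close>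

lemma glue:
  assumes h: "h \<noteq> 0" "\<And>x. x \<in> {A..B} \<Longrightarrow> poly h x \<ge> 0"
    and g1: "g1 \<in> M" "degree g1 \<le> m" "close_on h (f - g1) ({A..B} \<inter> {u - \<kappa>1..v + \<kappa>1}) \<delta>1"
    and g2: "g2 \<in> M" "degree g2 \<le> m" "close_on h (f - g2) ({A..B} \<inter> {v - \<kappa>2..w + \<kappa>2}) \<delta>2"
    and \<kappa>: "\<kappa>1 > 0" "\<kappa>2 > 0" and \<delta>: "\<delta>1 < \<delta>" "\<delta>2 < \<delta>" "u \<le> v" "v \<le> w"
  shows "\<exists>\<kappa>>0. \<exists>\<delta>'<\<delta>. \<exists>g\<in>M. degree g \<le> m \<and> close_on h (f - g) ({A..B} \<inter> {u - \<kappa>..w + \<kappa>}) \<delta>'"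
proof -
  \<comment> \<open>The weights change over where both representations are close, strictly between
    \<open>v\<close> and the next zero of \<open>h\<close>.\<close>
  obtain v1 v2 where v: "v < v1" "v1 < v2" "v2 < v + min \<kappa>1 \<kappa>2" "\<And>x. v1 \<le> x \<Longrightarrow> x \<le> v2 \<Longrightarrow> poly h x \<noteq> 0"
  proof -
    have fin: "finite {x. poly h x = 0}" using h(1) by (rule poly_roots_finite)
    define S where "S = insert (v + min \<kappa>1 \<kappa>2) {x. poly h x = 0 \<and> x > v}"
    have S: "finite S" "S \<noteq> {}" using fin by (auto simp: S_def)
    define r where "r = Min S"
    have r: "r > v" "r \<le> v + min \<kappa>1 \<kappa>2" unfolding r_def using S \<kappa> by (auto simp: S_def)
    have "poly h x \<noteq> 0" if "v < x" "x < r" for x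
    proof
      assume "poly h x = 0"
      then have "r \<le> x" unfolding r_def using S that by (intro Min_le) (auto simp: S_def)
      then show False using that by simp
    qed
    then show thesis using r by (intro that[of "v + (r - v) / 3" "v + 2 * (r - v) / 3"]) (auto simp: field_simps)
  qed
  define \<alpha> where "\<alpha> x = max 0 (min 1 ((v2 - x) / (v2 - v1)))" for x
  have \<alpha>01: "0 \<le> \<alpha> x" "\<alpha> x \<le> 1" for x by (auto simp: \<alpha>_def)
  have \<alpha>sq: "0 \<le> \<alpha> x ^ 2" "\<alpha> x ^ 2 \<le> 1" for x using \<alpha>01[of x] by (auto simp: power_le_one)
  have \<alpha>1: "\<alpha> x = 1" if "x \<le> v1" for x using that v(2) by (auto simp: \<alpha>_def field_simps)
  have \<alpha>0: "\<alpha> x = 0" if "x \<ge> v2" for x using that v(2) by (auto simp: \<alpha>_def field_simps)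
  \<comment> \<open>Members of \<open>M\<close> may be multiplied by squares only, so the partition
    of unity has the form \<open>\<alpha>^2 + \<beta>^2 = 1\<close>.\<close>
  define \<beta> where "\<beta> x = sqrt (1 - \<alpha> x ^ 2)" for x
  have \<alpha>c: "continuous_on UNIV \<alpha>" unfolding \<alpha>_def by (intro continuous_intros) (use v in auto)
  have \<beta>c: "continuous_on UNIV \<beta>" unfolding \<beta>_def by (intro continuous_intros \<alpha>c)
  have \<beta>2: "\<beta> x ^ 2 = 1 - \<alpha> x ^ 2" for x using \<alpha>sq[of x] by (simp add: \<beta>_def)
  have \<beta>1: "\<bar>\<beta> x\<bar> \<le> 1" for x using \<alpha>sq[of x] by (simp add: \<beta>_def)
  obtain C1 where C1: "C1 \<ge> 1" "\<And>k x. x \<in> {A..B} \<Longrightarrow> \<bar>poly (coeff g1 k) x\<bar> \<le> C1" using bpoly_bounded_interval by blast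
  obtain C2 where C2: "C2 \<ge> 1" "\<And>k x. x \<in> {A..B} \<Longrightarrow> \<bar>poly (coeff g2 k) x\<bar> \<le> C2" using bpoly_bounded_interval by blast
  define \<delta>m where "\<delta>m = max \<delta>1 \<delta>2"
  have \<delta>m: "\<delta>m < \<delta>" using \<delta> by (simp add: \<delta>m_def)
  define \<eta> where "\<eta> = (\<delta> - \<delta>m) / (2 * (C1 + C2))"
  have \<eta>: "\<eta> > 0" using \<delta>m C1 C2 by (simp add: \<eta>_def)
  have \<eta>C: "\<eta> * (C1 + C2) = (\<delta> - \<delta>m) / 2" 
  proof -
    have "C1 + C2 \<noteq> 0" using C1(1) C2(1) by linarith
    moreover have "d / (2 * c) * c = d / 2" if "c \<noteq> 0" for c d :: real using that by simp
    ultimately show ?thesis unfolding \<eta>_def by blast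
  qed
  obtain \<rho>1 where \<rho>1: "\<And>x. x \<in> {A..B} \<Longrightarrow> \<bar>\<alpha> x ^ 2 - poly \<rho>1 x ^ 2\<bar> \<le> \<eta> * poly h x"
  proof -
    have "\<exists>\<rho>. \<forall>x\<in>{A..B}. \<bar>\<alpha> x ^ 2 - poly \<rho> x ^ 2\<bar> \<le> \<eta> * poly h x"
      by (rule step_approx_square[where ?v1.0 = v1 and ?v2.0 = v2 and ?c1.0 = 1 and ?c2.0 = 0])
        (use h v \<alpha>c \<alpha>1 \<alpha>0 \<alpha>01 \<eta> in auto)
    then show thesis using that by blast
  qed
  obtain \<rho>2 where \<rho>2: "\<And>x. x \<in> {A..B} \<Longrightarrow> \<bar>\<beta> x ^ 2 - poly \<rho>2 x ^ 2\<bar> \<le> \<eta> * poly h x"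
  proof -
    have "\<exists>\<rho>. \<forall>x\<in>{A..B}. \<bar>\<beta> x ^ 2 - poly \<rho> x ^ 2\<bar> \<le> \<eta> * poly h x"
    proof (rule step_approx_square[where ?v1.0 = v1 and ?v2.0 = v2 and ?c1.0 = 0 and ?c2.0 = 1])
      show "\<beta> x = 0" if "x \<le> v1" for x using \<alpha>1[OF that] by (simp add: \<beta>_def)
      show "\<beta> x = 1" if "x \<ge> v2" for x using \<alpha>0[OF that] by (simp add: \<beta>_def)
    qed (use h v \<beta>c \<beta>1 \<eta> in auto)
    then show thesis using that by blast
  qed
  define g where "g = [:\<rho>1:] ^ 2 * g1 + [:\<rho>2:] ^ 2 * g2"
  have "g \<in> M" unfolding g_def by (intro add square_mult g1 g2)
  have "degree g \<le> m" unfolding g_def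
    by (intro degree_add_le) (use g1 g2 in \<open>auto simp: power2_eq_square intro: order.trans[OF degree_smult_le]\<close>)
  define \<kappa> where "\<kappa> = min \<kappa>1 \<kappa>2"
  have close: "close_on h (f - g) ({A..B} \<inter> {u - \<kappa>..w + \<kappa>}) (\<delta>m + (\<delta> - \<delta>m) / 2)"
    unfolding close_on_def
  proof (intro allI ballI)
    fix k x assume x: "x \<in> {A..B} \<inter> {u - \<kappa>..w + \<kappa>}"
    then have xAB: "x \<in> {A..B}" by simp
    have hx: "poly h x \<ge> 0" using h(2)[OF xAB] .
    define F G1 G2 where "F = poly (coeff f k) x" and "G1 = poly (coeff g1 k) x" and "G2 = poly (coeff g2 k) x"
    define a b where "a = \<alpha> x ^ 2" and "b = \<beta> x ^ 2"
    have ab: "a \<ge> 0" "b \<ge> 0" "a + b = 1" using \<alpha>sq[of x] by (auto simp: a_def b_def \<beta>2)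
    have "poly (coeff (f - g) k) x = F - poly \<rho>1 x ^ 2 * G1 - poly \<rho>2 x ^ 2 * G2"
      by (simp add: g_def F_def G1_def G2_def power2_eq_square)
    also have "\<dots> = a * (F - G1) + b * (F - G2) + (a - poly \<rho>1 x ^ 2) * G1 + (b - poly \<rho>2 x ^ 2) * G2"
    proof -
      have "F = (a + b) * F" using ab by simp
      then show ?thesis by (simp add: algebra_simps)
    qed
    finally have e: "poly (coeff (f - g) k) x = \<dots>" .
    have 1: "\<bar>a * (F - G1)\<bar> \<le> a * (\<delta>m * poly h x)"
    proof (cases "x \<le> v2")
      case True
      then have "x \<in> {A..B} \<inter> {u - \<kappa>1..v + \<kappa>1}" using x v by (auto simp: \<kappa>_def)
      then have "\<bar>F - G1\<bar> \<le> \<delta>1 * poly h x" using g1(3) unfolding close_on_def F_def G1_def by (metis coeff_diff poly_diff)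
      also have "\<dots> \<le> \<delta>m * poly h x" using hx by (intro mult_right_mono) (auto simp: \<delta>m_def)
      finally show ?thesis using ab by (simp add: abs_mult mult_left_mono)
    qed (use \<alpha>0[of x] in \<open>simp add: a_def\<close>)
    have 2: "\<bar>b * (F - G2)\<bar> \<le> b * (\<delta>m * poly h x)"
    proof (cases "x \<ge> v1")
      case True
      then have "x \<in> {A..B} \<inter> {v - \<kappa>2..w + \<kappa>2}" using x v \<kappa> by (auto simp: \<kappa>_def)
      then have "\<bar>F - G2\<bar> \<le> \<delta>2 * poly h x" using g2(3) unfolding close_on_def F_def G2_def by (metis coeff_diff poly_diff)
      also have "\<dots> \<le> \<delta>m * poly h x" using hx by (intro mult_right_mono) (auto simp: \<delta>m_def)
      finally show ?thesis using ab by (simp add: abs_mult mult_left_mono)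
    qed (use \<alpha>1[of x] in \<open>simp add: b_def \<beta>2\<close>)
    have 3: "\<bar>(a - poly \<rho>1 x ^ 2) * G1\<bar> \<le> (\<eta> * poly h x) * C1"
      unfolding abs_mult a_def G1_def using \<rho>1[OF xAB] C1(2)[OF xAB] hx \<eta> by (intro mult_mono) auto
    have 4: "\<bar>(b - poly \<rho>2 x ^ 2) * G2\<bar> \<le> (\<eta> * poly h x) * C2"
      unfolding abs_mult b_def G2_def using \<rho>2[OF xAB] C2(2)[OF xAB] hx \<eta> by (intro mult_mono) auto
    have "\<bar>poly (coeff (f - g) k) x\<bar> \<le> a * (\<delta>m * poly h x) + b * (\<delta>m * poly h x) + (\<eta> * poly h x) * C1 + (\<eta> * poly h x) * C2"
      unfolding e using 1 2 3 4 by linarith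
    also have "\<dots> = (a + b) * (\<delta>m * poly h x) + \<eta> * (C1 + C2) * poly h x" by (simp add: algebra_simps)
    also have "\<dots> = (\<delta>m + (\<delta> - \<delta>m) / 2) * poly h x" unfolding ab(3) \<eta>C by (simp add: algebra_simps)
    finally show "\<bar>poly (coeff (f - g) k) x\<bar> \<le> (\<delta>m + (\<delta> - \<delta>m) / 2) * poly h x" .
  qed
  have "\<kappa> > 0" using \<kappa> by (simp add: \<kappa>_def)
  moreover have "\<delta>m + (\<delta> - \<delta>m) / 2 < \<delta>" using \<delta>m by (simp add: field_simps)
  ultimately show ?thesis using close \<open>g \<in> M\<close> \<open>degree g \<le> m\<close> by blast
qed

text \<open>The coefficients of \<open>f\<close> vanish at \<open>c\<close> to at least one order
  more than \<open>h\<close>; the additional factor \<open>x - c\<close> beats any constant near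
  \<open>c\<close>.\<close>

lemma close_locally:
  assumes h: "h \<noteq> 0" "\<And>x. x \<in> {A..B} \<Longrightarrow> poly h x \<ge> 0"
    and dv: "[:[:- c, 1:] ^ Suc (order c h):] dvd f" and "\<delta> > 0"
  shows "\<exists>r>0. close_on h f ({A..B} \<inter> {c - r<..<c + r}) \<delta>"
proof -
  define n where "n = order c h"
  obtain h' where h': "h = [:- c, 1:] ^ n * h'" "\<not> [:- c, 1:] dvd h'"
    using order_decomp[OF h(1), of c] unfolding n_def by blast
  have h'c: "poly h' c \<noteq> 0" using h'(2) by (simp add: poly_eq_0_iff_dvd)
  obtain f' where f': "f = [:[:- c, 1:] ^ Suc n:] * f'" using dv unfolding n_def by (rule dvdE)
  have ev: "eventually (\<lambda>x. \<forall>k\<in>{..degree f'}. \<bar>(x - c) * poly (coeff f' k) x\<bar> < \<delta> * \<bar>poly h' x\<bar>) (nhds c)"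
  proof (intro eventually_ball_finite ballI finite_atMost)
    fix k
    define F where "F x = \<delta> * \<bar>poly h' x\<bar> - \<bar>(x - c) * poly (coeff f' k) x\<bar>" for x
    have "isCont F c" unfolding F_def by (intro continuous_intros)
    then have "(F \<longlongrightarrow> F c) (nhds c)" by (simp add: isCont_def tendsto_at_iff_tendsto_nhds)
    moreover have "F c > 0" using h'c \<open>\<delta> > 0\<close> by (simp add: F_def)
    ultimately have "eventually (\<lambda>x. F x > 0) (nhds c)" by (rule order_tendstoD(1))
    then show "eventually (\<lambda>x. \<bar>(x - c) * poly (coeff f' k) x\<bar> < \<delta> * \<bar>poly h' x\<bar>) (nhds c)"
      by eventually_elim (simp add: F_def)
  qed
  then obtain r where r: "r > 0" "\<And>x k. dist x c < r \<Longrightarrow> k \<le> degree f' \<Longrightarrow> \<bar>(x - c) * poly (coeff f' k) x\<bar> < \<delta> * \<bar>poly h' x\<bar>"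
    unfolding eventually_nhds_metric by auto
  have "close_on h f ({A..B} \<inter> {c - r<..<c + r}) \<delta>"
    unfolding close_on_def
  proof (intro allI ballI)
    fix k x assume x: "x \<in> {A..B} \<inter> {c - r<..<c + r}"
    have hx: "poly h x = \<bar>x - c\<bar> ^ n * \<bar>poly h' x\<bar>"
    proof -
      have "poly h x = \<bar>poly h x\<bar>" using h(2)[of x] x by simp
      then show ?thesis by (simp add: h'(1) abs_mult power_abs poly_power)
    qed
    have fx: "poly (coeff f k) x = (x - c) ^ n * ((x - c) * poly (coeff f' k) x)"
      by (simp add: f' poly_power algebra_simps)
    show "\<bar>poly (coeff f k) x\<bar> \<le> \<delta> * poly h x"
    proof (cases "k \<le> degree f'")
      case True
      have "\<bar>(x - c) * poly (coeff f' k) x\<bar> \<le> \<delta> * \<bar>poly h' x\<bar>"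
      proof -
        have "dist x c < r" using x by (auto simp: dist_real_def abs_if)
        from r(2)[OF this True] show ?thesis by simp
      qed
      then have "\<bar>x - c\<bar> ^ n * \<bar>(x - c) * poly (coeff f' k) x\<bar> \<le> \<bar>x - c\<bar> ^ n * (\<delta> * \<bar>poly h' x\<bar>)"
        by (intro mult_left_mono) auto
      then show ?thesis unfolding fx hx by (simp add: abs_mult power_abs mult_ac)
    next
      case False
      then show ?thesis unfolding fx hx using \<open>\<delta> > 0\<close> by (simp add: coeff_eq_0)
    qed
  qed
  then show ?thesis using r(1) by blast
qed

text \<open>Bisection glues the local representations to one \<open>g\<close> for which the
  coefficients of \<open>f - g\<close> are bounded by \<open>h\<close>. Each term of
  \<open>f - g\<close> is then absorbed by its summand of \<open>even_sum\<close>, as squares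
  weighted by polynomials non-negative on the interval.\<close>

theorem local_global:
  assumes AB: "A \<le> B"
    and ivl: "\<And>p q. (\<And>x. x \<in> {A..B} \<Longrightarrow> poly p x \<ge> 0) \<Longrightarrow> [:p:] * q ^ 2 \<in> M"
    and loc: "\<And>c n. c \<in> {A..B} \<Longrightarrow> \<exists>g\<in>M. degree g \<le> 2 * d \<and> [:[:- c, 1:] ^ n:] dvd f - g"
    and deg: "degree f \<le> 2 * d"
    and h: "h \<noteq> 0" "\<And>x. x \<in> {A..B} \<Longrightarrow> poly h x \<ge> 0"
  shows "f + [:h:] * even_sum d \<in> M"
proof -
  \<comment> \<open>The margin \<open>\<kappa>\<close> and the strict bound below 1 are what
    \<open>glue\<close> consumes and reproduces.\<close>
  define P where "P u v \<longleftrightarrow> (\<exists>\<kappa>>0. \<exists>\<delta>'<1. \<exists>g\<in>M. degree g \<le> 2 * d \<and> close_on h (f - g) ({A..B} \<inter> {u - \<kappa>..v + \<kappa>}) \<delta>')" for u v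
  have "P A B"
  proof (rule Bolzano[OF AB])
    fix a b c assume ab: "P a b" "P b c" "a \<le> b" "b \<le> c"
    then obtain \<kappa>1 \<delta>1 g1 \<kappa>2 \<delta>2 g2 where
      1: "\<kappa>1 > 0" "\<delta>1 < 1" "g1 \<in> M" "degree g1 \<le> 2 * d" "close_on h (f - g1) ({A..B} \<inter> {a - \<kappa>1..b + \<kappa>1}) \<delta>1"
      and 2: "\<kappa>2 > 0" "\<delta>2 < 1" "g2 \<in> M" "degree g2 \<le> 2 * d" "close_on h (f - g2) ({A..B} \<inter> {b - \<kappa>2..c + \<kappa>2}) \<delta>2"
      unfolding P_def by blast
    show "P a c" unfolding P_def by (rule glue[OF h 1(3,4,5) 2(3,4,5) 1(1) 2(1) 1(2) 2(2) ab(3,4)])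
  next
    fix c assume c: "A \<le> c" "c \<le> B"
    then obtain g where g: "g \<in> M" "degree g \<le> 2 * d" "[:[:- c, 1:] ^ Suc (order c h):] dvd f - g"
      using loc[of c "Suc (order c h)"] by auto
    obtain r where r: "r > 0" "close_on h (f - g) ({A..B} \<inter> {c - r<..<c + r}) (1 / 2)"
      using close_locally[where A = A and B = B and h = h and c = c and f = "f - g" and \<delta> = "1 / 2", OF h g(3)] by auto
    show "\<exists>d>0. \<forall>a b. a \<le> c \<and> c \<le> b \<and> b - a < d \<longrightarrow> P a b"
    proof (intro exI[of _ "r / 2"] conjI allI impI)
      fix a b assume ab: "a \<le> c \<and> c \<le> b \<and> b - a < r / 2"
      have "close_on h (f - g) ({A..B} \<inter> {a - r / 4..b + r / 4}) (1 / 2)"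
        using r ab unfolding close_on_def by auto
      then show "P a b" unfolding P_def using r(1) g by (intro exI[of _ "r / 4"] conjI exI[of _ "1 / 2"] bexI[of _ g]) auto
    qed (use r in simp)
  qed
  then obtain \<kappa> \<delta>' g where g: "\<kappa> > 0" "\<delta>' < 1" "g \<in> M" "degree g \<le> 2 * d" "close_on h (f - g) ({A..B} \<inter> {A - \<kappa>..B + \<kappa>}) \<delta>'"
    unfolding P_def by blast
  define e where "e k = coeff (f - g) k" for k
  have e: "\<bar>poly (e k) x\<bar> \<le> poly h x" if "x \<in> {A..B}" for k x
  proof -
    have "\<bar>poly (e k) x\<bar> \<le> \<delta>' * poly h x" using g(5) that g(1) unfolding close_on_def e_def by auto
    also have "\<dots> \<le> 1 * poly h x" using g(2) h(2)[OF that] by (intro mult_right_mono) auto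
    finally show ?thesis by simp
  qed
  have "f - g = (\<Sum>k\<le>2 * d. [:e k:] * varY ^ k)"
  proof -
    have "degree (f - g) \<le> 2 * d" by (intro degree_diff_le deg g(4))
    then have "f - g = (\<Sum>k\<le>2 * d. monom (coeff (f - g) k) k)" by (rule poly_as_sum_of_monoms'[symmetric])
    also have "\<dots> = (\<Sum>k\<le>2 * d. [:e k:] * varY ^ k)"
      by (intro sum.cong refl) (simp add: e_def varY_def monom_altdef)
    finally show ?thesis .
  qed
  then have "f + [:h:] * even_sum d = g + (\<Sum>k\<le>2 * d. [:e k:] * varY ^ k + [:h:] * ((varY ^ (k div 2)) ^ 2 + (varY ^ (k - k div 2)) ^ 2))"
    unfolding even_sum_def sum.distrib sum_distrib_left distrib_left by (simp add: algebra_simps)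
  also have "\<dots> \<in> M"
  proof (rule add[OF g(3) sum])
    fix k
    define a b where "a = varY ^ (k div 2)" and "b = varY ^ (k - k div 2)"
    have ab: "varY ^ k = a * b" by (simp add: a_def b_def flip: power_add)
    obtain c :: real where c: "c + c = 1" "c > 0" "c \<le> 1" by (rule that[of "1 / 2"]) simp_all
    \<comment> \<open>\<open>p * (a + b)^2 + q * (a - b)^2\<close> equals
      \<open>(p + q) * (a^2 + b^2) + 2 * (p - q) * a * b\<close>, so \<open>p\<close> and
      \<open>q\<close> have to be \<open>h / 2\<close> plus and minus \<open>e k / 4\<close>; here
      \<open>c\<close> is 1/2.\<close>
    define p where "p = smult c (h + smult c (e k))"
    define q where "q = smult c (h - smult c (e k))"
    have half: "c * (x + c * y) + c * (x - c * y) = x" "2 * (c * (x + c * y) - c * (x - c * y)) = y" for x y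
    proof -
      have "c * (x + c * y) + c * (x - c * y) = (c + c) * x" by (simp add: algebra_simps)
      then show "c * (x + c * y) + c * (x - c * y) = x" by (simp only: c mult_1_left)
      have "2 * (c * (x + c * y) - c * (x - c * y)) = (c + c) * ((c + c) * y)" by (simp add: algebra_simps)
      then show "2 * (c * (x + c * y) - c * (x - c * y)) = y" by (simp only: c mult_1_left)
    qed
    have pq: "p + q = h" "smult 2 (p - q) = e k"
    proof -
      show "p + q = h"
      proof (rule poly_eqI)
        fix n
        have "coeff (p + q) n = c * (coeff h n + c * coeff (e k) n) + c * (coeff h n - c * coeff (e k) n)"
          by (simp only: p_def q_def coeff_add coeff_diff coeff_smult)
        also have "\<dots> = coeff h n" by (rule half(1))
        finally show "coeff (p + q) n = coeff h n" .
      qed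
      show "smult 2 (p - q) = e k"
      proof (rule poly_eqI)
        fix n
        have "coeff (smult 2 (p - q)) n = 2 * (c * (coeff h n + c * coeff (e k) n) - c * (coeff h n - c * coeff (e k) n))"
          by (simp only: p_def q_def coeff_add coeff_diff coeff_smult)
        also have "\<dots> = coeff (e k) n" by (rule half(2))
        finally show "coeff (smult 2 (p - q)) n = coeff (e k) n" .
      qed
    qed
    have "[:p:] * (a + b) ^ 2 + [:q:] * (a - b) ^ 2 = [:p + q:] * (a ^ 2 + b ^ 2) + [:smult 2 (p - q):] * (a * b)"
    proof -
      have "smult 2 r = r + r" for r :: "real poly"
        by (metis one_add_one smult_1_left smult_add_left)
      then have "[:smult 2 (p - q):] = [:p:] + [:p:] - [:q:] - [:q:]" by (simp only:) simp
      moreover have "[:p + q:] = [:p:] + [:q:]" by simp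
      ultimately show ?thesis by (simp only: power2_eq_square) (simp only: algebra_simps)
    qed
    also have "\<dots> = [:e k:] * varY ^ k + [:h:] * (a ^ 2 + b ^ 2)" unfolding pq ab by simp
    finally have eq: "[:e k:] * varY ^ k + [:h:] * (a ^ 2 + b ^ 2) = [:p:] * (a + b) ^ 2 + [:q:] * (a - b) ^ 2" by simp
    have pq0: "poly p x \<ge> 0" "poly q x \<ge> 0" if "x \<in> {A..B}" for x
    proof -
      have "\<bar>c * poly (e k) x\<bar> \<le> 1 * poly h x"
        unfolding abs_mult using c e[OF that, of k] by (intro mult_mono) auto
      then have "poly h x + c * poly (e k) x \<ge> 0" "poly h x - c * poly (e k) x \<ge> 0" by auto
      then show "poly p x \<ge> 0" "poly q x \<ge> 0" using c(2) by (simp_all add: p_def q_def)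
    qed
    then have "[:p:] * (a + b) ^ 2 \<in> M" "[:q:] * (a - b) ^ 2 \<in> M" by (auto intro: ivl simp del: mult_pCons_left)
    then show "[:e k:] * varY ^ k + [:h:] * ((varY ^ (k div 2)) ^ 2 + (varY ^ (k - k div 2)) ^ 2) \<in> M"
      unfolding a_def[symmetric] b_def[symmetric] eq by (rule add)
  qed
  finally show ?thesis .
qed

end

subsection \<open>Lower bounds for square-free polynomials\<close>

text \<open>The primitive part has no prime factor in R[x], so every prime divisor of it involves
  y.\<close>

lemma bpoly_prime_factor:
  fixes r :: bpoly
  assumes "degree r > 0"
  shows "\<exists>p. prime p \<and> degree p > 0 \<and> p dvd r"
proof -
  define r' where "r' = primitive_part r"
  have r: "r = smult (Polynomial.content r) r'" by (simp add: r'_def)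
  have "degree r' > 0" using assms by (simp add: r'_def)
  then have "r' \<noteq> 0" "\<not> is_unit r'" by (auto simp: is_unit_poly_iff)
  then obtain p where p: "prime p" "p dvd r'" using prime_divisor_exists by blast
  have "degree p > 0"
  proof (rule ccontr)
    assume "\<not> degree p > 0"
    then obtain c where c: "p = [:c:]" by (auto elim: degree_eq_zeroE)
    then have "c dvd Polynomial.content r'" using p(2) by (simp add: const_poly_dvd_iff_dvd_content)
    moreover have "Polynomial.content r' = 1"
    proof -
      have "r \<noteq> 0" using assms by auto
      then show ?thesis by (simp add: r'_def)
    qed
    ultimately have "is_unit c" by simp
    then have "is_unit p" unfolding c by (simp add: is_unit_const_poly_iff)
    then show False using p(1) by (simp add: not_prime_unit)
  qed
  moreover have "p dvd r" using p(2) r by (metis dvd_smult)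
  ultimately show ?thesis using p(1) by blast
qed

text \<open>Let \<open>r\<close> have least y-degree in the ideal of \<open>f\<close> and
  \<open>pderiv f\<close>. By pseudo-division every ideal element becomes a multiple of
  \<open>r\<close> after multiplication by a nonzero polynomial in x. A prime factor of
  \<open>r\<close> involving y would thus divide \<open>f\<close> and its derivative, hence divide
  \<open>f\<close> twice; so \<open>r\<close> lies in R[x].\<close>

lemma squarefree_bezout:
  fixes f :: bpoly
  assumes "f \<noteq> 0" and sf: "\<And>p. prime p \<Longrightarrow> degree p > 0 \<Longrightarrow> \<not> p ^ 2 dvd f"
  shows "\<exists>u v D. u * f + v * pderiv f = [:D:] \<and> D \<noteq> 0"
proof -
  define I where "I = {u * f + v * pderiv f | u v. True}"
  have fI: "f \<in> I" "pderiv f \<in> I"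
    unfolding I_def by (auto intro: exI[of _ 0] exI[of _ 1])
  have Ilin: "a * g + b * r \<in> I" if gr: "g \<in> I" "r \<in> I" for a b g r
  proof -
    obtain u v u' v' where "g = u * f + v * pderiv f" "r = u' * f + v' * pderiv f"
      using gr unfolding I_def by blast
    then have "a * g + b * r = (a * u + b * u') * f + (a * v + b * v') * pderiv f"
      by (simp add: algebra_simps)
    then show ?thesis unfolding I_def by blast
  qed
  obtain r where r: "r \<in> I" "r \<noteq> 0" "\<And>g. g \<in> I \<and> g \<noteq> 0 \<Longrightarrow> degree r \<le> degree g"
    using ex_has_least_nat[of "\<lambda>g. g \<in> I \<and> g \<noteq> 0" f degree] fI assms(1) by blast
  have "degree r = 0"
  proof (rule ccontr)
    assume "degree r \<noteq> 0"
    then obtain p where p: "prime p" "degree p > 0" "p dvd r" using bpoly_prime_factor by blast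
    have pg: "p dvd g" if g: "g \<in> I" for g
    proof -
      obtain q s where qs: "pseudo_divmod g r = (q, s)" by (cases "pseudo_divmod g r")
      define c where "c = lead_coeff r ^ (Suc (degree g) - degree r)"
      have e: "smult c g = r * q + s" "s = 0 \<or> degree s < degree r"
        using pseudo_divmod[OF r(2) qs] by (simp_all add: c_def)
      have "s = [:c:] * g + (- q) * r" using e(1) by (simp add: algebra_simps)
      then have "s \<in> I" using Ilin g r(1) by metis
      then have "s = 0" using e(2) r(3)[of s] by fastforce
      then have "p dvd [:c:] * g" using e(1) p(3) by simp
      moreover have "\<not> p dvd [:c:]"
      proof
        assume "p dvd [:c:]"
        moreover have "c \<noteq> 0" using r(2) by (simp add: c_def)
        ultimately show False using p(2) dvd_imp_degree_le[of p "[:c:]"] by simp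
      qed
      ultimately show ?thesis using p(1) prime_dvd_multD by blast
    qed
    then obtain g where g: "f = p * g" using fI(1) by blast
    have "p dvd pderiv p * g"
    proof -
      have "pderiv f = p * pderiv g + pderiv p * g" unfolding g pderiv_mult by (simp add: mult.commute)
      then show ?thesis using pg[OF fI(2)] by (metis dvd_add_right_iff dvd_triv_left)
    qed
    moreover have "\<not> p dvd pderiv p" using p(2) by simp
    ultimately have "p dvd g" using p(1) prime_dvd_multD by blast
    then have "p ^ 2 dvd f" unfolding g by (simp add: power2_eq_square)
    then show False using sf p by blast
  qed
  then obtain D where "r = [:D:]" by (rule degree_eq_zeroE)
  moreover from this have "D \<noteq> 0" using r(2) by simp
  moreover obtain u v where "r = u * f + v * pderiv f" using r(1) unfolding I_def by blast
  ultimately show ?thesis by metis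
qed

section \<open>Explicit bounds for polynomials in one variable\<close>

lemma abs_poly_le:
  fixes p :: "real poly"
  assumes "degree p \<le> e" "\<And>i. \<bar>coeff p i\<bar> \<le> C" "\<bar>y\<bar> \<le> Y" "1 \<le> Y"
  shows "\<bar>poly p y\<bar> \<le> real (e + 1) * C * Y ^ e"
proof -
  have C: "C \<ge> 0" using assms(2)[of 0] by linarith
  have "\<bar>poly p y\<bar> \<le> (\<Sum>i\<le>e. \<bar>coeff p i * y ^ i\<bar>)"
    unfolding poly_altdef_le[OF assms(1)] by (rule sum_abs)
  also have "\<dots> \<le> (\<Sum>i\<le>e. C * Y ^ e)"
  proof (rule sum_mono)
    fix i assume "i \<in> {..e}"
    then have "\<bar>y\<bar> ^ i \<le> Y ^ i" "Y ^ i \<le> Y ^ e"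
      using assms by (auto intro: power_mono power_increasing)
    then have "\<bar>y\<bar> ^ i \<le> Y ^ e" by linarith
    then show "\<bar>coeff p i * y ^ i\<bar> \<le> C * Y ^ e"
      unfolding abs_mult power_abs using assms(2)[of i] C by (intro mult_mono) auto
  qed
  also have "\<dots> = real (e + 1) * C * Y ^ e" by simp
  finally show ?thesis .
qed

text \<open>The leading coefficients of \<open>F(y)\<close> and of \<open>F(- y)\<close> are both
  positive.\<close>

lemma nonneg_poly_even_degree:
  fixes F :: "real poly"
  assumes "\<And>y. poly F y \<ge> 0" "F \<noteq> 0"
  shows "even (degree F)" "lead_coeff F > 0"
proof -
  have pos: "lead_coeff G > 0" if "\<And>y. poly G y \<ge> 0" "G \<noteq> 0" for G :: "real poly"
  proof (rule ccontr)
    assume "\<not> lead_coeff G > 0"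
    then have "lead_coeff (- G) > 0" using that(2) by (simp add: not_less order_less_le)
    from poly_pinfty_gt_lc[OF this] obtain n where "\<forall>x\<ge>n. lead_coeff (- G) \<le> poly (- G) x" by blast
    then show False using that(1)[of n] \<open>lead_coeff (- G) > 0\<close> by (metis order.refl not_le order.strict_trans2 poly_minus neg_0_less_iff_less)
  qed
  show "lead_coeff F > 0" by (rule pos[OF assms])
  have "pcompose F [:0, -1:] \<noteq> 0" using assms(2) by (simp add: pcompose_eq_0_iff)
  then have "lead_coeff (pcompose F [:0, -1:]) > 0"
    by (intro pos) (use assms(1) in \<open>auto simp: poly_pcompose\<close>)
  then have "lead_coeff F * (- 1) ^ degree F > 0"
    by (subst (asm) lead_coeff_comp) auto
  then show "even (degree F)" using \<open>lead_coeff F > 0\<close>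
    by (cases "even (degree F)") auto
qed

definition even_sum_fun :: "nat \<Rightarrow> real \<Rightarrow> real" where
  "even_sum_fun d y = (\<Sum>k\<le>2 * d. (y ^ (k div 2)) ^ 2 + (y ^ (k - k div 2)) ^ 2)"

lemma even_sum_fun_le:
  assumes "\<bar>y\<bar> \<le> Y" "1 \<le> Y"
  shows "even_sum_fun d y \<le> real (2 * (2 * d + 1)) * Y ^ (2 * d)"
proof -
  have "(y ^ j) ^ 2 \<le> Y ^ (2 * d)" if "j \<le> d" for j
  proof -
    have "(y ^ j) ^ 2 = \<bar>y\<bar> ^ (2 * j)" by (simp add: power_mult[symmetric] mult.commute power_even_abs)
    also have "\<dots> \<le> Y ^ (2 * j)" using assms by (intro power_mono) auto
    also have "\<dots> \<le> Y ^ (2 * d)" using assms that by (intro power_increasing) auto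
    finally show ?thesis .
  qed
  then have "even_sum_fun d y \<le> (\<Sum>k\<le>2 * d. Y ^ (2 * d) + Y ^ (2 * d))"
    unfolding even_sum_fun_def by (intro sum_mono add_mono) auto
  also have "\<dots> = real (2 * (2 * d + 1)) * Y ^ (2 * d)" by (simp add: algebra_simps)
  finally show ?thesis .
qed

lemma even_sum_fun_nonneg: "even_sum_fun d y \<ge> 0"
  unfolding even_sum_fun_def by (intro sum_nonneg) auto

text \<open>A critical point \<open>y\<close> of \<open>F\<close> satisfies \<open>U(y) F(y) = D\<close>, and the critical points are bounded
  in terms of the leading coefficient.\<close>

lemma poly_lower_bound:
  fixes F U V :: "real poly"
  assumes deg: "degree F = 2 * d" "degree U \<le> e"
    and C: "C \<ge> 1" "\<And>i. \<bar>coeff F i\<bar> \<le> C" "\<And>i. \<bar>coeff U i\<bar> \<le> C" "\<bar>D\<bar> \<le> C"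
    and a: "lead_coeff F = a" "a > 0" and UV: "U * F + V * pderiv F = [:D:]"
    and nn: "\<And>y. poly F y \<ge> 0"
  shows "(2 * real (e + 1) * C ^ 2 * (2 * real (2 * d + 1) * C) ^ (e + 2 * d) * real (2 * (2 * d + 1)) * C ^ (e + 2 * d + 2)) * poly F y
     \<ge> (D * a ^ (e + 2 * d + 1)) ^ 2 * even_sum_fun d y"
proof -
  define n where "n = 2 * d"
  \<comment> \<open>\<open>Y\<close> is a radius beyond which the leading term is at least twice the
    rest in absolute value. It grows like \<open>1 / a\<close>, while \<open>G = a * Y\<close> is
    free of \<open>a\<close>.\<close>
  define G where "G = 2 * real (n + 1) * C"
  define Y where "Y = G / a"
  have aC: "a \<le> C" using C(2)[of "2 * d"] a deg by simp
  have G: "G \<ge> C" "G \<ge> 1"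
  proof -
    have "1 * C \<le> 2 * real (n + 1) * C" using C(1) by (intro mult_right_mono) auto
    then show "G \<ge> C" by (simp add: G_def)
    then show "G \<ge> 1" using C(1) by simp
  qed
  have aY: "a * Y = G" using a by (simp add: Y_def)
  have Y1: "Y \<ge> 1" using G(1) aC a by (simp add: Y_def pos_le_divide_eq)
  define E where "E = real (2 * (2 * d + 1))"
  have E: "E \<ge> 1" by (simp add: E_def)
  have large: "a * \<bar>y\<bar> ^ n \<le> 2 * poly F y" if y: "\<bar>y\<bar> \<ge> Y" for y
  proof (cases "n = 0")
    case True
    then have "degree F = 0" using deg by (simp add: n_def)
    then obtain c where "F = [:c:]" by (rule degree_eq_zeroE)
    then show ?thesis using a True by simp
  next
    case False
    define z where "z = \<bar>y\<bar>"
    have z: "z \<ge> 1" "z \<ge> Y" using y Y1 by (auto simp: z_def)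
    obtain m where m: "n = Suc m" using False by (cases n) auto
    have "poly F y = (\<Sum>i\<le>Suc m. coeff F i * y ^ i)" using poly_altdef[of F y] deg m by (simp add: n_def)
    also have "\<dots> = (\<Sum>i\<le>m. coeff F i * y ^ i) + a * z ^ n"
    proof -
      have "y ^ n = z ^ n" by (simp add: n_def z_def power_even_abs)
      then show ?thesis using a deg m by (simp add: n_def)
    qed
    finally have Fy: "poly F y = (\<Sum>i\<le>m. coeff F i * y ^ i) + a * z ^ n" .
    have "\<bar>\<Sum>i\<le>m. coeff F i * y ^ i\<bar> \<le> (\<Sum>i\<le>m. \<bar>coeff F i * y ^ i\<bar>)" by (rule sum_abs)
    also have "\<dots> \<le> (\<Sum>i\<le>m. C * z ^ m)"
    proof (rule sum_mono)
      fix i assume "i \<in> {..m}"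
      then have "z ^ i \<le> z ^ m" using z by (intro power_increasing) auto
      then show "\<bar>coeff F i * y ^ i\<bar> \<le> C * z ^ m"
        unfolding abs_mult power_abs z_def[symmetric] using C(1) C(2)[of i] z by (intro mult_mono) auto
    qed
    also have "\<dots> = real n * C * z ^ m" by (simp add: m)
    finally have s: "\<bar>\<Sum>i\<le>m. coeff F i * y ^ i\<bar> \<le> real n * C * z ^ m" .
    have "2 * (real n * C * z ^ m) \<le> G * z ^ m"
    proof -
      have "2 * (real n * C) \<le> G" using C(1) by (simp add: G_def algebra_simps)
      then have "2 * (real n * C) * z ^ m \<le> G * z ^ m" using z by (intro mult_right_mono) auto
      then show ?thesis by (simp add: mult.assoc)
    qed
    also have "\<dots> = a * (Y * z ^ m)" by (simp add: aY[symmetric])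
    also have "\<dots> \<le> a * (z * z ^ m)" using z a by (intro mult_left_mono mult_right_mono) auto
    also have "\<dots> = a * z ^ n" by (simp add: m)
    finally have "2 * (real n * C * z ^ m) \<le> a * z ^ n" .
    moreover have "poly F y \<ge> a * z ^ n - real n * C * z ^ m" using Fy s by (simp add: abs_le_iff)
    ultimately show ?thesis unfolding z_def[symmetric] by simp
  qed
  define K where "K = 2 * real (e + 1) * C ^ 2"
  have K: "K \<ge> C" "K \<ge> 1" "C \<le> real (e + 1) * C ^ 2"
  proof -
    have "1 * (C * 1) \<le> real (e + 1) * (C * C)" using C(1) by (intro mult_mono) auto
    then show c: "C \<le> real (e + 1) * C ^ 2" by (simp add: power2_eq_square)
    moreover have "K = real (e + 1) * C ^ 2 + real (e + 1) * C ^ 2" by (simp add: K_def)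
    ultimately show "K \<ge> C" using C(1) by linarith
    then show "K \<ge> 1" using C(1) by simp
  qed
  have "\<exists>y0\<in>{-Y..Y}. \<forall>y\<in>{-Y..Y}. poly F y0 \<le> poly F y"
    by (rule continuous_attains_inf) (use Y1 in \<open>auto intro!: continuous_intros\<close>)
  then obtain y0 where y0: "y0 \<in> {-Y..Y}" "\<And>y. y \<in> {-Y..Y} \<Longrightarrow> poly F y0 \<le> poly F y" by blast
  \<comment> \<open>The minimum over \<open>[-Y, Y]\<close> lies at the boundary, where the leading
    term decides, or at a critical point, where \<open>U * F = D\<close>.\<close>
  have min: "a * \<bar>D\<bar> \<le> K * Y ^ e * poly F y0"
  proof (cases "\<bar>y0\<bar> = Y")
    case True
    have "a * 1 \<le> a * \<bar>y0\<bar> ^ n" using a Y1 True by (intro mult_left_mono one_le_power) auto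
    also have "\<dots> \<le> 2 * poly F y0" using True by (intro large) simp
    finally have "a \<le> 2 * poly F y0" by simp
    then have "C * a \<le> C * (2 * poly F y0)" using C(1) by (intro mult_left_mono) auto
    also have "\<dots> \<le> (real (e + 1) * C ^ 2 * Y ^ e) * (2 * poly F y0)"
    proof -
      have "C * 1 \<le> real (e + 1) * C ^ 2 * Y ^ e" using K(3) Y1 C(1) by (intro mult_mono one_le_power) auto
      then show ?thesis using nn[of y0] by (intro mult_right_mono) auto
    qed
    also have "\<dots> = K * Y ^ e * poly F y0" by (simp add: K_def)
    finally have "C * a \<le> K * Y ^ e * poly F y0" .
    moreover have "a * \<bar>D\<bar> \<le> C * a" using C(4) a by (simp add: mult.commute mult_left_mono)
    ultimately show ?thesis by simp
  next
    case False
    then have in0: "-Y < y0" "y0 < Y" using y0(1) by auto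
    have "poly (pderiv F) y0 = 0"
    proof (rule DERIV_local_min[OF poly_DERIV])
      show "0 < min (y0 + Y) (Y - y0)" using in0 by simp
      show "\<forall>y. \<bar>y0 - y\<bar> < min (y0 + Y) (Y - y0) \<longrightarrow> poly F y0 \<le> poly F y"
        using y0(2) by (auto simp: abs_if split: if_splits)
    qed
    then have "poly U y0 * poly F y0 = D" using arg_cong[OF UV, of "\<lambda>p. poly p y0"] by simp
    then have "\<bar>D\<bar> = \<bar>poly U y0\<bar> * poly F y0" using nn[of y0] by (metis abs_mult abs_of_nonneg)
    also have "\<dots> \<le> (real (e + 1) * C * Y ^ e) * poly F y0"
      using nn[of y0] y0(1) by (intro mult_right_mono abs_poly_le deg C Y1) auto
    finally have "a * \<bar>D\<bar> \<le> C * ((real (e + 1) * C * Y ^ e) * poly F y0)"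
      using aC a C(1) nn[of y0] by (intro mult_mono) auto
    also have "\<dots> \<le> 2 * (C * ((real (e + 1) * C * Y ^ e) * poly F y0))"
      using C(1) Y1 nn[of y0] by simp
    also have "\<dots> = K * Y ^ e * poly F y0" by (simp add: K_def power2_eq_square)
    finally show ?thesis .
  qed
  \<comment> \<open>Inside the radius \<open>F\<close> is compared with its minimum, outside with
    its leading term; the powers of \<open>a\<close> clear the denominators of
    \<open>Y\<close>.\<close>
  have main: "a ^ (e + n + 1) * \<bar>D\<bar> * even_sum_fun d y \<le> K * G ^ (e + n) * E * poly F y"
  proof (cases "\<bar>y\<bar> \<le> Y")
    case True
    have "a * \<bar>D\<bar> * even_sum_fun d y \<le> (K * Y ^ e * poly F y0) * (E * Y ^ n)"
    proof (rule mult_mono[OF min])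
      show "even_sum_fun d y \<le> E * Y ^ n" using even_sum_fun_le[OF True Y1, of d] by (simp add: E_def n_def)
      show "0 \<le> K * Y ^ e * poly F y0" using nn[of y0] K(2) Y1 by simp
    qed (rule even_sum_fun_nonneg)
    also have "\<dots> \<le> (K * Y ^ e * poly F y) * (E * Y ^ n)"
    proof -
      have "poly F y0 \<le> poly F y" using True by (intro y0(2)) auto
      then show ?thesis using K(2) Y1 E by (intro mult_right_mono mult_left_mono) auto
    qed
    finally have "a ^ (e + n) * (a * \<bar>D\<bar> * even_sum_fun d y) \<le> a ^ (e + n) * ((K * Y ^ e * poly F y) * (E * Y ^ n))"
      using a by (intro mult_left_mono) auto
    also have "\<dots> = K * (a * Y) ^ (e + n) * E * poly F y"
      by (simp add: power_mult_distrib power_add)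
    finally show ?thesis unfolding aY by (simp add: mult_ac)
  next
    case False
    then have y: "\<bar>y\<bar> \<ge> Y" "\<bar>y\<bar> \<ge> 1" using Y1 by auto
    have "a * even_sum_fun d y \<le> a * (E * \<bar>y\<bar> ^ n)"
      using even_sum_fun_le[of y "\<bar>y\<bar>" d] y a by (intro mult_left_mono) (auto simp: E_def n_def)
    also have "\<dots> = E * (a * \<bar>y\<bar> ^ n)" by simp
    also have "\<dots> \<le> E * (2 * poly F y)" using large[OF y(1)] E by (intro mult_left_mono) auto
    finally have 1: "a * even_sum_fun d y \<le> E * (2 * poly F y)" .
    have 2: "a ^ (e + n) * \<bar>D\<bar> \<le> G ^ (e + n) * C"
      using a aC G C by (intro mult_mono power_mono) auto
    have "(a ^ (e + n) * \<bar>D\<bar>) * (a * even_sum_fun d y) \<le> (G ^ (e + n) * C) * (E * (2 * poly F y))"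
      by (rule mult_mono[OF 2 1]) (use a G C(1) even_sum_fun_nonneg[of d y] in auto)
    also have "\<dots> = (2 * C) * (G ^ (e + n) * E * poly F y)" by simp
    also have "\<dots> \<le> K * (G ^ (e + n) * E * poly F y)"
    proof -
      have "2 * C \<le> 2 * (real (e + 1) * C ^ 2)" using K(3) by (rule mult_left_mono) simp
      then have "2 * C \<le> K" unfolding K_def by (simp only: mult.assoc)
      then show ?thesis using G E nn[of y] by (intro mult_right_mono) auto
    qed
    finally show ?thesis by (simp add: mult_ac)
  qed
  \<comment> \<open>A further factor \<open>\<bar>D\<bar> * a^N\<close>, bounded by a constant,
    turns the left side into a square, so that \<open>D\<close> and \<open>a\<close> may be
    polynomials in x without regard to sign.\<close>
  define N where "N = e + n + 1"
  have "\<bar>D\<bar> * a ^ N \<le> C * C ^ N" using a aC C by (intro mult_mono power_mono) auto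
  then have DN: "\<bar>D\<bar> * a ^ N \<le> C ^ (N + 1)" by simp
  have "(D * a ^ N) ^ 2 * even_sum_fun d y = (\<bar>D\<bar> * a ^ N) * (a ^ N * \<bar>D\<bar> * even_sum_fun d y)"
  proof -
    have "(D * a ^ N) ^ 2 = (D * D) * (a ^ N * a ^ N)" by (simp only: power2_eq_square ac_simps)
    also have "D * D = \<bar>D\<bar> * \<bar>D\<bar>" by simp
    finally show ?thesis by (simp only: ac_simps)
  qed
  also have "\<dots> \<le> C ^ (N + 1) * (K * G ^ (e + n) * E * poly F y)"
    by (rule mult_mono[OF DN main[folded N_def]]) (use a C(1) even_sum_fun_nonneg[of d y] in auto)
  finally show ?thesis
    unfolding N_def K_def G_def E_def n_def by (simp add: mult_ac)
qed

lemma eval2_even_sum: "eval2 (even_sum d) x y = even_sum_fun d y"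
proof -
  interpret e: rhom "\<lambda>F. eval2 F x y" by (rule rhom_eval2)
  have "eval2 varY x y = y" by (simp add: eval2_poly varY_def)
  then show ?thesis unfolding even_sum_def even_sum_fun_def by (simp add: e.sum e.add e.power)
qed

lemma degree_even_sum: "degree (even_sum d) \<le> 2 * d"
proof -
  have "degree ((varY ^ j) ^ 2) \<le> 2 * d" if "j \<le> d" for j
    using that degree_power_le[of varY "j * 2"] by (simp add: varY_def flip: power_mult)
  then show ?thesis unfolding even_sum_def
    by (intro degree_sum_le degree_add_le) auto
qed

text \<open>The fibrewise bound holds with one constant \<open>C\<close> for all x in
  \<open>[A, B]\<close>, so \<open>h\<close> can be the square of
  \<open>D * l^(e + 2 * d + 1)\<close> up to a positive constant. Where \<open>D\<close> or the
  leading coefficient \<open>l\<close> vanishes, \<open>h\<close> does too and the bound is mere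
  non-negativity.\<close>

lemma reserve:
  fixes f :: bpoly
  assumes uv: "u * f + v * pderiv f = [:D:]" "D \<noteq> 0" and f0: "f \<noteq> 0"
  shows "\<exists>h d. h \<noteq> 0 \<and> (\<forall>x. poly h x \<ge> 0) \<and> degree f \<le> 2 * d \<and>
    (\<forall>x\<in>{A..B}. (\<forall>y. eval2 f x y \<ge> 0) \<longrightarrow> (\<forall>y. poly h x * even_sum_fun d y \<le> eval2 f x y))"
proof -
  define n where "n = degree f"
  \<comment> \<open>Rounded up for odd degree. A non-negative fibre with \<open>l\<close> nonzero
    has even degree, and then \<open>2 * d = n\<close>.\<close>
  define d where "d = (n + 1) div 2"
  define e where "e = degree u"
  define l where "l = lead_coeff f"
  have l0: "l \<noteq> 0" using f0 by (simp add: l_def)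
  obtain C1 where C1: "C1 \<ge> 1" "\<And>k x. x \<in> {A..B} \<Longrightarrow> \<bar>poly (coeff f k) x\<bar> \<le> C1" using bpoly_bounded_interval by blast
  obtain C2 where C2: "\<And>k x. x \<in> {A..B} \<Longrightarrow> \<bar>poly (coeff u k) x\<bar> \<le> C2" using bpoly_bounded_interval by blast
  obtain C3 where C3: "\<And>x. x \<in> {A..B} \<Longrightarrow> \<bar>poly D x\<bar> \<le> C3" using poly_bounded_interval by blast
  define C where "C = max C1 (max C2 C3)"
  have C: "C \<ge> 1" using C1(1) by (simp add: C_def)
  define L where "L = 2 * real (e + 1) * C ^ 2 * (2 * real (2 * d + 1) * C) ^ (e + 2 * d) * real (2 * (2 * d + 1)) * C ^ (e + 2 * d + 2)"
  have L: "L > 0" unfolding L_def by (intro mult_pos_pos zero_less_power) (use C in auto)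
  define h where "h = smult (inverse L) ((D * l ^ (e + 2 * d + 1)) ^ 2)"
  have hx: "poly h x = inverse L * (poly D x * poly l x ^ (e + 2 * d + 1)) ^ 2" for x
    by (simp add: h_def)
  have main: "poly h x * even_sum_fun d y \<le> eval2 f x y"
    if x: "x \<in> {A..B}" and nn: "\<And>y. eval2 f x y \<ge> 0" for x y
  proof (cases "poly l x = 0")
    case True
    then show ?thesis using nn[of y] by (simp add: hx)
  next
    case lx: False
    interpret ev: rhom "\<lambda>c. poly c x" by unfold_locales auto
    define F where "F = map_poly (\<lambda>c. poly c x) f"
    define U where "U = map_poly (\<lambda>c. poly c x) u"
    define V where "V = map_poly (\<lambda>c. poly c x) v"
    have evF: "eval2 f x y = poly F y" for y by (simp add: eval2_def F_def)
    have Fn: "coeff F n = poly l x" by (simp add: F_def ev.coeff_map n_def l_def)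
    have dF: "degree F = n"
    proof (rule antisym)
      show "degree F \<le> n" by (rule degree_le) (auto simp: F_def ev.coeff_map n_def coeff_eq_0)
      show "n \<le> degree F" using Fn lx by (intro le_degree) simp
    qed
    have F0: "F \<noteq> 0" using Fn lx by auto
    have Fnn: "poly F y \<ge> 0" for y using nn by (simp add: evF)
    have ev: "even n" and pos: "lead_coeff F > 0"
      using nonneg_poly_even_degree[OF Fnn F0] dF by auto
    have dU: "degree U \<le> e" by (rule degree_le) (auto simp: U_def ev.coeff_map e_def coeff_eq_0)
    have UV: "U * F + V * pderiv F = [:poly D x:]"
    proof -
      have "map_poly (\<lambda>c. poly c x) (u * f + v * pderiv f) = [:poly D x:]" unfolding uv by (simp add: map_poly_pCons)
      then show ?thesis by (simp add: U_def V_def F_def ev.map_poly_add ev.map_poly_mult ev.map_poly_pderiv)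
    qed
    have "(poly D x * poly l x ^ (e + 2 * d + 1)) ^ 2 * even_sum_fun d y \<le> L * poly F y"
      unfolding L_def
    proof (rule poly_lower_bound[OF _ dU C _ _ _ _ _ UV Fnn])
      show "degree F = 2 * d" using dF ev by (simp add: d_def)
      show "lead_coeff F = poly l x" using Fn dF by simp
      then show "0 < poly l x" using pos by simp
      show "\<bar>coeff F i\<bar> \<le> C" for i using C1(2)[OF x, of i] by (simp add: F_def ev.coeff_map C_def)
      show "\<bar>coeff U i\<bar> \<le> C" for i using C2[OF x, of i] by (simp add: U_def ev.coeff_map C_def)
      show "\<bar>poly D x\<bar> \<le> C" using C3[OF x] by (simp add: C_def)
    qed
    then have "inverse L * ((poly D x * poly l x ^ (e + 2 * d + 1)) ^ 2 * even_sum_fun d y) \<le> inverse L * (L * poly F y)"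
      using L by (intro mult_left_mono) auto
    also have "\<dots> = eval2 f x y" using L by (simp add: evF)
    finally show ?thesis by (simp add: hx mult.assoc)
  qed
  have "h \<noteq> 0" using L l0 uv(2) by (simp add: h_def)
  moreover have "poly h x \<ge> 0" for x using L by (simp add: hx)
  moreover have "degree f \<le> 2 * d" by (simp add: d_def n_def)
  ultimately show ?thesis using main by blast
qed

subsection \<open>Local membership\<close>

text \<open>\<open>is_sos\<close> forgets the degrees of the squares; here each has y-degree at most
  d, so the bound 2d survives multiplication by polynomials in x.\<close>

inductive_set sos_deg :: "nat \<Rightarrow> bpoly set" for d where
  zero: "0 \<in> sos_deg d"
| add: "degree p \<le> d \<Longrightarrow> s \<in> sos_deg d \<Longrightarrow> p ^ 2 + s \<in> sos_deg d"

lemma sos_deg_square: "degree p \<le> d \<Longrightarrow> p ^ 2 \<in> sos_deg d"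
  using sos_deg.add[OF _ sos_deg.zero, of p d] by simp

lemma sos_deg_add: "s \<in> sos_deg d \<Longrightarrow> t \<in> sos_deg d \<Longrightarrow> s + t \<in> sos_deg d"
  by (induction rule: sos_deg.induct) (auto simp: add.assoc intro: sos_deg.add)

lemma degree_power2_le: "degree (p :: 'a::comm_semiring_1 poly) \<le> d \<Longrightarrow> degree (p ^ 2) \<le> 2 * d"
  using degree_power_le[of p 2] by simp

lemma degree_sos_deg: "s \<in> sos_deg d \<Longrightarrow> degree s \<le> 2 * d"
  by (induction rule: sos_deg.induct) (auto intro: degree_add_le degree_power2_le)

lemma degree_const_mult_le: "degree (s :: 'a::comm_semiring_1 poly) \<le> m \<Longrightarrow> degree ([:p:] * s) \<le> m"
  using degree_smult_le[of p s] by simp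

context quadratic_module
begin

lemma sos_deg_mult: "s \<in> sos_deg d \<Longrightarrow> f \<in> M \<Longrightarrow> f * s \<in> M"
proof (induction rule: sos_deg.induct)
  case (add p s)
  have "f * (p ^ 2 + s) = p ^ 2 * f + f * s" by (simp add: algebra_simps)
  then show ?case using add square_mult quadratic_module.add[OF quadratic_module_axioms] by metis
qed (use zero in simp)

lemma sos_deg_in: "s \<in> sos_deg d \<Longrightarrow> s \<in> M"
  using sos_deg_mult[of s d 1] square[of 1] by simp

end

text \<open>Writing \<open>y^k\<close> as a product of two powers of degree at most d and using
  \<open>a * b = ((a + b) / 2)^2 - ((a - b) / 2)^2\<close> respects the degree bound.\<close>

lemma diff_sos_deg:
  fixes f :: bpoly
  assumes "degree f \<le> 2 * d"
  shows "\<exists>P\<in>sos_deg d. \<exists>N\<in>sos_deg d. f = P - N"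
proof -
  obtain c :: real where c: "4 * c ^ 2 = 1" by (rule that[of "1 / 2"]) (simp add: power2_eq_square)
  define \<kappa> :: bpoly where "\<kappa> = [:[:c:]:]"
  have \<kappa>: "4 * \<kappa> ^ 2 = 1"
  proof -
    have "[:[:4 * c ^ 2:]:] = (1 :: bpoly)" by (simp add: c one_pCons)
    moreover have "[:[:4 * c ^ 2:]:] = [:[:4:]:] * \<kappa> ^ 2" by (simp add: \<kappa>_def power2_eq_square)
    moreover have "(4 :: bpoly) = [:[:4:]:]" by (simp add: numeral_poly)
    ultimately show ?thesis by (simp only:)
  qed
  have mono: "\<exists>P\<in>sos_deg d. \<exists>N\<in>sos_deg d. monom e k = P - N" if k: "k \<le> 2 * d" for e k
  proof -
    define a where "a = monom e (k div 2)"
    define b :: bpoly where "b = monom 1 (k - k div 2)"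
    have deg: "degree a \<le> d" "degree b \<le> d"
      using k by (auto simp: a_def b_def intro: order.trans[OF degree_monom_le])
    have "monom e k = a * b" by (simp add: a_def b_def mult_monom)
    also have "\<dots> = (4 * \<kappa> ^ 2) * (a * b)" by (simp only: \<kappa> mult_1_left)
    also have "\<dots> = (\<kappa> * (a + b)) ^ 2 - (\<kappa> * (a - b)) ^ 2"
      by (simp add: power2_eq_square algebra_simps)
    finally have "monom e k = (\<kappa> * (a + b)) ^ 2 - (\<kappa> * (a - b)) ^ 2" .
    moreover have "degree (\<kappa> * (a + b)) \<le> d" "degree (\<kappa> * (a - b)) \<le> d"
      unfolding \<kappa>_def by (intro degree_const_mult_le degree_add_le degree_diff_le deg)+
    ultimately show ?thesis using sos_deg_square by metis
  qed
  have "\<exists>P\<in>sos_deg d. \<exists>N\<in>sos_deg d. (\<Sum>k\<in>K. monom (coeff f k) k) = P - N" if "finite K" "K \<subseteq> {..2 * d}" for K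
    using that
  proof (induction K rule: finite_induct)
    case empty
    then show ?case using sos_deg.zero by force
  next
    case (insert k K)
    then obtain P N where 1: "P \<in> sos_deg d" "N \<in> sos_deg d" "(\<Sum>k\<in>K. monom (coeff f k) k) = P - N" by auto
    obtain P' N' where 2: "P' \<in> sos_deg d" "N' \<in> sos_deg d" "monom (coeff f k) k = P' - N'"
    proof -
      have "\<exists>P\<in>sos_deg d. \<exists>N\<in>sos_deg d. monom (coeff f k) k = P - N" using insert.prems by (intro mono) auto
      then show thesis using that by blast
    qed
    have "(\<Sum>k\<in>insert k K. monom (coeff f k) k) = (P' + P) - (N' + N)"
      using insert 1 2 by simp
    then show ?case using 1 2 sos_deg_add by blast
  qed
  from this[of "{..2 * d}"] show ?thesis using poly_as_sum_of_monoms'[OF assms] by simp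
qed

text \<open>Hensel lifting of \<open>1 / sqrt \<gamma>\<close>: each step adds
  \<open>a * (x - c)^(n + 1)\<close>, where \<open>a\<close> solves a linear equation whose
  coefficient \<open>2 * \<rho>(c) * \<gamma>(c)\<close> is nonzero.\<close>

lemma sqrt_inverse_mod:
  fixes \<gamma> :: "real poly"
  assumes "poly \<gamma> c > 0"
  shows "\<exists>\<rho>. [:- c, 1:] ^ n dvd \<rho> ^ 2 * \<gamma> - 1"
proof -
  have "\<exists>\<rho>. [:- c, 1:] ^ Suc n dvd \<rho> ^ 2 * \<gamma> - 1 \<and> poly \<rho> c \<noteq> 0" for n
  proof (induction n)
    case 0
    define s where "s = 1 / sqrt (poly \<gamma> c)"
    have s: "s ^ 2 * poly \<gamma> c = 1" "s \<noteq> 0" using assms by (simp_all add: s_def power_divide)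
    then have "poly ([:s:] ^ 2 * \<gamma> - 1) c = 0" by simp
    then have "[:- c, 1:] dvd [:s:] ^ 2 * \<gamma> - 1" by (simp only: poly_eq_0_iff_dvd)
    then show ?case using s(2) by (intro exI[of _ "[:s:]"]) simp
  next
    case (Suc n)
    define X where "X = [:- c, 1:] ^ Suc n"
    obtain \<rho> where \<rho>: "X dvd \<rho> ^ 2 * \<gamma> - 1" "poly \<rho> c \<noteq> 0" using Suc unfolding X_def by blast
    then obtain e where e: "\<rho> ^ 2 * \<gamma> - 1 = X * e" by blast
    define b where "b = 2 * poly \<rho> c * poly \<gamma> c"
    have b: "b \<noteq> 0" using \<rho>(2) assms by (simp add: b_def)
    define a where "a = - poly e c / b"
    have ab: "poly e c + a * b = 0" using b by (simp add: a_def)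
    define \<rho>' where "\<rho>' = \<rho> + [:a:] * X"
    have "\<rho>' ^ 2 * \<gamma> - 1 = (\<rho> ^ 2 * \<gamma> - 1) + X * ([:a:] * (\<rho> + \<rho>) * \<gamma>) + X * (X * [:a:] ^ 2 * \<gamma>)"
      unfolding \<rho>'_def by (simp only: power2_eq_square) (simp only: algebra_simps)
    also have "\<dots> = X * (e + [:a:] * (\<rho> + \<rho>) * \<gamma> + X * [:a:] ^ 2 * \<gamma>)"
      unfolding e by (simp only: distrib_left)
    finally have eq: "\<rho>' ^ 2 * \<gamma> - 1 = \<dots>" .
    have Xc: "poly X c = 0" by (simp add: X_def)
    have "poly (e + [:a:] * (\<rho> + \<rho>) * \<gamma> + X * [:a:] ^ 2 * \<gamma>) c = poly e c + a * b"
      by (simp only: poly_add poly_mult Xc) (simp add: b_def algebra_simps)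
    then have "[:- c, 1:] dvd e + [:a:] * (\<rho> + \<rho>) * \<gamma> + X * [:a:] ^ 2 * \<gamma>"
      unfolding ab by (simp only: poly_eq_0_iff_dvd)
    then have "X * [:- c, 1:] dvd \<rho>' ^ 2 * \<gamma> - 1" unfolding eq by (rule mult_dvd_mono[OF dvd_refl])
    moreover have "X * [:- c, 1:] = [:- c, 1:] ^ Suc (Suc n)" by (simp only: X_def power_Suc mult.commute)
    moreover have "poly \<rho>' c \<noteq> 0" using \<rho>(2) by (simp add: \<rho>'_def Xc)
    ultimately show ?case by metis
  qed
  then obtain \<rho> where "[:- c, 1:] ^ Suc n dvd \<rho> ^ 2 * \<gamma> - 1" by blast
  moreover have "[:- c, 1:] ^ n dvd [:- c, 1:] ^ Suc n" by (rule le_imp_power_dvd) simp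
  ultimately show ?thesis using dvd_trans by blast
qed

section \<open>Substitution of polynomials for the variable x\<close>

definition bpoly_subst :: "real poly \<Rightarrow> bpoly \<Rightarrow> bpoly" where
  "bpoly_subst q f = map_poly (\<lambda>p. pcompose p q) f"

lemma rhom_pcompose: "rhom (\<lambda>p :: real poly. pcompose p q)"
  by unfold_locales (simp_all add: pcompose_add pcompose_mult pcompose_1)

interpretation bpoly_subst: rhom "bpoly_subst q" for q
proof -
  interpret p: rhom "\<lambda>p. pcompose p q" by (rule rhom_pcompose)
  show "rhom (bpoly_subst q)"
    by unfold_locales (simp_all add: bpoly_subst_def p.map_poly_add p.map_poly_mult pcompose_1)
qed

lemma eval2_bpoly_subst: "eval2 (bpoly_subst q f) t y = eval2 f (poly q t) y"
  unfolding bpoly_subst_def by (induction f) (simp_all add: eval2_def map_poly_pCons poly_pcompose)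

lemma bpoly_subst_const: "bpoly_subst q [:p:] = [:pcompose p q:]"
  by (simp add: bpoly_subst_def map_poly_pCons)

lemma coeff_bpoly_subst: "coeff (bpoly_subst q f) i = pcompose (coeff f i) q"
  by (simp add: bpoly_subst_def coeff_map_poly)

lemma degree_bpoly_subst_le: "degree (bpoly_subst q f) \<le> degree f"
  by (rule degree_le) (simp add: coeff_bpoly_subst coeff_eq_0)

lemma bpoly_subst_subst: "bpoly_subst r (bpoly_subst q f) = bpoly_subst (pcompose q r) f"
  by (rule poly_eqI) (simp add: coeff_bpoly_subst pcompose_assoc)

lemma bpoly_subst_id: "bpoly_subst [:0, 1:] f = f"
  by (rule poly_eqI) (simp add: coeff_bpoly_subst)

lemma pcompose_power: "pcompose (p ^ n) q = pcompose p q ^ n" for p q :: "'a::comm_ring_1 poly"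
  by (induction n) (simp_all add: pcompose_1 pcompose_mult)

lemma const_dvd_mult:
  assumes "p dvd q" shows "[:p:] dvd [:q:] * (f :: 'a::comm_ring_1 poly)"
proof -
  obtain r where "q = p * r" using assms by blast
  then have "[:q:] = [:p:] * [:r:]" by simp
  then show ?thesis by (metis dvd_mult2 dvd_triv_left)
qed

abbreviation lin :: "real \<Rightarrow> real \<Rightarrow> real poly" where
  "lin c \<sigma> \<equiv> [:- (\<sigma> * c), \<sigma>:]"

context quadratic_module
begin

text \<open>The two hypotheses say that \<open>\<sigma>(x - c)\<close> may be used as a weight, up to arbitrarily high order
  at \<open>c\<close>, whenever the set contains no one-sided neighbourhood of \<open>c\<close> on the opposite side.\<close>

lemma local_membership:
  fixes f :: bpoly
  assumes deg: "degree f \<le> 2 * d" and fc: "\<And>y. eval2 f c y \<ge> 0"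
    and side: "\<And>\<sigma>. \<sigma> \<in> {1, -1} \<Longrightarrow>
      (\<exists>r>0. \<forall>t y. 0 \<le> t \<longrightarrow> t < r \<longrightarrow> eval2 f (c - \<sigma> * t) y \<ge> 0) \<or>
      (\<forall>n. \<exists>p. [:p:] \<in> M \<and> [:- c, 1:] ^ n dvd p - (lin c \<sigma>))"
  shows "\<exists>g\<in>M. degree g \<le> 2 * d \<and> [:[:- c, 1:] ^ n:] dvd f - g"
proof -
  define nn where "nn \<sigma> \<longleftrightarrow> (\<exists>r>0. \<forall>t y. 0 \<le> t \<longrightarrow> t < r \<longrightarrow> eval2 f (c - \<sigma> * t) y \<ge> 0)" for \<sigma>
  define wt where "wt \<sigma> \<longleftrightarrow> (\<forall>n. \<exists>p. [:p:] \<in> M \<and> [:- c, 1:] ^ n dvd p - (lin c \<sigma>))" for \<sigma>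
  have side': "nn \<sigma> \<or> wt \<sigma>" if "\<sigma> \<in> {1, -1}" for \<sigma> using side[OF that] unfolding nn_def wt_def .
  \<comment> \<open>\<open>sh\<close> moves \<open>c\<close> to 0 and orients the x-axis by
    \<open>\<sigma>\<close>; \<open>bk\<close> undoes this because
    \<open>\<sigma>^2 = 1\<close>.\<close>
  define sh where "sh \<sigma> = bpoly_subst [:c, \<sigma>:]" for \<sigma>
  define bk where "bk \<sigma> = bpoly_subst (lin c \<sigma>)" for \<sigma>
  have bs: "bk \<sigma> (sh \<sigma> g) = g" if "\<sigma> \<in> {1, -1}" for \<sigma> g
  proof -
    have "pcompose [:c, \<sigma>:] (lin c \<sigma>) = [:0, 1:]" using that by (auto simp: pcompose_pCons)
    then show ?thesis by (simp add: bk_def sh_def bpoly_subst_subst bpoly_subst_id)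
  qed
  have bX: "bk \<sigma> [:[:0, 1:]:] = [:(lin c \<sigma>):]" for \<sigma>
    by (simp add: bk_def bpoly_subst_const pcompose_pCons)
  have bdvd: "[:[:- c, 1:] ^ n:] dvd bk \<sigma> g" if dv: "[:[:0, 1:] ^ n:] dvd g" and \<sigma>: "\<sigma> \<in> {1, -1}" for \<sigma> g n
  proof -
    obtain g' where g': "g = [:[:0, 1:] ^ n:] * g'" using dv by blast
    have "bk \<sigma> g = [:(lin c \<sigma>) ^ n:] * bk \<sigma> g'"
      unfolding g' bk_def bpoly_subst.mult bpoly_subst_const pcompose_power by (simp add: pcompose_pCons)
    moreover have "(lin c \<sigma>) = [:- c, 1:] * [:\<sigma>:]" by simp
    then have "[:- c, 1:] ^ n dvd (lin c \<sigma>) ^ n" by (simp only: power_mult_distrib dvd_triv_left)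
    ultimately show ?thesis by (simp add: const_dvd_mult del: mult_pCons_left)
  qed
  have dbk: "degree (bk \<sigma> g) \<le> m" if "degree g \<le> m" for \<sigma> g m
    unfolding bk_def using degree_bpoly_subst_le[of "(lin c \<sigma>)" g] that by (rule order.trans)
  have dsh: "degree (sh \<sigma> f) \<le> 2 * d" for \<sigma>
    unfolding sh_def using degree_bpoly_subst_le[of "[:c, \<sigma>:]" f] deg by (rule order.trans)
  have evsh: "eval2 (sh \<sigma> f) t y = eval2 f (c + \<sigma> * t) y" for \<sigma> t y
    by (simp add: sh_def eval2_bpoly_subst mult.commute)
  \<comment> \<open>The weight t of the one-sided representation becomes
    \<open>\<sigma> * (x - c)\<close>, which \<open>p\<close> replaces modulo the power of
    \<open>x - c\<close>.\<close>
  have one_sided: ?thesis if \<sigma>: "\<sigma> \<in> {1, -1}" and n\<sigma>: "nn (- \<sigma>)" and w\<sigma>: "wt \<sigma>" for \<sigma>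
  proof -
    obtain r where r: "r > 0" "\<And>t y. 0 \<le> t \<Longrightarrow> t < r \<Longrightarrow> eval2 (sh \<sigma> f) t y \<ge> 0"
      using n\<sigma> unfolding nn_def evsh by auto
    from local_two_squares_onesided[OF r, of n] obtain P Q R S where
      dg: "2 * degree P \<le> degree (sh \<sigma> f)" "2 * degree Q \<le> degree (sh \<sigma> f)"
        "2 * degree R \<le> degree (sh \<sigma> f)" "2 * degree S \<le> degree (sh \<sigma> f)"
      and dv: "[:[:0, 1:] ^ n:] dvd sh \<sigma> f - (P ^ 2 + Q ^ 2 + [:[:0, 1:]:] * (R ^ 2 + S ^ 2))" by blast
    obtain p where p: "[:p:] \<in> M" "[:- c, 1:] ^ n dvd p - (lin c \<sigma>)" using w\<sigma> unfolding wt_def by blast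
    have dPQ: "degree P \<le> d" "degree Q \<le> d" "degree R \<le> d" "degree S \<le> d" using dg dsh[of \<sigma>] by auto
    define s where "s = bk \<sigma> P ^ 2 + bk \<sigma> Q ^ 2"
    define t where "t = bk \<sigma> R ^ 2 + bk \<sigma> S ^ 2"
    have st: "s \<in> sos_deg d" "t \<in> sos_deg d"
      unfolding s_def t_def by (intro sos_deg_add sos_deg_square dbk dPQ)+
    have 1: "[:[:- c, 1:] ^ n:] dvd f - (s + [:(lin c \<sigma>):] * t)"
    proof -
      have "bk \<sigma> (sh \<sigma> f - (P ^ 2 + Q ^ 2 + [:[:0, 1:]:] * (R ^ 2 + S ^ 2))) = bk \<sigma> (sh \<sigma> f) - (s + bk \<sigma> [:[:0, 1:]:] * t)"
        unfolding s_def t_def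
        by (simp only: bk_def bpoly_subst.diff bpoly_subst.add bpoly_subst.mult bpoly_subst.power)
      then show ?thesis using bdvd[OF dv \<sigma>] unfolding bs[OF \<sigma>] bX by (simp only:)
    qed
    have 2: "[:[:- c, 1:] ^ n:] dvd [:p - (lin c \<sigma>):] * t" by (rule const_dvd_mult[OF p(2)])
    have 3: "[:p - (lin c \<sigma>):] = [:p:] - [:(lin c \<sigma>):]" by simp
    have "f - (s + a * t) = (f - (s + b * t)) - (a - b) * t" for a b by (simp add: algebra_simps)
    then have "f - (s + [:p:] * t) = (f - (s + [:(lin c \<sigma>):] * t)) - [:p - (lin c \<sigma>):] * t"
      unfolding 3 by blast
    then have "[:[:- c, 1:] ^ n:] dvd f - (s + [:p:] * t)" using dvd_diff[OF 1 2] by (simp only:)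
    moreover have "s + [:p:] * t \<in> M" by (intro add sos_deg_in[OF st(1)] sos_deg_mult[OF st(2)] p(1))
    moreover have "degree (s + [:p:] * t) \<le> 2 * d"
      by (intro degree_add_le degree_const_mult_le degree_sos_deg st)
    ultimately show ?thesis by blast
  qed
  consider "nn 1" "nn (- 1)" | "nn (- 1)" "wt 1" | "nn 1" "wt (- 1)" | "wt 1" "wt (- 1)"
    using side'[of 1] side'[of "- 1"] by blast
  then show ?thesis
  proof cases
    case 1
    then obtain r r' where r: "r > 0" "\<And>t y. 0 \<le> t \<Longrightarrow> t < r \<Longrightarrow> eval2 f (c - t) y \<ge> 0"
      and r': "r' > 0" "\<And>t y. 0 \<le> t \<Longrightarrow> t < r' \<Longrightarrow> eval2 f (c + t) y \<ge> 0"
      unfolding nn_def by auto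
    have "eval2 (sh 1 f) t y \<ge> 0" if "\<bar>t\<bar> < min r r'" for t y
      using that r(2)[of "- t" y] r'(2)[of t y] by (cases "t \<ge> 0") (simp_all add: evsh)
    then obtain P Q where dg: "2 * degree P \<le> degree (sh 1 f)" "2 * degree Q \<le> degree (sh 1 f)"
      and dv: "[:[:0, 1:] ^ n:] dvd sh 1 f - (P ^ 2 + Q ^ 2)"
      using local_two_squares[of "min r r'" "sh 1 f" n] r(1) r'(1) by auto
    define s where "s = bk 1 P ^ 2 + bk 1 Q ^ 2"
    have "degree P \<le> d" "degree Q \<le> d" using dg dsh[of 1] by auto
    then have s: "s \<in> sos_deg d" unfolding s_def by (intro sos_deg_add sos_deg_square dbk)
    have "bk 1 (sh 1 f - (P ^ 2 + Q ^ 2)) = bk 1 (sh 1 f) - s"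
      unfolding s_def by (simp only: bk_def bpoly_subst.diff bpoly_subst.add bpoly_subst.power)
    then have "[:[:- c, 1:] ^ n:] dvd f - s" using bdvd[OF dv, of 1] bs[of 1 f] by simp
    then show ?thesis using sos_deg_in[OF s] degree_sos_deg[OF s] by blast
  next
    case 2
    then show ?thesis by (intro one_sided[of 1]) auto
  next
    case 3
    then show ?thesis by (intro one_sided[of "- 1"]) auto
  next
    case 4
    \<comment> \<open>Both \<open>x - c\<close> and \<open>c - x\<close> act as weights, so any
      multiple of \<open>x - c\<close>, in particular \<open>f - f(c, y)\<close>, is represented.
      What remains is \<open>f(c, y)\<close>, non-negative and constant in x. Isolated points of
      \<open>U\<close> lead here.\<close>
    define F :: bpoly where "F = bpoly_subst [:c:] f"
    have evF: "eval2 F t y = eval2 f c y" for t y by (simp add: F_def eval2_bpoly_subst)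
    have dF: "degree F \<le> 2 * d" unfolding F_def using degree_bpoly_subst_le[of "[:c:]" f] deg by (rule order.trans)
    have "eval2 F t y \<ge> 0" if "\<bar>t\<bar> < 1" for t y using fc by (simp add: evF)
    then obtain P Q where dg: "2 * degree P \<le> degree F" "2 * degree Q \<le> degree F"
      and dv: "[:[:0, 1:] ^ n:] dvd F - (P ^ 2 + Q ^ 2)"
      using local_two_squares[of 1 F n] by auto
    define s where "s = bk 1 P ^ 2 + bk 1 Q ^ 2"
    have "degree P \<le> d" "degree Q \<le> d" using dg dF by auto
    then have s: "s \<in> sos_deg d" unfolding s_def by (intro sos_deg_add sos_deg_square dbk)
    have bF: "bk 1 F = F" by (simp add: bk_def F_def bpoly_subst_subst pcompose_pCons)
    have "bk 1 (F - (P ^ 2 + Q ^ 2)) = bk 1 F - s"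
      unfolding s_def by (simp only: bk_def bpoly_subst.diff bpoly_subst.add bpoly_subst.power)
    then have 1: "[:[:- c, 1:] ^ n:] dvd F - s" using bdvd[OF dv, of 1] bF by simp
    have "[:[:- c, 1:]:] dvd f - F"
      unfolding const_poly_dvd_iff
    proof
      fix i
      have "poly (coeff (f - F) i) c = 0" by (simp add: F_def coeff_bpoly_subst poly_pcompose)
      then show "[:- c, 1:] dvd coeff (f - F) i" by (simp only: poly_eq_0_iff_dvd)
    qed
    then obtain G where G: "f - F = [:[:- c, 1:]:] * G" by blast
    have "degree G \<le> 2 * d"
    proof (cases "G = 0")
      case False
      have "degree ([:[:- c, 1:]:] * G) = degree [:[:- c, 1:]:] + degree G"
        using False by (intro degree_mult_eq) auto
      moreover have "degree (f - F) \<le> 2 * d" by (intro degree_diff_le deg dF)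
      ultimately show ?thesis unfolding G by simp
    qed simp
    then obtain u v where uv: "u \<in> sos_deg d" "v \<in> sos_deg d" "G = u - v" using diff_sos_deg by blast
    obtain p where p: "[:p:] \<in> M" "[:- c, 1:] ^ n dvd p - (lin c 1)" using 4(1) unfolding wt_def by blast
    obtain q where q: "[:q:] \<in> M" "[:- c, 1:] ^ n dvd q - (lin c (- 1))" using 4(2) unfolding wt_def by blast
    define g where "g = s + [:p:] * u + [:q:] * v"
    have "f - g = (F - s) - [:p - (lin c 1):] * u - [:q - (lin c (- 1)):] * v"
    proof -
      have "f = F + [:[:- c, 1:]:] * (u - v)" using G uv(3) by (simp only: diff_eq_eq add.commute)
      moreover have 3: "[:p - (lin c 1):] = [:p:] - [:[:- c, 1:]:]" by simp
      moreover have 4: "[:q - (lin c (- 1)):] = [:q:] + [:[:- c, 1:]:]" by simp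
      moreover have "(F + X * (u - v)) - (s + a * u + b * v) = (F - s) - (a - X) * u - (b + X) * v" for a b X
        by (simp add: algebra_simps)
      ultimately show ?thesis unfolding g_def 3 4 by metis
    qed
    then have "[:[:- c, 1:] ^ n:] dvd f - g"
      using dvd_diff[OF dvd_diff[OF 1 const_dvd_mult[OF p(2), of u]] const_dvd_mult[OF q(2), of v]] by (simp only:)
    moreover have "g \<in> M" unfolding g_def
      by (intro add sos_deg_in[OF s] sos_deg_mult[OF uv(1)] sos_deg_mult[OF uv(2)] p(1) q(1))
    moreover have "degree g \<le> 2 * d" unfolding g_def
      by (intro degree_add_le degree_const_mult_le degree_sos_deg s uv)
    ultimately show ?thesis by blast
  qed
qed

text \<open>As \<open>s\<close> is negative at \<open>c\<close>, -1 is congruent to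
  \<open>\<rho>^2 * s\<close>; a difference \<open>u - v\<close> of sums of squares is then
  congruent to \<open>u + \<rho>^2 * s * v\<close>.\<close>

lemma local_membership_outside:
  fixes f :: bpoly
  assumes deg: "degree f \<le> 2 * d" and s: "[:s:] \<in> M" "poly s c < 0"
  shows "\<exists>g\<in>M. degree g \<le> 2 * d \<and> [:[:- c, 1:] ^ n:] dvd f - g"
proof -
  obtain \<rho> where \<rho>: "[:- c, 1:] ^ n dvd \<rho> ^ 2 * (- s) - 1"
    using sqrt_inverse_mod[of "- s" c n] s(2) by auto
  obtain u v where uv: "u \<in> sos_deg d" "v \<in> sos_deg d" "f = u - v" using diff_sos_deg[OF deg] by blast
  define p where "p = \<rho> ^ 2 * s"
  have "[:\<rho>:] ^ 2 * [:s:] = [:p:]" by (simp add: p_def power2_eq_square)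
  then have p: "[:p:] \<in> M" using square_mult[OF s(1), of "[:\<rho>:]"] by simp
  have "f - (u + [:p:] * v) = [:\<rho> ^ 2 * (- s) - 1:] * v"
  proof -
    have "[:\<rho> ^ 2 * (- s) - 1:] = - [:p:] - 1" by (simp add: p_def one_pCons)
    moreover have "(u - v) - (u + P * v) = (- P - 1) * v" for P by (simp add: algebra_simps)
    ultimately show ?thesis unfolding uv(3) by (simp only:)
  qed
  then have "[:[:- c, 1:] ^ n:] dvd f - (u + [:p:] * v)" using const_dvd_mult[OF \<rho>, of v] by (simp only:)
  moreover have "u + [:p:] * v \<in> M" by (intro add sos_deg_in[OF uv(1)] sos_deg_mult[OF uv(2)] p)
  moreover have "degree (u + [:p:] * v) \<le> 2 * d"
    by (intro degree_add_le degree_const_mult_le degree_sos_deg uv)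
  ultimately show ?thesis by blast
qed

text \<open>The factor \<open>\<gamma>\<close>, positive at \<open>c\<close>, is removed modulo a
  power of \<open>x - c\<close> by the square of its inverse square root.\<close>

lemma weight_from_generator:
  assumes "[:s:] \<in> M" "s = (lin c \<sigma>) * \<gamma>" "poly \<gamma> c > 0"
  shows "\<exists>p. [:p:] \<in> M \<and> [:- c, 1:] ^ n dvd p - (lin c \<sigma>)"
proof -
  obtain \<rho> where \<rho>: "[:- c, 1:] ^ n dvd \<rho> ^ 2 * \<gamma> - 1" using sqrt_inverse_mod[OF assms(3)] by blast
  have "[:\<rho>:] ^ 2 * [:s:] = [:\<rho> ^ 2 * s:]" by (simp add: power2_eq_square)
  then have "[:\<rho> ^ 2 * s:] \<in> M" using square_mult[OF assms(1), of "[:\<rho>:]"] by simp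
  moreover have "\<rho> ^ 2 * s - (lin c \<sigma>) = (\<rho> ^ 2 * \<gamma> - 1) * (lin c \<sigma>)"
    unfolding assms(2) by (simp only: algebra_simps)
  then have "[:- c, 1:] ^ n dvd \<rho> ^ 2 * s - (lin c \<sigma>)" using \<rho> by (simp only: dvd_mult2)
  ultimately show ?thesis by blast
qed

end

subsection \<open>Saturation\<close>

text \<open>At a zero of \<open>P\<close> the value of \<open>G\<close> is a limit from the right
  through points where \<open>P\<close> is nonzero.\<close>

lemma nonneg_cancel_square:
  fixes P G :: "real poly"
  assumes "\<And>y. poly (P ^ 2 * G) y \<ge> 0" "P \<noteq> 0"
  shows "poly G y \<ge> 0"
proof -
  define S where "S = {z. poly P z = 0} - {y}"
  have "finite S" using poly_roots_finite[OF assms(2)] by (simp add: S_def)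
  then have "open (- S)" by (simp add: finite_imp_closed open_Compl)
  then have "eventually (\<lambda>z. z \<in> - S) (nhds y)" by (rule eventually_nhds_in_open) (simp add: S_def)
  then have "eventually (\<lambda>z. z \<in> - S) (at_right y)"
    by (rule filter_leD[OF at_within_le_nhds])
  moreover have "eventually (\<lambda>z. z > y) (at_right y)" by (rule eventually_at_right_less)
  ultimately have "eventually (\<lambda>z. poly G z \<ge> 0) (at_right y)"
  proof eventually_elim
    case (elim z)
    then have "poly P z \<noteq> 0" by (auto simp: S_def)
    then have "poly P z ^ 2 > 0" by simp
    then show ?case using assms(1)[of z] by (simp add: zero_le_mult_iff)
  qed
  moreover have "((\<lambda>z. poly G z) \<longlongrightarrow> poly G y) (at_right y)"
    by (intro tendsto_intros isCont_tendsto_compose[OF poly_isCont])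
  ultimately show ?thesis by (intro tendsto_lowerbound) auto
qed

text \<open>Vanishing on a whole vertical line would make the linear polynomial of that line a
  divisor, which irreducibility together with positive y-degree excludes.\<close>

lemma prime_bpoly_eval_nonzero:
  fixes p :: bpoly
  assumes "prime p" "degree p > 0"
  shows "map_poly (\<lambda>c. poly c x) p \<noteq> 0"
proof
  assume z: "map_poly (\<lambda>c. poly c x) p = 0"
  have "[:[:- x, 1:]:] dvd p"
    unfolding const_poly_dvd_iff
  proof
    fix i
    have "poly (coeff p i) x = 0" using arg_cong[OF z, of "\<lambda>q. coeff q i"] by (simp add: coeff_map_poly)
    then show "[:- x, 1:] dvd coeff p i" by (simp only: poly_eq_0_iff_dvd)
  qed
  then obtain q where q: "p = [:[:- x, 1:]:] * q" by blast
  have "irreducible p" using assms(1) by (simp add: prime_elem_imp_irreducible prime_def)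
  then have "is_unit [:[:- x, 1:]:] \<or> is_unit q" using q irreducibleD by blast
  then have "is_unit q" by (simp add: is_unit_const_poly_iff is_unit_poly_iff)
  then have "degree q = 0" by (auto simp: is_unit_poly_iff)
  then have "degree p = 0" unfolding q using degree_smult_le[of "[:- x, 1:]" q] by simp
  then show False using assms(2) by simp
qed

text \<open>The hypothesis \<open>loc\<close> speaks of all polynomials non-negative on
  \<open>U\<close> because it is applied to \<open>f2\<close>, which differs from \<open>f\<close>
  by the reserve. Squares of primes involving y are divided out by induction on the
  y-degree.\<close>

theorem (in quadratic_module) saturated_if_locally:
  assumes AB: "A \<le> B" "U \<subseteq> {A..B}"
    and ivl: "\<And>p q. (\<And>x. x \<in> {A..B} \<Longrightarrow> poly p x \<ge> 0) \<Longrightarrow> [:p:] * q ^ 2 \<in> M"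
    and loc: "\<And>f d c n. degree f \<le> 2 * d \<Longrightarrow> (\<And>x y. x \<in> U \<Longrightarrow> eval2 f x y \<ge> 0) \<Longrightarrow> c \<in> {A..B} \<Longrightarrow>
      \<exists>g\<in>M. degree g \<le> 2 * d \<and> [:[:- c, 1:] ^ n:] dvd f - g"
    and f: "\<And>x y. x \<in> U \<Longrightarrow> eval2 f x y \<ge> 0"
  shows "f \<in> M"
  using f
proof (induction "degree f" arbitrary: f rule: less_induct)
  case less
  show ?case
  proof (cases "f = 0")
    case True
    then show ?thesis using zero by simp
  next
    case f0: False
    show ?thesis
    proof (cases "\<exists>p. prime p \<and> degree p > 0 \<and> p ^ 2 dvd f")
      case True
      then obtain p g where p: "prime p" "degree p > 0" and g: "f = p ^ 2 * g" by blast
      have "eval2 g x y \<ge> 0" if "x \<in> U" for x y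
      proof -
        interpret ev: rhom "\<lambda>c. poly c x" by unfold_locales auto
        have e: "eval2 q x y = poly (map_poly (\<lambda>c. poly c x) q) y" for q y by (simp add: eval2_def)
        show ?thesis unfolding e
        proof (rule nonneg_cancel_square)
          show "0 \<le> poly (map_poly (\<lambda>c. poly c x) p ^ 2 * map_poly (\<lambda>c. poly c x) g) y" for y
            using less.prems[OF that, of y] unfolding e g ev.map_poly_mult ev.map_poly_power .
        qed (rule prime_bpoly_eval_nonzero[OF p])
      qed
      moreover have "degree g < degree f"
        using f0 p(2) unfolding g by (subst degree_mult_eq) (auto simp: degree_power_eq)
      ultimately have "g \<in> M" using less.hyps by blast
      then show ?thesis unfolding g by (rule square_mult)
    next
      case False
      then have "\<exists>u v D. u * f + v * pderiv f = [:D:] \<and> D \<noteq> 0"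
        by (intro squarefree_bezout[OF f0]) auto
      then obtain u v D where "u * f + v * pderiv f = [:D:]" "D \<noteq> 0" by (elim exE conjE)
      from reserve[OF this f0, of A B] obtain h d where h: "h \<noteq> 0" "\<And>x. poly h x \<ge> 0"
        and d: "degree f \<le> 2 * d"
        and low: "\<And>x y. x \<in> {A..B} \<Longrightarrow> (\<And>y. eval2 f x y \<ge> 0) \<Longrightarrow> poly h x * even_sum_fun d y \<le> eval2 f x y"
        by blast
      \<comment> \<open>Subtracting the reserve keeps non-negativity on \<open>U\<close>, and
        \<open>local_global\<close> adds it back.\<close>
      define f2 where "f2 = f - [:h:] * even_sum d"
      have d2: "degree f2 \<le> 2 * d"
        unfolding f2_def by (intro degree_diff_le d degree_const_mult_le degree_even_sum)
      have f2nn: "eval2 f2 x y \<ge> 0" if "x \<in> U" for x y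
      proof -
        interpret e: rhom "\<lambda>F. eval2 F x y" by (rule rhom_eval2)
        have "eval2 [:h:] x y = poly h x" by (simp add: eval2_poly)
        then have "eval2 f2 x y = eval2 f x y - poly h x * even_sum_fun d y"
          unfolding f2_def e.diff e.mult by (simp add: eval2_even_sum)
        moreover have "poly h x * even_sum_fun d y \<le> eval2 f x y"
          using that AB(2) less.prems by (intro low) auto
        ultimately show ?thesis by simp
      qed
      have "f2 + [:h:] * even_sum d \<in> M"
        using AB(1) ivl loc[OF d2 f2nn] d2 h by (intro local_global) auto
      then show ?thesis by (simp add: f2_def)
    qed
  qed
qed

lemma gens_mem:
  assumes "k \<ge> 1"
  shows "[:[:- a 0, 1:]:] \<in> qmodule (gens k a b)" "[:[:b (k - 1), - 1:]:] \<in> qmodule (gens k a b)"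
    and "\<And>i. Suc i < k \<Longrightarrow> [:[:- a (Suc i), 1:] * [:- b i, 1:]:] \<in> qmodule (gens k a b)"
proof -
  have l: "varX - const2 c = [:[:- c, 1:]:]" "const2 c - varX = [:[:c, - 1:]:]" for c
    by (simp_all add: varX_def const2_def)
  show "[:[:- a 0, 1:]:] \<in> qmodule (gens k a b)"
    by (rule qmodule_generator) (simp add: gens_def l)
  show "[:[:b (k - 1), - 1:]:] \<in> qmodule (gens k a b)"
    by (rule qmodule_generator) (simp add: gens_def l)
  fix i assume "Suc i < k"
  then have "(varX - const2 (a (Suc i))) * (varX - const2 (b i)) \<in> set (gens k a b)"
    unfolding gens_def by (auto simp: image_iff intro!: bexI[of _ i])
  moreover have "[:[:- a (Suc i), 1:]:] * [:[:- b i, 1:]:] = [:[:- a (Suc i), 1:] * [:- b i, 1:]:]" by simp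
  ultimately show "[:[:- a (Suc i), 1:] * [:- b i, 1:]:] \<in> qmodule (gens k a b)"
    by (intro qmodule_generator) (simp only: l)
qed

theorem theorem2:
  fixes k :: nat and a b :: "nat \<Rightarrow> real"
  assumes "k \<ge> 1"
    and "\<And>i. i < k \<Longrightarrow> a i \<le> b i"
    and "\<And>i. Suc i < k \<Longrightarrow> b i < a (Suc i)"
  shows "\<forall>f :: bpoly.
           (\<forall>x y. x \<in> (\<Union>i<k. {a i..b i}) \<longrightarrow> eval2 f x y \<ge> 0)
           \<longrightarrow> f \<in> qmodule (gens k a b)"
proof (intro allI impI)
  fix f :: bpoly
  define M where "M = qmodule (gens k a b)"
  define U where "U = (\<Union>i<k. {a i..b i})"
  define A B where "A = a 0" and "B = b (k - 1)"
  assume "\<forall>x y. x \<in> (\<Union>i<k. {a i..b i}) \<longrightarrow> eval2 f x y \<ge> 0"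
  then have f: "\<And>x y. x \<in> U \<Longrightarrow> eval2 f x y \<ge> 0" by (simp add: U_def)
  interpret quadratic_module M unfolding M_def by (rule quadratic_module_qmodule)
  have gA: "[:[:- A, 1:]:] \<in> M" and gB: "[:[:B, - 1:]:] \<in> M"
    and gi: "\<And>i. Suc i < k \<Longrightarrow> [:[:- a (Suc i), 1:] * [:- b i, 1:]:] \<in> M"
    using gens_mem[OF assms(1), where a = a and b = b] unfolding M_def A_def B_def by auto
  have Aa: "A \<le> a i" if "i < k" for i
    using that
  proof (induction i)
    case (Suc i)
    then show ?case using assms(2)[of i] assms(3)[of i] by force
  qed (simp add: A_def)
  have bB: "b i \<le> B" if "i < k" for i
  proof -
    have "b (k - 1 - j) \<le> B" if "j < k" for j
      using that
    proof (induction j)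
      case (Suc j)
      have "Suc (k - 1 - Suc j) = k - 1 - j" using Suc.prems by simp
      then show ?case using Suc assms(3)[of "k - 1 - Suc j"] assms(2)[of "k - 1 - j"] by force
    qed (simp add: B_def)
    from this[of "k - 1 - i"] show ?thesis using that by simp
  qed
  have AB: "A \<le> B" using Aa[of 0] assms(1) assms(2)[of 0] bB[of 0] by auto
  have UAB: "U \<subseteq> {A..B}"
  proof
    fix x assume "x \<in> U"
    then obtain i where "i < k" "a i \<le> x" "x \<le> b i" by (auto simp: U_def)
    then show "x \<in> {A..B}" using Aa[of i] bB[of i] by simp
  qed
  have "f \<in> M"
  proof (rule saturated_if_locally[OF AB UAB _ _ f])
    fix p q assume p: "\<And>x. x \<in> {A..B} \<Longrightarrow> poly p x \<ge> 0"
    show "[:p:] * q ^ 2 \<in> M"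
    proof (cases "A < B")
      case True
      then show ?thesis using gA gB p by (intro interval) auto
    next
      case False
      \<comment> \<open>A single point: \<open>x - A\<close> and \<open>A - x\<close> both lie in
        \<open>M\<close>, so all that matters about \<open>p\<close> is its value at
        \<open>A\<close>.\<close>
      then have BA: "B = A" using AB by simp
      define m where "m = poly p A"
      have m: "m \<ge> 0" using p[of A] BA by (simp add: m_def)
      have "poly (p - [:m:]) A = 0" by (simp add: m_def)
      then have "[:- A, 1:] dvd p - [:m:]" by (simp only: poly_eq_0_iff_dvd)
      then obtain r where r: "p - [:m:] = [:- A, 1:] * r" by (rule dvdE)
      obtain P N where PN: "P \<in> sos_deg (degree ([:r:] * q ^ 2))" "N \<in> sos_deg (degree ([:r:] * q ^ 2))"
        "[:r:] * q ^ 2 = P - N"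
        using diff_sos_deg[of "[:r:] * q ^ 2" "degree ([:r:] * q ^ 2)"] by auto
      have e1: "[:[:sqrt m:]:] ^ 2 = [:[:m:]:]" using m by (simp add: power2_eq_square)
      have e2: "[:p:] = [:[:m:]:] + [:[:- A, 1:]:] * [:r:]"
      proof -
        have "p = [:m:] + [:- A, 1:] * r" unfolding r[symmetric] by simp
        then have "[:p:] = [:[:m:] + [:- A, 1:] * r:]" by (rule arg_cong)
        then show ?thesis by simp
      qed
      have e3: "[:[:B, - 1:]:] = - [:[:- A, 1:]:]" by (simp add: BA)
      have "[:p:] * q ^ 2 = [:[:m:]:] * q ^ 2 + [:[:- A, 1:]:] * ([:r:] * q ^ 2)"
        unfolding e2 distrib_right mult.assoc ..
      also have "\<dots> = ([:[:sqrt m:]:] * q) ^ 2 + [:[:- A, 1:]:] * P + [:[:B, - 1:]:] * N"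
        unfolding PN(3) power_mult_distrib e1 e3 right_diff_distrib by (simp only: mult_minus_left add_diff_eq diff_conv_add_uminus add.assoc)
      also have "\<dots> \<in> M" by (intro add square sos_deg_mult[OF PN(1) gA] sos_deg_mult[OF PN(2) gB])
      finally show ?thesis .
    qed
  next
    fix f :: bpoly and d c n
    assume deg: "degree f \<le> 2 * d" and nn: "\<And>x y. x \<in> U \<Longrightarrow> eval2 f x y \<ge> 0" and c: "c \<in> {A..B}"
    \<comment> \<open>\<open>i\<close> will be the last interval that starts at or before
      \<open>c\<close>, so \<open>c\<close> lies in it or to its right, before the next
      interval.\<close>
    define I where "I = {i. i < k \<and> a i \<le> c}"
    have I: "finite I" "0 \<in> I" using assms(1) c by (auto simp: I_def A_def)
    define i where "i = Max I"
    have "i \<in> I" unfolding i_def using I by (intro Max_in) auto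
    then have i: "i < k" "a i \<le> c" by (auto simp: I_def)
    have next_i: "c < a (Suc i)" if "Suc i < k"
    proof (rule ccontr)
      assume "\<not> c < a (Suc i)"
      then have "Suc i \<le> i" unfolding i_def using I(1) that by (intro Max_ge) (auto simp: I_def i_def)
      then show False by simp
    qed
    show "\<exists>g\<in>M. degree g \<le> 2 * d \<and> [:[:- c, 1:] ^ n:] dvd f - g"
    proof (cases "c \<le> b i")
      case True
      have inU: "x \<in> U" if "a i \<le> x" "x \<le> b i" for x using that i by (auto simp: U_def)
      show ?thesis
      proof (rule local_membership[OF deg])
        show "eval2 f c y \<ge> 0" for y using i True by (intro nn inU) auto
        fix \<sigma> :: real assume "\<sigma> \<in> {1, - 1}"
        then consider "\<sigma> = 1" | "\<sigma> = - 1" by blast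
        then show "(\<exists>r>0. \<forall>t y. 0 \<le> t \<longrightarrow> t < r \<longrightarrow> eval2 f (c - \<sigma> * t) y \<ge> 0) \<or>
          (\<forall>n. \<exists>p. [:p:] \<in> M \<and> [:- c, 1:] ^ n dvd p - (lin c \<sigma>))"
        proof cases
          \<comment> \<open>This direction concerns points to the left of \<open>c\<close>. They
            belong to \<open>U\<close> unless \<open>c\<close> is the left end point
            \<open>a i\<close>, where the generator vanishing at \<open>a i\<close> supplies the
            weight \<open>x - c\<close>.\<close>
          case \<sigma>: 1
          show ?thesis
          proof (cases "a i < c")
            case True
            have "\<forall>t y. 0 \<le> t \<longrightarrow> t < c - a i \<longrightarrow> eval2 f (c - \<sigma> * t) y \<ge> 0"
              using \<open>c \<le> b i\<close> by (auto simp: \<sigma> intro!: nn inU)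
            then show ?thesis using True by (intro disjI1 exI[of _ "c - a i"]) auto
          next
            case False
            then have ca: "c = a i" using i by simp
            show ?thesis
            proof (cases i)
              case 0
              then have "c = A" using ca by (simp add: A_def)
              then have "[:[:- c, 1:]:] \<in> M \<and> [:- c, 1:] ^ n dvd [:- c, 1:] - (lin c \<sigma>)" for n
                using gA by (simp add: \<sigma>)
              then show ?thesis by blast
            next
              case (Suc j)
              then have j: "Suc j < k" using i by simp
              have "[:- a (Suc j), 1:] * [:- b j, 1:] = (lin c \<sigma>) * [:- b j, 1:]" by (simp add: \<sigma> ca Suc)
              moreover have "poly [:- b j, 1:] c > 0" using assms(3)[OF j] by (simp add: ca Suc)
              ultimately show ?thesis using weight_from_generator[OF gi[OF j]] by blast
            qed
          qed
        next
          \<comment> \<open>At a right end point \<open>c = b i\<close> before a gap the generator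
            is read as \<open>(c - x) * (a (Suc i) - x)\<close>, whose second factor is positive at
            \<open>c\<close>.\<close>
          case \<sigma>: 2
          show ?thesis
          proof (cases "c < b i")
            case True
            have "\<forall>t y. 0 \<le> t \<longrightarrow> t < b i - c \<longrightarrow> eval2 f (c - \<sigma> * t) y \<ge> 0"
              using i by (auto simp: \<sigma> intro!: nn inU)
            then show ?thesis using True by (intro disjI1 exI[of _ "b i - c"]) auto
          next
            case False
            then have cb: "c = b i" using \<open>c \<le> b i\<close> by simp
            show ?thesis
            proof (cases "Suc i < k")
              case False
              then have "i = k - 1" using i by simp
              then have "c = B" using cb by (simp add: B_def)
              then have "[:[:c, - 1:]:] \<in> M \<and> [:- c, 1:] ^ n dvd [:c, - 1:] - (lin c \<sigma>)" for n
                using gB by (simp add: \<sigma>)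
              then show ?thesis by blast
            next
              case True
              have "[:- a (Suc i), 1:] * [:- b i, 1:] = (lin c \<sigma>) * [:a (Suc i), - 1:]" by (simp add: \<sigma> cb)
              moreover have "poly [:a (Suc i), - 1:] c > 0" using assms(3)[OF True] by (simp add: cb)
              ultimately show ?thesis using weight_from_generator[OF gi[OF True]] by blast
            qed
          qed
        qed
      qed
    next
      case False
      have "Suc i < k"
      proof (rule ccontr)
        assume "\<not> Suc i < k"
        then have "i = k - 1" using i by simp
        then show False using False c by (simp add: B_def)
      qed
      \<comment> \<open>Inside the gap the generator formed from its two end points is
        negative.\<close>
      moreover have "poly ([:- a (Suc i), 1:] * [:- b i, 1:]) c < 0"
      proof -
        have "(c - a (Suc i)) * (c - b i) < 0" using next_i[OF \<open>Suc i < k\<close>] False by (intro mult_neg_pos) auto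
        then show ?thesis by (simp only: poly_mult) (simp add: algebra_simps)
      qed
      ultimately show ?thesis using local_membership_outside[OF deg gi] by blast
    qed
  qed
  then show "f \<in> qmodule (gens k a b)" by (simp add: M_def)
qed

end
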